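(* Let $k\ge 3$ and let $Z_1,Z_2,\dots$ be an infinite sequence of independent random vectors in $\mathbb{R}^d$, identically distributed within the natural exponential family with natural parameter $\theta$, log-partition function $A$, expectation $\mu$, variance function $\Lambda$, and finite moments up to order $k$. For $n\ge1$ let $Y_n=\frac1n(Z_1+\dots+Z_n)$. Then the distribution of $Y_n$ is also in the natural exponential family, parametrized by $\theta_n=n\theta$, with log-partition function $A_n(\theta_n)=nA(\theta_n/n)$, expectation $\mu$ and variance function $\Lambda_n=\Lambda/n$. Moreover, suppose that $\hat\theta_n=n\hat\theta$, where $\hat\theta:\mathbb{R}^d\to\mathbb{R}^d$ does not depend on $n$ and is $k$ times totally differentiable with bounded $k$-th derivative. Then $$\mathrm{DKLA}_n=A_n(\hat\theta_n(Y_n))-\langle Y_n,\hat\theta_n(Y_n)\rangle+\operatorname{tr}\Big(\Lambda_n(Y_n)\,\frac{\partial\hat\theta_n(y)}{\partial y}\Big|_{y=Y_n}\Big)$$ satisfies, as $n\to\infty$ (the expectations involved being assumed finite), $$\mathbb{E}[\mathrm{DKLA}_n]=\mathrm{MKLA}_n-\langle\mu,\theta_n\rangle+A_n(\theta_n)+O(n^{-1}),$$ where $\mathrm{MKLA}_n=\mathbb{E}\big[A_n(\hat\theta_n(Y_n))-A_n(\theta_n)-\langle\nabla A_n(\theta_n),\hat\theta_n(Y_n)-\theta_n\rangle\big]$ is the mean Kullback-Leibler analysis loss associated to $\hat\theta_n$ with respect to $\theta_n$.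
   Context: Natural exponential family (minimal): a family $P_\theta$ with density or mass function $p(y;\theta)=h(y)\exp(\langle y,\theta\rangle-A(\theta))$, $\theta$ in the (open) natural parameter space $\Theta\subseteq\mathbb{R}^d$, with $A$ convex, $\nabla A$ one-to-one, $\mathbb{E}[Z]=\nabla A(\theta)=\mu$ and $\mathrm{Var}[Z]=\nabla\nabla^tA(\theta)$ for $Z\sim P_\theta$. With $\phi=(\nabla A)^{-1}$, the variance function is $\Lambda=(\nabla\nabla^tA)\circ\phi$, so $\mathrm{Var}[Z]=\Lambda(\mu)$; $\Lambda$ is regarded as a $C^\infty$ function $\mathbb{R}^d\to\mathbb{R}^{d\times d}$ (in particular it may be evaluated at $Y_n$). The map $\hat\theta$ takes values in $\Theta$. The mean Kullback-Leibler analysis loss is the expectation of the Kullback-Leibler divergence $D(P_0\|P_1)$ with $P_0$ the true law of $Y_n$ (parameter $\theta_n$) and $P_1$ the member of the family of laws of $Y_n$ with parameter $\hat\theta_n(Y_n)$; by the Bregman formula $D(P_{\theta_0}\|P_{\theta_1})=A(\theta_1)-A(\theta_0)-\langle\nabla A(\theta_0),\theta_1-\theta_0\rangle$ it is the expression given. $\frac{\partial\hat\theta_n(y)}{\partial y}$ is the $d\times d$ Jacobian. In the $O(n^{-1})$ term, $d$, $\theta$, $A$ and $\hat\theta$ are fixed.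
   Formalization: The O(1/n) claim additionally assumes that, for some p>1, E|tr(Λ_n(Y_n) ∂θ̂_n/∂y(Y_n))|^p stays bounded as n→∞; with the expectations merely finite for each n, the claim is false. *)

theory Defs
  imports "HOL-Probability.Probability" "HOL-Library.Landau_Symbols"
begin

definition grad :: "('a::real_inner \<Rightarrow> real) \<Rightarrow> 'a \<Rightarrow> 'a" where
  "grad f x = (THE D. GDERIV f x :> D)"

definition hessian :: "(real^'n \<Rightarrow> real) \<Rightarrow> real^'n \<Rightarrow> real^'n^'n" where
  "hessian f x = jacobian (grad f) (at x)"

definition mean :: "'a::{banach, second_countable_topology} measure \<Rightarrow> 'a" where
  "mean N = (\<integral>y. y \<partial>N)"

definition covariance_matrix :: "(real^'n) measure \<Rightarrow> real^'n^'n" where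
  "covariance_matrix N = (\<chi> i j. \<integral>y. (y $ i - mean N $ i) * (y $ j - mean N $ j) \<partial>N)"

text \<open>
  \<open>total_deriv f vs x\<close> is the total derivative of order \<open>length vs\<close> of \<open>f\<close> at \<open>x\<close>, evaluated on the
  directions \<open>vs\<close>. The space of \<open>m\<close>-linear maps depends on \<open>m\<close>, so it cannot serve as a
  codomain here; since the domain is finite-dimensional, a map into that space is totally
  differentiable iff its evaluation at every tuple of directions is.
\<close>

primrec total_deriv ::
  "('a::real_normed_vector \<Rightarrow> 'b::real_normed_vector) \<Rightarrow> 'a list \<Rightarrow> 'a \<Rightarrow> 'b" where
  "total_deriv f [] = f"
| "total_deriv f (v # vs) = (\<lambda>x. frechet_derivative (total_deriv f vs) (at x) v)"

definition times_differentiable ::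
  "nat \<Rightarrow> ('a::euclidean_space \<Rightarrow> 'b::real_normed_vector) \<Rightarrow> bool" where
  "times_differentiable k f \<longleftrightarrow>
     (\<forall>vs. length vs < k \<longrightarrow> (\<forall>x. total_deriv f vs differentiable (at x)))"

definition bounded_total_deriv ::
  "nat \<Rightarrow> ('a::euclidean_space \<Rightarrow> 'b::real_normed_vector) \<Rightarrow> bool" where
  "bounded_total_deriv k f \<longleftrightarrow>
     (\<exists>C. \<forall>x vs. length vs = k \<longrightarrow> norm (total_deriv f vs x) \<le> C * prod_list (map norm vs))"

definition smooth :: "('a::euclidean_space \<Rightarrow> 'b::real_normed_vector) \<Rightarrow> bool" where
  "smooth f \<longleftrightarrow> (\<forall>m. times_differentiable m f)"

text \<open>
  Reference measures: Lebesgue measure (so that \<open>p\<close> is a density), or the counting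
  measure of a countable set, regarded as a Borel measure (so that \<open>p\<close> is a mass function).
\<close>

definition reference_measure :: "(real^'n) measure \<Rightarrow> bool" where
  "reference_measure \<nu> \<longleftrightarrow>
     \<nu> = lborel \<or> (\<exists>S. countable S \<and> \<nu> = distr (count_space S) borel (\<lambda>y. y))"

definition nef_law ::
  "(real^'n) measure \<Rightarrow> (real^'n \<Rightarrow> real) \<Rightarrow> (real^'n \<Rightarrow> real) \<Rightarrow> real^'n \<Rightarrow> (real^'n) measure" where
  "nef_law \<nu> h A \<theta> = density \<nu> (\<lambda>y. ennreal (h y * exp (y \<bullet> \<theta> - A \<theta>)))"

text \<open>
  Minimal natural exponential family with natural parameter space \<open>\<Theta>\<close> (the set of
  all parameters at which the unnormalised density is integrable). Convexity, differentiability of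
  \<open>A\<close> and the moment identities hold for every such family with \<open>\<Theta>\<close> open; they are listed because
  they belong to the notion as used here. Minimality is injectivity of the gradient map.
\<close>

definition natural_exp_family ::
  "(real^'n) measure \<Rightarrow> (real^'n \<Rightarrow> real) \<Rightarrow> (real^'n) set \<Rightarrow> (real^'n \<Rightarrow> real) \<Rightarrow> bool" where
  "natural_exp_family \<nu> h \<Theta> A \<longleftrightarrow>
     reference_measure \<nu> \<and>
     h \<in> borel_measurable borel \<and> (\<forall>y. 0 \<le> h y) \<and>
     \<Theta> \<noteq> {} \<and> open \<Theta> \<and>
     \<Theta> = {\<theta>. (\<integral>\<^sup>+y. ennreal (h y * exp (y \<bullet> \<theta>)) \<partial>\<nu>) < \<infinity>} \<and>
     (\<forall>\<theta>\<in>\<Theta>. prob_space (nef_law \<nu> h A \<theta>)) \<and>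
     convex_on \<Theta> A \<and>
     (\<forall>\<theta>\<in>\<Theta>. A differentiable (at \<theta>) \<and> grad A differentiable (at \<theta>)) \<and>
     inj_on (grad A) \<Theta> \<and>
     (\<forall>\<theta>\<in>\<Theta>. integrable (nef_law \<nu> h A \<theta>) (\<lambda>y. (norm y)\<^sup>2) \<and>
             mean (nef_law \<nu> h A \<theta>) = grad A \<theta> \<and>
             covariance_matrix (nef_law \<nu> h A \<theta>) = hessian A \<theta>)"

text \<open>
  The variance function is determined on the mean space, the image of \<open>\<Theta>\<close> under the gradient map; a
  function on the whole space is a variance function if it extends it.
\<close>

definition is_variance_function ::
  "(real^'n) set \<Rightarrow> (real^'n \<Rightarrow> real) \<Rightarrow> (real^'n \<Rightarrow> real^'n^'n) \<Rightarrow> bool" where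
  "is_variance_function \<Theta> A \<Lambda> \<longleftrightarrow>
     (\<forall>m \<in> grad A ` \<Theta>. \<Lambda> m = hessian A (the_inv_into \<Theta> (grad A) m))"

definition sample_mean :: "(nat \<Rightarrow> 'w \<Rightarrow> real^'n) \<Rightarrow> nat \<Rightarrow> 'w \<Rightarrow> real^'n" where
  "sample_mean Z n \<omega> = (1 / real n) *\<^sub>R (\<Sum>i=1..n. Z i \<omega>)"

definition scaled_log_partition :: "(real^'n \<Rightarrow> real) \<Rightarrow> nat \<Rightarrow> real^'n \<Rightarrow> real" where
  "scaled_log_partition A n \<eta> = real n * A ((1 / real n) *\<^sub>R \<eta>)"

text \<open>
  \<open>trace_term\<close> is the last summand of \<open>DKLA\<close>. It has a name of its own because its finite
  expectation for every \<open>n\<close> does not prevent \<open>E[trace_term]\<close> from being unbounded in \<open>n\<close> (\<open>\<Lambda>\<close> may grow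
  arbitrarily fast), so the first-order expansion needs an integrability condition on it that
  is uniform for large \<open>n\<close>.
\<close>

definition trace_term ::
  "(real^'n \<Rightarrow> real^'n^'n) \<Rightarrow> (real^'n \<Rightarrow> real^'n) \<Rightarrow> real^'n \<Rightarrow> real" where
  "trace_term \<Lambda> T y = trace (\<Lambda> y ** jacobian T (at y))"

definition DKLA ::
  "(real^'n \<Rightarrow> real) \<Rightarrow> (real^'n \<Rightarrow> real^'n^'n) \<Rightarrow> (real^'n \<Rightarrow> real^'n) \<Rightarrow> real^'n \<Rightarrow> real" where
  "DKLA A \<Lambda> T y = A (T y) - y \<bullet> T y + trace_term \<Lambda> T y"

definition KLA_loss ::
  "(real^'n \<Rightarrow> real) \<Rightarrow> real^'n \<Rightarrow> (real^'n \<Rightarrow> real^'n) \<Rightarrow> real^'n \<Rightarrow> real" where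
  "KLA_loss A \<theta> T y = A (T y) - A \<theta> - grad A \<theta> \<bullet> (T y - \<theta>)"

end

theory Submission
  imports Defs
begin

text \<open>
  Exponential tilting by \<open>\<delta>\<close> of one observation corresponds to tilting by \<open>n \<delta>\<close> of the sample mean,
  so the laws of the sample mean form an exponential family as soon as one of them has a density
  with respect to a reference measure.

  Write \<open>g\<close> for the estimator and \<open>F y = tr (\<Lambda> y (Dg) y)\<close>. After cancellation the claim reads
  \<open>E F(Y) - n E \<langle>Y - \<mu>, g Y\<rangle> = O(1/n)\<close>. Both terms equal \<open>F \<mu> + O(1/n)\<close>: for the second,
  expand \<open>g\<close> at \<open>\<mu>\<close>; the linear part gives \<open>F \<mu>\<close> because \<open>Var Y = \<Lambda> \<mu> / n\<close>, the quadratic part is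
  a third centred moment of a mean, hence \<open>O(1/n\<^sup>2)\<close>, and the remainder is at least quartic in
  \<open>Y - \<mu>\<close>. For the first, expand \<open>F\<close> near \<open>\<mu>\<close>; the uniform \<open>L\<^sup>p\<close> bound makes the event that \<open>Y\<close> is far
  from \<open>\<mu>\<close> negligible. All moments of \<open>Y - \<mu>\<close> are finite with the rate \<open>n powr (- r / 2)\<close> since
  the natural parameter space is open.
\<close>

section \<open>Second-order expansions and total derivatives\<close>

text \<open>The factor n in front of the inner product decides how sharp each estimate must be.
  Absolute moments bound the cubic contribution only by n powr (- 3 / 2), which would leave an error
  n powr (- 1 / 2); the exact third moment of a sum of independent centred vectors recovers the
  missing half power. The estimator has a bounded k-th derivative, hence polynomial growth and a
  global Taylor estimate, whereas \<Lambda> may grow arbitrarily, so that F can be expanded only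
  locally; hence two kinds of Taylor estimate.

  The law of the mean poses a different problem: a family must have Lebesgue measure or a countable
  counting measure as reference, and its parameter space must be exactly the set where the Laplace
  integral is finite. So absolute continuity has to survive averaging in both cases, and finiteness
  has to be transported in both directions, through integrals that may be infinite.\<close>

lemma differentiable_imp_locally_lipschitz:
  fixes g :: "'a::real_normed_vector \<Rightarrow> 'b::real_normed_vector"
  assumes "g differentiable (at x)"
  shows "\<exists>C\<ge>0. \<forall>\<^sub>F y in nhds x. norm (g y - g x) \<le> C * norm (y - x)"
proof -
  obtain g' where g': "(g has_derivative g') (at x)"
    using assms by (auto simp: differentiable_def)
  then interpret g': bounded_linear g' by (rule has_derivative_bounded_linear)
  obtain K where K: "K \<ge> 0" "\<And>v. norm (g' v) \<le> norm v * K"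
    using g'.nonneg_bounded by auto
  obtain d where d: "d > 0" "\<And>y. norm (y - x) < d \<Longrightarrow> norm (g y - g x - g' (y - x)) \<le> 1 * norm (y - x)"
    using g'[unfolded has_derivative_at_alt] zero_less_one by blast
  \<comment> \<open>\<open>K\<close> bounds the derivative as a linear map, and 1 is the error that
    differentiability allows for epsilon 1.\<close>
  have "norm (g y - g x) \<le> (K + 1) * norm (y - x)" if "dist y x < d" for y
  proof -
    have "norm (g y - g x) \<le> norm (g y - g x - g' (y - x)) + norm (g' (y - x))"
      by norm
    with d(2)[of y] K(2)[of "y - x"] that show ?thesis
      by (simp add: dist_norm algebra_simps)
  qed
  with d(1) K(1) show ?thesis
    by (intro exI[of _ "K + 1"]) (auto simp: eventually_nhds_metric)
qed

text \<open>
  Peano form of the expansion: only the behaviour near \<open>x\<close> matters, which makes the notion closed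
  under products and available for a log-partition function with a mere second derivative at \<open>\<theta>\<close>.
\<close>

definition second_order_at ::
  "('a::real_normed_vector \<Rightarrow> 'b::real_normed_vector) \<Rightarrow> ('a \<Rightarrow> 'b) \<Rightarrow> 'a \<Rightarrow> bool" where
  "second_order_at f L x \<longleftrightarrow> bounded_linear L \<and>
     (\<exists>C\<ge>0. \<forall>\<^sub>F y in nhds x. norm (f y - f x - L (y - x)) \<le> C * (norm (y - x))\<^sup>2)"

text \<open>The map \<open>f - f' x\<close> has derivative \<open>f' z - f' x\<close> at z, of size
  |z - x| because its values on the basis are differentiable at x; the mean value inequality turns
  this into a quadratic error. This fits a log-partition function, whose gradient is assumed
  differentiable at each parameter.\<close>

lemma second_order_atI:
  fixes f :: "'a::euclidean_space \<Rightarrow> 'b::real_normed_vector"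
  assumes der: "\<forall>\<^sub>F y in nhds x. (f has_derivative f' y) (at y)"
    and diff: "\<And>b. b \<in> Basis \<Longrightarrow> (\<lambda>y. f' y b) differentiable (at x)"
  shows "second_order_at f (f' x) x"
proof -
  have "\<forall>b\<in>Basis. \<exists>C\<ge>0. \<forall>\<^sub>F y in nhds x. norm (f' y b - f' x b) \<le> C * norm (y - x)"
    using differentiable_imp_locally_lipschitz[OF diff] by blast
  then obtain C where C: "\<And>b. b \<in> Basis \<Longrightarrow> C b \<ge> 0"
    "\<And>b. b \<in> Basis \<Longrightarrow> \<forall>\<^sub>F y in nhds x. norm (f' y b - f' x b) \<le> C b * norm (y - x)"
    by metis
  have "\<forall>\<^sub>F y in nhds x. (f has_derivative f' y) (at y) \<and>
      (\<forall>b\<in>Basis. norm (f' y b - f' x b) \<le> C b * norm (y - x))"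
    using der C(2) by (auto simp: eventually_conj_iff eventually_ball_finite_distrib)
  then obtain d where d: "d > 0" "\<And>y. dist y x < d \<Longrightarrow> (f has_derivative f' y) (at y)"
    "\<And>y b. dist y x < d \<Longrightarrow> b \<in> Basis \<Longrightarrow> norm (f' y b - f' x b) \<le> C b * norm (y - x)"
    by (auto simp: eventually_nhds_metric)
  have lin: "bounded_linear (f' y)" if "dist y x < d" for y
    using d(2)[OF that] has_derivative_bounded_linear by blast
  have x: "bounded_linear (f' x)" using lin d(1) by simp
  let ?C = "\<Sum>b\<in>Basis. C b"
  \<comment> \<open>Lipschitz bounds on the finitely many basis vectors add up to a bound for the
    whole linear map.\<close>
  have opbound: "norm (f' y v - f' x v) \<le> ?C * norm (y - x) * norm v" if "dist y x < d" for y v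
  proof -
    interpret D: bounded_linear "\<lambda>v. f' y v - f' x v"
      using lin[OF that] x by (rule bounded_linear_sub)
    have "f' y v - f' x v = (\<Sum>b\<in>Basis. (v \<bullet> b) *\<^sub>R (f' y b - f' x b))"
      using D.sum[of "\<lambda>b. (v \<bullet> b) *\<^sub>R b" Basis] by (simp add: D.scaleR euclidean_representation)
    also have "norm \<dots> \<le> (\<Sum>b\<in>Basis. norm v * (C b * norm (y - x)))"
      using d(3)[OF that] Basis_le_norm
      by (intro sum_norm_le) (auto intro!: mult_mono)
    finally show ?thesis by (simp add: sum_distrib_left sum_distrib_right mult_ac)
  qed
  have "norm (f y - f x - f' x (y - x)) \<le> ?C * (norm (y - x))\<^sup>2" if y: "dist y x < d" for y
  proof -
    \<comment> \<open>The closed ball of radius |y - x| about x is convex, contains both end points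
      and stays inside the neighbourhood of radius d.\<close>
    have "norm ((f y - f' x y) - (f x - f' x x)) \<le> (?C * norm (y - x)) * norm (y - x)"
    proof (rule differentiable_bound[where f' = "\<lambda>z v. f' z v - f' x v" and S = "cball x (norm (y - x))"])
      fix z assume z: "z \<in> cball x (norm (y - x))"
      then have zd: "dist z x < d" "norm (z - x) \<le> norm (y - x)"
        using y by (auto simp: dist_norm norm_minus_commute)
      show "((\<lambda>y. f y - f' x y) has_derivative (\<lambda>v. f' z v - f' x v)) (at z within cball x (norm (y - x)))"
        by (intro has_derivative_diff has_derivative_at_withinI[OF d(2)[OF zd(1)]]
            bounded_linear_imp_has_derivative[OF x])
      show "onorm (\<lambda>v. f' z v - f' x v) \<le> ?C * norm (y - x)"
      proof (rule onorm_bound)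
        show "norm (f' z v - f' x v) \<le> ?C * norm (y - x) * norm v" for v
        proof -
          have "?C * norm (z - x) * norm v \<le> ?C * norm (y - x) * norm v"
            using zd(2) C(1) by (intro mult_right_mono mult_left_mono sum_nonneg) auto
          with opbound[OF zd(1), of v] show ?thesis by linarith
        qed
      qed (use C(1) in \<open>auto intro!: mult_nonneg_nonneg sum_nonneg\<close>)
    qed (auto simp: dist_norm norm_minus_commute)
    moreover have "(f y - f' x y) - (f x - f' x x) = f y - f x - f' x (y - x)"
      using x by (simp add: linear_diff bounded_linear.linear)
    ultimately show ?thesis by (simp add: power2_eq_square mult_ac)
  qed
  then have "\<forall>\<^sub>F y in nhds x. norm (f y - f x - f' x (y - x)) \<le> ?C * (norm (y - x))\<^sup>2"
    using d(1) by (auto simp: eventually_nhds_metric)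
  moreover have "?C \<ge> 0" using C(1) by (rule sum_nonneg)
  ultimately show ?thesis using x unfolding second_order_at_def by blast
qed

lemma second_order_at_compose_bounded_linear:
  assumes f: "second_order_at f L x" and T: "bounded_linear T"
  shows "second_order_at (\<lambda>y. T (f y)) (\<lambda>v. T (L v)) x"
proof -
  interpret T: bounded_linear T by fact
  obtain C where C: "C \<ge> 0" "\<forall>\<^sub>F y in nhds x. norm (f y - f x - L (y - x)) \<le> C * (norm (y - x))\<^sup>2"
    and L: "bounded_linear L"
    using f by (auto simp: second_order_at_def)
  obtain K where K: "K \<ge> 0" "\<And>v. norm (T v) \<le> norm v * K"
    using T.nonneg_bounded by auto
  have bound: "norm (T u) \<le> K * C * r" if "norm u \<le> C * r" for u r
  proof -
    have "norm (T u) \<le> norm u * K" by (rule K)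
    also have "\<dots> \<le> (C * r) * K" using that K(1) by (rule mult_right_mono)
    finally show ?thesis by (simp add: mult_ac)
  qed
  have "\<forall>\<^sub>F y in nhds x. norm (T (f y) - T (f x) - T (L (y - x))) \<le> K * C * (norm (y - x))\<^sup>2"
    using C(2) by eventually_elim (use bound in \<open>simp flip: T.diff\<close>)
  with bounded_linear_compose[OF T L] C(1) K(1) show ?thesis
    unfolding second_order_at_def by (auto intro!: exI[of _ "K * C"])
qed

lemma second_order_at_const: "second_order_at (\<lambda>_. c) (\<lambda>_. 0) x"
  by (auto simp: second_order_at_def)

lemma second_order_at_add:
  assumes "second_order_at f L x" "second_order_at g N x"
  shows "second_order_at (\<lambda>y. f y + g y) (\<lambda>v. L v + N v) x"
proof -
  obtain C D where *: "C \<ge> 0" "\<forall>\<^sub>F y in nhds x. norm (f y - f x - L (y - x)) \<le> C * (norm (y - x))\<^sup>2"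
    "D \<ge> 0" "\<forall>\<^sub>F y in nhds x. norm (g y - g x - N (y - x)) \<le> D * (norm (y - x))\<^sup>2"
    using assms by (auto simp: second_order_at_def)
  have bound: "norm (a + a' - (b + b') - (c + c')) \<le> (C + D) * r"
    if "norm (a - b - c) \<le> C * r" "norm (a' - b' - c') \<le> D * r" for a a' b b' c c' :: 'b and r
  proof -
    have "norm ((a - b - c) + (a' - b' - c')) \<le> C * r + D * r"
      using that by (rule norm_triangle_mono)
    then show ?thesis by (simp add: algebra_simps)
  qed
  have "\<forall>\<^sub>F y in nhds x. norm (f y + g y - (f x + g x) - (L (y - x) + N (y - x)))
      \<le> (C + D) * (norm (y - x))\<^sup>2"
    using *(2) *(4) by eventually_elim (rule bound)
  with assms *(1,3) show ?thesis
    unfolding second_order_at_def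
    by (intro conjI exI[of _ "C + D"]) (auto intro: bounded_linear_add)
qed

lemma second_order_at_sum:
  assumes "\<And>i. i \<in> I \<Longrightarrow> second_order_at (f i) (L i) x"
  shows "second_order_at (\<lambda>y. \<Sum>i\<in>I. f i y) (\<lambda>v. \<Sum>i\<in>I. L i v) x"
  using assms
  by (induction I rule: infinite_finite_induct)
    (simp_all add: second_order_at_const second_order_at_add)

text \<open>Within distance 1 of x the linear parts and the remainders of both factors are bounded,
  so each term of the product beyond the linearisation is a bounded multiple of something
  quadratic.\<close>

lemma second_order_at_mult:
  fixes f g :: "'a::real_normed_vector \<Rightarrow> real"
  assumes f: "second_order_at f L x" and g: "second_order_at g N x"
  shows "second_order_at (\<lambda>y. f y * g y) (\<lambda>v. f x * N v + L v * g x) x"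
proof -
  obtain C D where C: "C \<ge> 0" "\<forall>\<^sub>F y in nhds x. norm (f y - f x - L (y - x)) \<le> C * (norm (y - x))\<^sup>2"
    and D: "D \<ge> 0" "\<forall>\<^sub>F y in nhds x. norm (g y - g x - N (y - x)) \<le> D * (norm (y - x))\<^sup>2"
    and L: "bounded_linear L" and N: "bounded_linear N"
    using assms by (auto simp: second_order_at_def)
  obtain K where K: "K \<ge> 0" "\<And>v. \<bar>L v\<bar> \<le> norm v * K"
    using bounded_linear.nonneg_bounded[OF L] by auto
  obtain J where J: "J \<ge> 0" "\<And>v. \<bar>N v\<bar> \<le> norm v * J"
    using bounded_linear.nonneg_bounded[OF N] by auto
  let ?E = "C * (\<bar>g x\<bar> + J + D) + K * J + (\<bar>f x\<bar> + K) * D"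
  have near: "\<forall>\<^sub>F y in nhds x. norm (y - x) < 1"
    by (auto simp: eventually_nhds_metric dist_norm intro!: exI[of _ 1])
  have bound: "norm (f y * g y - f x * g x - (f x * N (y - x) + L (y - x) * g x)) \<le> ?E * (norm (y - x))\<^sup>2"
    if "norm (f y - f x - L (y - x)) \<le> C * (norm (y - x))\<^sup>2"
      "norm (g y - g x - N (y - x)) \<le> D * (norm (y - x))\<^sup>2" "norm (y - x) < 1" for y
  proof -
    define r where "r = norm (y - x)"
    define a where "a = f y - f x - L (y - x)"
    define b where "b = g y - g x - N (y - x)"
    have r: "0 \<le> r" "r \<le> 1" using that(3) by (auto simp: r_def)
    then have r2: "r\<^sup>2 \<le> r" "r\<^sup>2 \<le> 1" "0 \<le> r\<^sup>2" by (auto simp: power2_eq_square mult_left_le mult_le_one)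
    have ab: "\<bar>a\<bar> \<le> C * r\<^sup>2" "\<bar>b\<bar> \<le> D * r\<^sup>2" using that by (auto simp: a_def b_def r_def)
    have LN: "\<bar>L (y - x)\<bar> \<le> r * K" "\<bar>N (y - x)\<bar> \<le> r * J" using K(2) J(2) by (auto simp: r_def)
    have L1: "\<bar>L (y - x)\<bar> \<le> K" "\<bar>N (y - x)\<bar> \<le> J"
      using LN mult_left_le_one_le[OF K(1) r] mult_left_le_one_le[OF J(1) r] by linarith+
    have b1: "\<bar>b\<bar> \<le> D" using ab(2) mult_left_le[OF r2(2) D(1)] by linarith
    \<comment> \<open>Every term outside the linearisation contains a remainder \<open>a\<close> or
      \<open>b\<close>, or is the product of the two linear parts; these are the three summands of
      \<open>?E\<close>.\<close>
    have eq: "f y * g y - f x * g x - (f x * N (y - x) + L (y - x) * g x)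
      = a * (g x + N (y - x) + b) + L (y - x) * N (y - x) + (f x + L (y - x)) * b"
      by (simp add: a_def b_def algebra_simps)
    have t1: "\<bar>a * (g x + N (y - x) + b)\<bar> \<le> (C * r\<^sup>2) * (\<bar>g x\<bar> + J + D)"
      unfolding abs_mult using ab(1) L1 b1 C(1) r2 by (intro mult_mono) auto
    have t2: "\<bar>L (y - x) * N (y - x)\<bar> \<le> (r * K) * (r * J)"
      unfolding abs_mult using LN K(1) J(1) r by (intro mult_mono) auto
    have t3: "\<bar>(f x + L (y - x)) * b\<bar> \<le> (\<bar>f x\<bar> + K) * (D * r\<^sup>2)"
      unfolding abs_mult using ab(2) L1 K(1) by (intro mult_mono) auto
    have "\<bar>a * (g x + N (y - x) + b) + L (y - x) * N (y - x) + (f x + L (y - x)) * b\<bar>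
        \<le> (C * r\<^sup>2) * (\<bar>g x\<bar> + J + D) + (r * K) * (r * J) + (\<bar>f x\<bar> + K) * (D * r\<^sup>2)"
      using t1 t2 t3 by linarith
    also have "\<dots> = ?E * r\<^sup>2" by (simp add: algebra_simps power2_eq_square)
    finally show ?thesis by (simp only: eq r_def real_norm_def)
  qed
  have "\<forall>\<^sub>F y in nhds x. norm (f y * g y - f x * g x - (f x * N (y - x) + L (y - x) * g x))
      \<le> ?E * (norm (y - x))\<^sup>2"
    using C(2) D(2) near by eventually_elim (rule bound)
  moreover have "bounded_linear (\<lambda>v. f x * N v + L v * g x)"
    using L N by (intro bounded_linear_add bounded_linear_const_mult bounded_linear_mult_const)
  moreover have "?E \<ge> 0" using C(1) D(1) K(1) J(1) by auto
  ultimately show ?thesis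
    unfolding second_order_at_def by blast
qed

section \<open>Iterated directional derivatives and Taylor expansion\<close>

lemma times_differentiableD:
  "times_differentiable k f \<Longrightarrow> length vs < k \<Longrightarrow> total_deriv f vs differentiable (at x)"
  by (auto simp: times_differentiable_def)

lemma times_differentiable_mono: "times_differentiable k f \<Longrightarrow> j \<le> k \<Longrightarrow> times_differentiable j f"
  by (auto simp: times_differentiable_def)

text \<open>The head of the list is the direction differentiated last, so a suffix is a derivative
  taken beforehand and the list can be peeled from either end.\<close>

lemma total_deriv_append: "total_deriv f (us @ vs) = total_deriv (total_deriv f vs) us"
  by (induction us) auto

lemma times_differentiable_total_deriv:
  "times_differentiable k f \<Longrightarrow> times_differentiable (k - length vs) (total_deriv f vs)"
  unfolding times_differentiable_def total_deriv_append[symmetric] by auto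

lemma has_derivative_total_deriv:
  assumes "times_differentiable k f" "length vs < k"
  shows "(total_deriv f vs has_derivative (\<lambda>v. total_deriv f (v # vs) x)) (at x)"
  using times_differentiableD[OF assms] by (simp add: frechet_derivative_works)

text \<open>The chosen \<open>frechet_derivative\<close> is known to be linear in the function only
  where the summands are differentiable; the hypothesis secures this for every order below
  \<open>length vs\<close>.\<close>

lemma total_deriv_sum_scaleR:
  assumes "\<And>b. b \<in> B \<Longrightarrow> times_differentiable (length vs) (F b)"
  shows "total_deriv (\<lambda>x. \<Sum>b\<in>B. c b *\<^sub>R F b x) vs = (\<lambda>x. \<Sum>b\<in>B. c b *\<^sub>R total_deriv (F b) vs x)"
  using assms
proof (induction vs)
  case (Cons v vs)
  have IH: "total_deriv (\<lambda>x. \<Sum>b\<in>B. c b *\<^sub>R F b x) vs = (\<lambda>x. \<Sum>b\<in>B. c b *\<^sub>R total_deriv (F b) vs x)"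
    by (intro Cons.IH times_differentiable_mono[OF Cons.prems]) auto
  show ?case
  proof
    fix x
    have "((\<lambda>x. \<Sum>b\<in>B. c b *\<^sub>R total_deriv (F b) vs x) has_derivative
        (\<lambda>v. \<Sum>b\<in>B. c b *\<^sub>R total_deriv (F b) (v # vs) x)) (at x)"
      using Cons.prems by (intro has_derivative_sum has_derivative_scaleR_right has_derivative_total_deriv) auto
    from frechet_derivative_at[OF this, symmetric]
    show "total_deriv (\<lambda>x. \<Sum>b\<in>B. c b *\<^sub>R F b x) (v # vs) x = (\<Sum>b\<in>B. c b *\<^sub>R total_deriv (F b) (v # vs) x)"
      by (simp add: IH)
  qed
qed simp

text \<open>Linearity in an inner slot: the derivative along \<open>v\<close> is linear in
  \<open>v\<close>, and the outer directions \<open>us\<close> then act on a finite combination with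
  constant coefficients.\<close>

lemma total_deriv_Basis_expansion:
  assumes f: "times_differentiable k f" and len: "length us + length vs < k"
  shows "total_deriv f (us @ v # vs) x = (\<Sum>b\<in>Basis. (v \<bullet> b) *\<^sub>R total_deriv f (us @ b # vs) x)"
proof -
  have *: "total_deriv f (v # vs) = (\<lambda>x. \<Sum>b\<in>Basis. (v \<bullet> b) *\<^sub>R total_deriv f (b # vs) x)"
  proof
    fix x
    have "linear (\<lambda>v. total_deriv f (v # vs) x)"
      using has_derivative_linear[OF has_derivative_total_deriv[OF f]] len by auto
    from linear_sum[OF this, of "\<lambda>b. (v \<bullet> b) *\<^sub>R b" Basis] linear_scale[OF this]
    show "total_deriv f (v # vs) x = (\<Sum>b\<in>Basis. (v \<bullet> b) *\<^sub>R total_deriv f (b # vs) x)"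
      by (simp only: euclidean_representation)
  qed
  have "times_differentiable (length us) (total_deriv f (b # vs))" for b
    using times_differentiable_mono[OF times_differentiable_total_deriv[OF f, of "b # vs"]] len by simp
  then show ?thesis
    unfolding total_deriv_append[of f us] * by (subst total_deriv_sum_scaleR) auto
qed

text \<open>Multilinear maps on a finite-dimensional space are bounded. The induction removes the
  last entry, the direction differentiated first, because the derivative along a fixed basis vector
  is again a function to which the induction hypothesis applies.\<close>

lemma total_deriv_pointwise_bound:
  fixes f :: "'a::euclidean_space \<Rightarrow> 'b::real_normed_vector"
  assumes "times_differentiable m f"
  shows "\<exists>C\<ge>0. \<forall>vs. length vs = m \<longrightarrow> norm (total_deriv f vs x) \<le> C * prod_list (map norm vs)"
  using assms
proof (induction m arbitrary: f)
  case 0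
  then show ?case by (intro exI[of _ "norm (f x)"]) auto
next
  case (Suc m)
  have "\<exists>C\<ge>0. \<forall>vs. length vs = m \<longrightarrow>
      norm (total_deriv (total_deriv f [b]) vs x) \<le> C * prod_list (map norm vs)" for b
    using times_differentiable_total_deriv[OF Suc.prems, of "[b]"] by (intro Suc.IH) simp
  then obtain C where C: "\<And>b. C b \<ge> 0" "\<And>b vs. length vs = m \<Longrightarrow>
      norm (total_deriv (total_deriv f [b]) vs x) \<le> C b * prod_list (map norm vs)"
    by metis
  have "norm (total_deriv f vs x) \<le> (\<Sum>b\<in>Basis. C b) * prod_list (map norm vs)" if vs_len: "length vs = Suc m" for vs
  proof -
    obtain us v where vs: "vs = us @ [v]" using vs_len by (cases vs rule: rev_cases) auto
    have len: "length us = m" using vs_len vs by simp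
    have "total_deriv f vs x = (\<Sum>b\<in>Basis. (v \<bullet> b) *\<^sub>R total_deriv (total_deriv f [b]) us x)"
      unfolding vs using total_deriv_Basis_expansion[OF Suc.prems, of us "[]" v x] len
      by (simp add: total_deriv_append)
    also have "norm \<dots> \<le> (\<Sum>b\<in>Basis. norm v * (C b * prod_list (map norm us)))"
      using C(2)[OF len] Basis_le_norm by (intro sum_norm_le) (auto intro!: mult_mono)
    finally show ?thesis by (simp add: vs sum_distrib_left sum_distrib_right mult_ac)
  qed
  then show ?case using C(1) by (intro exI[of _ "\<Sum>b\<in>Basis. C b"]) (auto intro: sum_nonneg)
qed

lemma prod_list_map_replicate: "prod_list (map f (replicate m v)) = f v ^ m"
  for f :: "'a \<Rightarrow> 'b::comm_monoid_mult"
  by (induction m) auto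

lemma times_differentiable_imp_second_order_at:
  fixes f :: "'a::euclidean_space \<Rightarrow> 'b::real_normed_vector"
  assumes "times_differentiable 2 f"
  shows "second_order_at f (frechet_derivative f (at x)) x"
proof (rule second_order_atI)
  show "\<forall>\<^sub>F y in nhds x. (f has_derivative frechet_derivative f (at y)) (at y)"
    using has_derivative_total_deriv[OF assms, of "[]"] by simp
  show "(\<lambda>y. frechet_derivative f (at y) b) differentiable (at x)" for b
    using times_differentiableD[OF assms, of "[b]"] by simp
qed

text \<open>Along the segment from x to x + v, pairing with v gives a scalar function, for which the
  Lagrange form of the remainder is available. The orders 3 to k - 1 are derivatives at x, hence
  bounded multilinear maps; the order k sits at an unknown point of the segment, which is where the
  global bound enters. Pairing raises each degree in v by one, so the error ranges from degree 4 to
  degree k + 1.\<close>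

lemma taylor_inner_expansion:
  fixes g :: "'a::euclidean_space \<Rightarrow> 'a"
  assumes diff: "times_differentiable k g" and bdd: "bounded_total_deriv k g" and k: "k \<ge> 3"
  shows "\<exists>C\<ge>0. \<forall>v. \<bar>g (x + v) \<bullet> v - g x \<bullet> v - total_deriv g [v] x \<bullet> v - (total_deriv g [v, v] x \<bullet> v) / 2\<bar>
    \<le> C * (norm v ^ 4 + norm v ^ (k + 1))"
proof -
  obtain B where B: "\<And>x vs. length vs = k \<Longrightarrow> norm (total_deriv g vs x) \<le> B * prod_list (map norm vs)"
    using bdd by (auto simp: bounded_total_deriv_def)
  have "\<forall>m\<in>{3..<k}. \<exists>C\<ge>0. \<forall>vs. length vs = m \<longrightarrow> norm (total_deriv g vs x) \<le> C * prod_list (map norm vs)"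
    by (intro ballI total_deriv_pointwise_bound times_differentiable_mono[OF diff]) auto
  then obtain C where C: "\<And>m. m \<in> {3..<k} \<Longrightarrow> C m \<ge> 0"
    "\<And>m vs. m \<in> {3..<k} \<Longrightarrow> length vs = m \<Longrightarrow> norm (total_deriv g vs x) \<le> C m * prod_list (map norm vs)"
    by metis
  have "\<bar>g (x + v) \<bullet> v - g x \<bullet> v - total_deriv g [v] x \<bullet> v - (total_deriv g [v, v] x \<bullet> v) / 2\<bar>
    \<le> (sum C {3..<k} + \<bar>B\<bar>) * (norm v ^ 4 + norm v ^ (k + 1))" for v
  proof -
    define \<phi> where "\<phi> m t = total_deriv g (replicate m v) (x + t *\<^sub>R v) \<bullet> v" for m t
    have der: "(\<phi> m has_real_derivative \<phi> (Suc m) t) (at t)" if "m < k" for m t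
    proof -
      have "(total_deriv g (replicate m v) has_derivative (\<lambda>u. total_deriv g (u # replicate m v) (x + t *\<^sub>R v)))
          (at (x + t *\<^sub>R v))"
        using that by (intro has_derivative_total_deriv[OF diff]) simp
      then have "((\<lambda>t. total_deriv g (replicate m v) (x + t *\<^sub>R v)) has_derivative
          (\<lambda>s. total_deriv g ((s *\<^sub>R v) # replicate m v) (x + t *\<^sub>R v))) (at t)"
        by (rule has_derivative_compose[rotated]) (auto intro!: derivative_eq_intros)
      then have "(\<phi> m has_derivative (\<lambda>s. total_deriv g ((s *\<^sub>R v) # replicate m v) (x + t *\<^sub>R v) \<bullet> v)) (at t)"
        unfolding \<phi>_def by (rule has_derivative_inner_left)
      \<comment> \<open>Linearity in the direction differentiated last pulls out the scalar
        \<open>s\<close>, so the derivative becomes multiplication by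
        \<open>\<phi> (Suc m) t\<close>.\<close>
      moreover have "linear (\<lambda>u. total_deriv g (u # replicate m v) (x + t *\<^sub>R v))"
        using has_derivative_linear[OF has_derivative_total_deriv[OF diff]] that by auto
      ultimately show ?thesis
        unfolding has_field_derivative_def \<phi>_def by (simp add: linear_scale mult_commute_abs)
    qed
    obtain t where t: "0 < t" "t < 1" "\<phi> 0 1 = (\<Sum>m<k. \<phi> m 0 / fact m * 1 ^ m) + \<phi> k t / fact k * 1 ^ k"
      using Maclaurin[of 1 k \<phi> "\<phi> 0"] k der by auto
    have "{..<k} = {0, 1, 2} \<union> {3..<k}" using k by auto
    then have split: "(\<Sum>m<k. \<phi> m 0 / fact m * 1 ^ m) =
        \<phi> 0 0 + \<phi> 1 0 + \<phi> 2 0 / 2 + (\<Sum>m=3..<k. \<phi> m 0 / fact m)"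
      by (subst \<open>{..<k} = _\<close>, subst sum.union_disjoint) (auto simp: numeral_eq_Suc)
    \<comment> \<open>For base at most 1 the exponent 4 dominates, otherwise the exponent k + 1; the
      sum covers both.\<close>
    have mono: "norm v ^ (m + 1) \<le> norm v ^ 4 + norm v ^ (k + 1)" if "3 \<le> m" "m \<le> k" for m
    proof (cases "norm v \<le> 1")
      case True
      then have "norm v ^ (m + 1) \<le> norm v ^ 4" using that by (intro power_decreasing) auto
      then show ?thesis by (simp add: add_increasing2)
    next
      case False
      then have "norm v ^ (m + 1) \<le> norm v ^ (k + 1)" using that by (intro power_increasing) auto
      then show ?thesis by (simp add: add_increasing)
    qed
    have term_bound: "\<bar>\<phi> m s / fact m\<bar> \<le> K * (norm v ^ 4 + norm v ^ (k + 1))"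
      if "3 \<le> m" "m \<le> k" "K \<ge> 0" "norm (total_deriv g (replicate m v) (x + s *\<^sub>R v)) \<le> K * norm v ^ m" for m s K
    proof -
      have "\<bar>\<phi> m s / fact m\<bar> \<le> \<bar>\<phi> m s\<bar>"
        by (simp add: divide_le_eq mult_le_cancel_left1)
      also have "\<dots> \<le> norm (total_deriv g (replicate m v) (x + s *\<^sub>R v)) * norm v"
        unfolding \<phi>_def by (rule Cauchy_Schwarz_ineq2)
      also have "\<dots> \<le> (K * norm v ^ m) * norm v" using that(4) by (rule mult_right_mono) simp
      also have "\<dots> = K * norm v ^ (m + 1)" by simp
      also have "\<dots> \<le> K * (norm v ^ 4 + norm v ^ (k + 1))"
        using mono[OF that(1,2)] that(3) by (rule mult_left_mono)
      finally show ?thesis .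
    qed
    have "\<bar>\<Sum>m=3..<k. \<phi> m 0 / fact m\<bar> \<le> (\<Sum>m=3..<k. C m * (norm v ^ 4 + norm v ^ (k + 1)))"
    proof (intro order_trans[OF sum_abs] sum_mono)
      fix m assume m: "m \<in> {3..<k}"
      then show "\<bar>\<phi> m 0 / fact m\<bar> \<le> C m * (norm v ^ 4 + norm v ^ (k + 1))"
        using C(2)[OF m, of "replicate m v"] C(1)[OF m]
        by (intro term_bound) (auto simp: prod_list_map_replicate)
    qed
    moreover have "\<bar>\<phi> k t / fact k\<bar> \<le> \<bar>B\<bar> * (norm v ^ 4 + norm v ^ (k + 1))"
    proof (intro term_bound)
      have "norm (total_deriv g (replicate k v) (x + t *\<^sub>R v)) \<le> B * norm v ^ k"
        using B[of "replicate k v"] by (simp add: prod_list_map_replicate)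
      also have "\<dots> \<le> \<bar>B\<bar> * norm v ^ k" by (intro mult_right_mono) auto
      finally show "norm (total_deriv g (replicate k v) (x + t *\<^sub>R v)) \<le> \<bar>B\<bar> * norm v ^ k" .
    qed (use k in auto)
    moreover have "g (x + v) \<bullet> v - g x \<bullet> v - total_deriv g [v] x \<bullet> v - (total_deriv g [v, v] x \<bullet> v) / 2
        = (\<Sum>m=3..<k. \<phi> m 0 / fact m) + \<phi> k t / fact k"
    proof -
      have "\<phi> 0 1 = g (x + v) \<bullet> v" "\<phi> 0 0 = g x \<bullet> v" "\<phi> 1 0 = total_deriv g [v] x \<bullet> v"
        "\<phi> 2 0 = total_deriv g [v, v] x \<bullet> v"
        by (simp_all add: \<phi>_def numeral_2_eq_2)
      then show ?thesis using t(3) split by simp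
    qed
    ultimately show ?thesis
      unfolding sum_distrib_right[symmetric] distrib_right[of _ "\<bar>B\<bar>"] by linarith
  qed
  moreover have "sum C {3..<k} + \<bar>B\<bar> \<ge> 0" using C(1) by (intro add_nonneg_nonneg sum_nonneg) auto
  ultimately show ?thesis by blast
qed

section \<open>Moments of sums of independent random vectors\<close>

lemma (in prob_space) integrable_norm_power_le:
  fixes X :: "'a \<Rightarrow> 'b::{second_countable_topology, banach}"
  assumes "integrable M (\<lambda>\<omega>. norm (X \<omega>) ^ k)" "j \<le> k" and [measurable]: "X \<in> borel_measurable M"
  shows "integrable M (\<lambda>\<omega>. norm (X \<omega>) ^ j)"
proof (rule Bochner_Integration.integrable_bound)
  show "integrable M (\<lambda>\<omega>. 1 + norm (X \<omega>) ^ k)" using assms by simp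
  have "r ^ j \<le> 1 + r ^ k" if "r \<ge> 0" for r :: real
  proof (cases "r \<le> 1")
    case True
    then have "r ^ j \<le> 1" using that by (simp add: power_le_one)
    then show ?thesis using that by (simp add: add_increasing2)
  next
    case False
    then have "r ^ j \<le> r ^ k" using assms(2) by (intro power_increasing) auto
    then show ?thesis by simp
  qed
  then show "AE \<omega> in M. norm (norm (X \<omega>) ^ j) \<le> norm (1 + norm (X \<omega>) ^ k)"
    by (auto intro: order_trans)
qed simp

lemma borel_measurable_vec_nth[measurable (raw)]:
  fixes f :: "'a \<Rightarrow> real^'n"
  assumes "f \<in> borel_measurable M"
  shows "(\<lambda>x. f x $ i) \<in> borel_measurable M"
  using assms by (rule measurable_compose)
    (intro borel_measurable_continuous_onI linear_continuous_on bounded_linear_vec_nth)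

text \<open>An index that occurs only once contributes its mean as a separate factor, and this mean
  is 0. The indices \<open>i\<close> and \<open>l\<close> may coincide, whence the integrability
  assumption on the product of \<open>f\<close> and \<open>h\<close>.\<close>

lemma (in prob_space) indep_product_expectation_zero:
  assumes fin: "finite I" and ijl: "i \<in> I" "j \<in> I" "l \<in> I" "j \<noteq> i" "j \<noteq> l"
    and indep: "indep_vars (\<lambda>_. borel) X I"
    and meas[measurable]: "f \<in> borel_measurable borel" "g \<in> borel_measurable borel" "h \<in> borel_measurable borel"
    and int: "integrable M (\<lambda>\<omega>. f (X i \<omega>))" "integrable M (\<lambda>\<omega>. g (X j \<omega>))" "integrable M (\<lambda>\<omega>. h (X l \<omega>))"
      "i = l \<Longrightarrow> integrable M (\<lambda>\<omega>. f (X i \<omega>) * h (X i \<omega>))"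
    and zero: "expectation (\<lambda>\<omega>. g (X j \<omega>)) = (0::real)"
  shows "integrable M (\<lambda>\<omega>. f (X i \<omega>) * g (X j \<omega>) * h (X l \<omega>))" (is ?int)
    and "expectation (\<lambda>\<omega>. f (X i \<omega>) * g (X j \<omega>) * h (X l \<omega>)) = 0" (is ?zero)
proof -
  \<comment> \<open>\<open>\<phi> m\<close> collects the functions attached to the index
    \<open>m\<close> and is 1 at all other indices, so that independence applies to a product over
    all of \<open>I\<close>.\<close>
  define \<phi> where "\<phi> m z = (if m = i then f z else 1) * (if m = j then g z else 1) * (if m = l then h z else 1)" for m z
  have ind: "indep_vars (\<lambda>_. borel) (\<lambda>m \<omega>. \<phi> m (X m \<omega>)) I"
    by (rule indep_vars_compose2[OF indep]) (auto simp: \<phi>_def)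
  have "integrable M (\<lambda>\<omega>. \<phi> m (X m \<omega>))" if "m \<in> I" for m
    using int ijl by (cases "m = i"; cases "m = j"; cases "m = l") (auto simp: \<phi>_def)
  note int' = this
  have prod: "(\<Prod>m\<in>I. \<phi> m (X m \<omega>)) = f (X i \<omega>) * g (X j \<omega>) * h (X l \<omega>)" for \<omega>
    using fin ijl by (simp add: \<phi>_def prod.distrib)
  show ?int
    using indep_vars_integrable[OF fin ind int'] by (simp add: prod)
  have "expectation (\<lambda>\<omega>. \<Prod>m\<in>I. \<phi> m (X m \<omega>)) = (\<Prod>m\<in>I. expectation (\<lambda>\<omega>. \<phi> m (X m \<omega>)))"
    by (rule indep_vars_lebesgue_integral[OF fin ind int'])
  also have "\<dots> = 0"
    using ijl zero fin by (intro prod_zero) (auto simp: \<phi>_def intro!: bexI[of _ j])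
  finally show ?zero by (simp add: prod)
qed

lemma (in prob_space) indep_centred_second_moment:
  fixes X :: "'i \<Rightarrow> 'a \<Rightarrow> real^'n"
  assumes fin: "finite I" and indep: "indep_vars (\<lambda>_. borel) X I"
    and int: "\<And>i. i \<in> I \<Longrightarrow> integrable M (\<lambda>\<omega>. norm (X i \<omega>) ^ 2)"
    and zero: "\<And>i a. i \<in> I \<Longrightarrow> expectation (\<lambda>\<omega>. X i \<omega> $ a) = 0"
  shows "integrable M (\<lambda>\<omega>. (\<Sum>i\<in>I. X i \<omega>) $ a * (\<Sum>i\<in>I. X i \<omega>) $ b)"
    and "expectation (\<lambda>\<omega>. (\<Sum>i\<in>I. X i \<omega>) $ a * (\<Sum>i\<in>I. X i \<omega>) $ b)
      = (\<Sum>i\<in>I. expectation (\<lambda>\<omega>. X i \<omega> $ a * X i \<omega> $ b))"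
proof -
  have meas: "X i \<in> borel_measurable M" if "i \<in> I" for i
    using indep that by (auto simp: indep_vars_def)
  have c1: "integrable M (\<lambda>\<omega>. X i \<omega> $ a)" if i: "i \<in> I" for i a
  proof (rule Bochner_Integration.integrable_bound)
    show "integrable M (\<lambda>\<omega>. norm (X i \<omega>) ^ 1)"
      using int[OF i] _ meas[OF i] by (rule integrable_norm_power_le) simp
    show "(\<lambda>\<omega>. X i \<omega> $ a) \<in> borel_measurable M" using meas[OF i] by measurable
  qed (auto simp: component_le_norm_cart)
  have c2: "integrable M (\<lambda>\<omega>. X i \<omega> $ a * X i \<omega> $ b)" if i: "i \<in> I" for i a b
  proof (rule Bochner_Integration.integrable_bound[OF int[OF i]])
    show "(\<lambda>\<omega>. X i \<omega> $ a * X i \<omega> $ b) \<in> borel_measurable M" using meas[OF i] by measurable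
  qed (auto simp: power2_eq_square abs_mult intro!: mult_mono component_le_norm_cart)
  have cross: "integrable M (\<lambda>\<omega>. X i \<omega> $ a * X j \<omega> $ b)"
    "i \<noteq> j \<Longrightarrow> expectation (\<lambda>\<omega>. X i \<omega> $ a * X j \<omega> $ b) = 0" if "i \<in> I" "j \<in> I" for i j
  proof -
    \<comment> \<open>The constant 1 as third function, placed at the first index, reduces the
      triple product to a pair.\<close>
    note z = indep_product_expectation_zero[OF fin that(1) that(2) that(1) _ _ indep,
        of "\<lambda>x. x $ a" "\<lambda>x. x $ b" "\<lambda>_. 1"]
    have 1: "integrable M (\<lambda>\<omega>. X i \<omega> $ a * X j \<omega> $ b * 1)" if "i \<noteq> j"
      by (rule z(1)) (use that \<open>i \<in> I\<close> \<open>j \<in> I\<close> c1 zero in auto)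
    have 2: "expectation (\<lambda>\<omega>. X i \<omega> $ a * X j \<omega> $ b * 1) = 0" if "i \<noteq> j"
      by (rule z(2)) (use that \<open>i \<in> I\<close> \<open>j \<in> I\<close> c1 zero in auto)
    show "integrable M (\<lambda>\<omega>. X i \<omega> $ a * X j \<omega> $ b)"
      using c2[OF that(1)] 1 by (cases "i = j") simp_all
    show "i \<noteq> j \<Longrightarrow> expectation (\<lambda>\<omega>. X i \<omega> $ a * X j \<omega> $ b) = 0" using 2 by simp
  qed
  have eq: "(\<Sum>i\<in>I. X i \<omega>) $ a * (\<Sum>i\<in>I. X i \<omega>) $ b = (\<Sum>i\<in>I. \<Sum>j\<in>I. X i \<omega> $ a * X j \<omega> $ b)" for \<omega>
    by (simp add: sum_product)
  show "integrable M (\<lambda>\<omega>. (\<Sum>i\<in>I. X i \<omega>) $ a * (\<Sum>i\<in>I. X i \<omega>) $ b)"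
    unfolding eq using cross by (intro Bochner_Integration.integrable_sum) auto
  have "expectation (\<lambda>\<omega>. (\<Sum>i\<in>I. X i \<omega>) $ a * (\<Sum>i\<in>I. X i \<omega>) $ b)
      = (\<Sum>i\<in>I. \<Sum>j\<in>I. expectation (\<lambda>\<omega>. X i \<omega> $ a * X j \<omega> $ b))"
    unfolding eq using cross by (simp add: Bochner_Integration.integral_sum Bochner_Integration.integrable_sum)
  also have "\<dots> = (\<Sum>i\<in>I. \<Sum>j\<in>I. if i = j then expectation (\<lambda>\<omega>. X i \<omega> $ a * X i \<omega> $ b) else 0)"
    using cross(2) by (intro sum.cong) auto
  finally show "expectation (\<lambda>\<omega>. (\<Sum>i\<in>I. X i \<omega>) $ a * (\<Sum>i\<in>I. X i \<omega>) $ b)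
      = (\<Sum>i\<in>I. expectation (\<lambda>\<omega>. X i \<omega> $ a * X i \<omega> $ b))"
    using fin by (simp add: sum.delta)
qed

text \<open>Only triples of equal indices survive: in every other triple some index differs from
  both others, and its centred factor has expectation 0.\<close>

lemma (in prob_space) indep_centred_third_moment:
  fixes X :: "'i \<Rightarrow> 'a \<Rightarrow> real^'n"
  assumes fin: "finite I" and indep: "indep_vars (\<lambda>_. borel) X I"
    and int: "\<And>i. i \<in> I \<Longrightarrow> integrable M (\<lambda>\<omega>. norm (X i \<omega>) ^ 3)"
    and zero: "\<And>i a. i \<in> I \<Longrightarrow> expectation (\<lambda>\<omega>. X i \<omega> $ a) = 0"
  shows "integrable M (\<lambda>\<omega>. (\<Sum>i\<in>I. X i \<omega>) $ a * (\<Sum>i\<in>I. X i \<omega>) $ b * (\<Sum>i\<in>I. X i \<omega>) $ c)"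
    and "expectation (\<lambda>\<omega>. (\<Sum>i\<in>I. X i \<omega>) $ a * (\<Sum>i\<in>I. X i \<omega>) $ b * (\<Sum>i\<in>I. X i \<omega>) $ c)
      = (\<Sum>i\<in>I. expectation (\<lambda>\<omega>. X i \<omega> $ a * X i \<omega> $ b * X i \<omega> $ c))"
proof -
  have meas: "X i \<in> borel_measurable M" if "i \<in> I" for i
    using indep that by (auto simp: indep_vars_def)
  have c1: "integrable M (\<lambda>\<omega>. X i \<omega> $ a)" if i: "i \<in> I" for i a
  proof (rule Bochner_Integration.integrable_bound)
    show "integrable M (\<lambda>\<omega>. norm (X i \<omega>) ^ 1)"
      using int[OF i] _ meas[OF i] by (rule integrable_norm_power_le) simp
    show "(\<lambda>\<omega>. X i \<omega> $ a) \<in> borel_measurable M" using meas[OF i] by measurable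
  qed (auto simp: component_le_norm_cart)
  have c2: "integrable M (\<lambda>\<omega>. X i \<omega> $ a * X i \<omega> $ b)" if i: "i \<in> I" for i a b
  proof (rule Bochner_Integration.integrable_bound)
    show "integrable M (\<lambda>\<omega>. norm (X i \<omega>) ^ 2)"
      using int[OF i] _ meas[OF i] by (rule integrable_norm_power_le) simp
    show "(\<lambda>\<omega>. X i \<omega> $ a * X i \<omega> $ b) \<in> borel_measurable M" using meas[OF i] by measurable
  qed (auto simp: power2_eq_square abs_mult intro!: mult_mono component_le_norm_cart)
  have c3: "integrable M (\<lambda>\<omega>. X i \<omega> $ a * X i \<omega> $ b * X i \<omega> $ c)" if i: "i \<in> I" for i
  proof (rule Bochner_Integration.integrable_bound[OF int[OF i]])
    show "(\<lambda>\<omega>. X i \<omega> $ a * X i \<omega> $ b * X i \<omega> $ c) \<in> borel_measurable M" using meas[OF i] by measurable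
  qed (auto simp: power3_eq_cube abs_mult intro!: mult_mono component_le_norm_cart)
  have tri: "integrable M (\<lambda>\<omega>. X i \<omega> $ a * X j \<omega> $ b * X l \<omega> $ c) \<and>
      expectation (\<lambda>\<omega>. X i \<omega> $ a * X j \<omega> $ b * X l \<omega> $ c) = 0"
    if "i \<in> I" "j \<in> I" "l \<in> I" "j \<noteq> i" "j \<noteq> l" for i j l a b c
    using indep_product_expectation_zero[OF fin _ _ _ _ _ indep, of i j l "\<lambda>x. x $ a" "\<lambda>x. x $ b" "\<lambda>x. x $ c"]
      that c1 c2 zero by auto
  have cross: "integrable M (\<lambda>\<omega>. X i \<omega> $ a * X j \<omega> $ b * X l \<omega> $ c) \<and> (\<not> (i = j \<and> j = l) \<longrightarrow>
      expectation (\<lambda>\<omega>. X i \<omega> $ a * X j \<omega> $ b * X l \<omega> $ c) = 0)" if "i \<in> I" "j \<in> I" "l \<in> I" for i j l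
  proof -
    \<comment> \<open>Permuting the three factors moves the isolated index to the middle, the
      position treated by \<open>tri\<close>.\<close>
    consider "j \<noteq> i" "j \<noteq> l" | "i \<noteq> j" "i \<noteq> l" | "l \<noteq> i" "l \<noteq> j" | "i = j" "j = l" by auto
    then show ?thesis
    proof cases
      case 1 then show ?thesis using tri that by blast
    next
      case 2 then show ?thesis using tri[of j i l b a c] that by (simp add: mult_ac)
    next
      case 3 then show ?thesis using tri[of i l j a c b] that by (simp add: mult_ac)
    next
      case 4 then show ?thesis using c3 that by simp
    qed
  qed
  have eq: "(\<Sum>i\<in>I. X i \<omega>) $ a * (\<Sum>i\<in>I. X i \<omega>) $ b * (\<Sum>i\<in>I. X i \<omega>) $ c
      = (\<Sum>i\<in>I. \<Sum>j\<in>I. \<Sum>l\<in>I. X i \<omega> $ a * X j \<omega> $ b * X l \<omega> $ c)" for \<omega>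
    unfolding sum_component sum_product by (simp add: sum_distrib_right sum_distrib_left) (intro sum.cong refl sum.swap)
  show "integrable M (\<lambda>\<omega>. (\<Sum>i\<in>I. X i \<omega>) $ a * (\<Sum>i\<in>I. X i \<omega>) $ b * (\<Sum>i\<in>I. X i \<omega>) $ c)"
    unfolding eq using cross by (intro Bochner_Integration.integrable_sum) auto
  have "expectation (\<lambda>\<omega>. (\<Sum>i\<in>I. X i \<omega>) $ a * (\<Sum>i\<in>I. X i \<omega>) $ b * (\<Sum>i\<in>I. X i \<omega>) $ c)
      = (\<Sum>i\<in>I. \<Sum>j\<in>I. \<Sum>l\<in>I. expectation (\<lambda>\<omega>. X i \<omega> $ a * X j \<omega> $ b * X l \<omega> $ c))"
    unfolding eq using cross by (simp add: Bochner_Integration.integral_sum Bochner_Integration.integrable_sum)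
  also have "\<dots> = (\<Sum>i\<in>I. \<Sum>j\<in>I. \<Sum>l\<in>I. if l = j then
      if j = i then expectation (\<lambda>\<omega>. X i \<omega> $ a * X i \<omega> $ b * X i \<omega> $ c) else 0 else 0)"
    using cross by (intro sum.cong) auto
  finally show "expectation (\<lambda>\<omega>. (\<Sum>i\<in>I. X i \<omega>) $ a * (\<Sum>i\<in>I. X i \<omega>) $ b * (\<Sum>i\<in>I. X i \<omega>) $ c)
      = (\<Sum>i\<in>I. expectation (\<lambda>\<omega>. X i \<omega> $ a * X i \<omega> $ b * X i \<omega> $ c))"
    using fin by (simp add: sum.delta)
qed

text \<open>A finite product measure is determined by its values on boxes, and both the density and
  the indicator of a box are products over the coordinates.\<close>

lemma PiM_density:
  fixes f :: "'i \<Rightarrow> 'a \<Rightarrow> ennreal"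
  assumes fin: "finite I" and P: "\<And>i. prob_space (N i)" and Q: "\<And>i. prob_space (density (N i) (f i))"
    and f[measurable]: "\<And>i. f i \<in> borel_measurable (N i)"
  shows "PiM I (\<lambda>i. density (N i) (f i)) = density (PiM I N) (\<lambda>x. \<Prod>i\<in>I. f i (x i))"
proof -
  interpret N: product_prob_space N I by (intro product_prob_spaceI P)
  interpret D: product_prob_space "\<lambda>i. density (N i) (f i)" I by (intro product_prob_spaceI Q)
  have pm[measurable]: "(\<lambda>x. \<Prod>i\<in>I. f i (x i)) \<in> borel_measurable (PiM I N)"
    by (intro borel_measurable_prod_ennreal) measurable
  show ?thesis
  proof (rule D.PiM_eqI[symmetric])
    show "sets (density (PiM I N) (\<lambda>x. \<Prod>i\<in>I. f i (x i))) = sets (PiM I (\<lambda>i. density (N i) (f i)))"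
      by (simp cong: sets_PiM_cong)
    fix A assume A: "\<And>i. i \<in> I \<Longrightarrow> A i \<in> sets (density (N i) (f i))"
    then have A': "\<And>i. i \<in> I \<Longrightarrow> A i \<in> sets (N i)" by simp
    have "emeasure (density (PiM I N) (\<lambda>x. \<Prod>i\<in>I. f i (x i))) (Pi\<^sub>E I A)
      = (\<integral>\<^sup>+x. (\<Prod>i\<in>I. f i (x i)) * indicator (Pi\<^sub>E I A) x \<partial>PiM I N)"
      using A' fin by (intro emeasure_density) (auto intro!: sets_PiM_I_finite)
    also have "\<dots> = (\<integral>\<^sup>+x. (\<Prod>i\<in>I. f i (x i) * indicator (A i) (x i)) \<partial>PiM I N)"
      using fin by (intro nn_integral_cong)
        (auto simp: space_PiM PiE_iff indicator_def prod.distrib split: if_splits intro!: prod_zero)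
    also have "\<dots> = (\<Prod>i\<in>I. \<integral>\<^sup>+x. f i x * indicator (A i) x \<partial>N i)"
      using A' fin by (intro N.product_nn_integral_prod) auto
    also have "\<dots> = (\<Prod>i\<in>I. emeasure (density (N i) (f i)) (A i))"
      using A' by (intro prod.cong refl emeasure_density[symmetric]) auto
    finally show "emeasure (density (PiM I N) (\<lambda>x. \<Prod>i\<in>I. f i (x i))) (Pi\<^sub>E I A) = \<dots>" .
  qed (use fin in auto)
qed

section \<open>Gradients, tilting and the law of the sample mean\<close>

lemma GDERIV_unique: "GDERIV f x :> D \<Longrightarrow> GDERIV f x :> E \<Longrightarrow> D = E"
  unfolding gderiv_def
  by (metis (no_types, lifting) has_derivative_unique inner_commute vector_eq_ldot)

lemma grad_eqI: "GDERIV f x :> D \<Longrightarrow> grad f x = D"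
  unfolding grad_def using GDERIV_unique by blast

lemma GDERIV_grad:
  fixes f :: "'a::euclidean_space \<Rightarrow> real"
  assumes "f differentiable (at x)"
  shows "GDERIV f x :> grad f x"
proof -
  obtain f' where f': "(f has_derivative f') (at x)"
    using assms by (auto simp: differentiable_def)
  then have lin: "linear f'" by (rule has_derivative_linear)
  have "f' v = v \<bullet> (\<Sum>b\<in>Basis. f' b *\<^sub>R b)" for v
    using linear_sum[OF lin, of "\<lambda>b. (v \<bullet> b) *\<^sub>R b" Basis] linear_scale[OF lin]
    by (simp add: euclidean_representation inner_sum_right mult.commute)
  with f' have "GDERIV f x :> (\<Sum>b\<in>Basis. f' b *\<^sub>R b)"
    unfolding gderiv_def by (metis (no_types, lifting) ext)
  then show ?thesis using grad_eqI by metis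
qed

text \<open>The scalings n and 1 / n cancel by the chain rule. It is an equivalence because
  \<open>grad\<close> is a definite description: the two gradients then agree even at points where
  neither derivative exists.\<close>

lemma GDERIV_scaled_log_partition:
  assumes "n \<ge> 1"
  shows "GDERIV (scaled_log_partition A n) \<eta> :> D \<longleftrightarrow> GDERIV A ((1 / real n) *\<^sub>R \<eta>) :> D"
proof
  have n: "real n \<noteq> 0" using assms by simp
  assume "GDERIV A ((1 / real n) *\<^sub>R \<eta>) :> D"
  then have "((\<lambda>\<eta>. A ((1 / real n) *\<^sub>R \<eta>)) has_derivative (\<lambda>h. ((1 / real n) *\<^sub>R h) \<bullet> D)) (at \<eta>)"
    unfolding gderiv_def
    by (rule has_derivative_compose[rotated]) (auto intro!: derivative_eq_intros)
  from has_derivative_mult_right[OF this, of "real n"]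
  show "GDERIV (scaled_log_partition A n) \<eta> :> D"
    unfolding gderiv_def scaled_log_partition_def[abs_def] using n by simp
next
  have n: "real n \<noteq> 0" using assms by simp
  assume "GDERIV (scaled_log_partition A n) \<eta> :> D"
  then have "((scaled_log_partition A n) has_derivative (\<lambda>h. h \<bullet> D)) (at (real n *\<^sub>R ((1 / real n) *\<^sub>R \<eta>)))"
    unfolding gderiv_def using n by simp
  then have "((\<lambda>\<eta>. scaled_log_partition A n (real n *\<^sub>R \<eta>)) has_derivative (\<lambda>h. (real n *\<^sub>R h) \<bullet> D))
      (at ((1 / real n) *\<^sub>R \<eta>))"
    by (rule has_derivative_compose[rotated]) (auto intro!: derivative_eq_intros)
  from has_derivative_mult_right[OF this, of "1 / real n"]
  show "GDERIV A ((1 / real n) *\<^sub>R \<eta>) :> D"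
    unfolding gderiv_def scaled_log_partition_def[abs_def] using n by simp
qed

lemma grad_scaled_log_partition:
  assumes "n \<ge> 1"
  shows "grad (scaled_log_partition A n) = (\<lambda>\<eta>. grad A ((1 / real n) *\<^sub>R \<eta>))"
proof
  fix \<eta>
  have "gderiv (scaled_log_partition A n) \<eta> = gderiv A ((1 / real n) *\<^sub>R \<eta>)"
    using GDERIV_scaled_log_partition[OF assms] by blast
  then show "grad (scaled_log_partition A n) \<eta> = grad A ((1 / real n) *\<^sub>R \<eta>)"
    by (simp add: grad_def)
qed

lemma matrix_scaleR: "matrix (\<lambda>v. c *\<^sub>R f v) = c *\<^sub>R matrix f"
  for f :: "real^'m \<Rightarrow> real^'n"
  by (simp add: matrix_def vec_eq_iff)

text \<open>The gradient keeps its values and only rescales its argument, so differentiating once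
  more leaves a single factor 1 / n.\<close>

lemma hessian_scaled_log_partition:
  assumes n: "n \<ge> 1" and diff: "grad A differentiable (at ((1 / real n) *\<^sub>R \<eta>))"
  shows "grad (scaled_log_partition A n) differentiable (at \<eta>)"
    and "hessian (scaled_log_partition A n) \<eta> = (1 / real n) *\<^sub>R hessian A ((1 / real n) *\<^sub>R \<eta>)"
proof -
  let ?D = "frechet_derivative (grad A) (at ((1 / real n) *\<^sub>R \<eta>))"
  have D: "(grad A has_derivative ?D) (at ((1 / real n) *\<^sub>R \<eta>))"
    using diff by (simp add: frechet_derivative_works)
  then have "((\<lambda>\<eta>. grad A ((1 / real n) *\<^sub>R \<eta>)) has_derivative (\<lambda>h. ?D ((1 / real n) *\<^sub>R h))) (at \<eta>)"
    by (rule has_derivative_compose[rotated]) (auto intro!: derivative_eq_intros)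
  moreover have "?D ((1 / real n) *\<^sub>R h) = (1 / real n) *\<^sub>R ?D h" for h
    using linear_scale[OF has_derivative_linear[OF D]] by simp
  ultimately have *: "(grad (scaled_log_partition A n) has_derivative (\<lambda>h. (1 / real n) *\<^sub>R ?D h)) (at \<eta>)"
    by (simp add: grad_scaled_log_partition[OF n])
  then show "grad (scaled_log_partition A n) differentiable (at \<eta>)" by (rule differentiableI)
  show "hessian (scaled_log_partition A n) \<eta> = (1 / real n) *\<^sub>R hessian A ((1 / real n) *\<^sub>R \<eta>)"
    unfolding hessian_def jacobian_def frechet_derivative_at[OF *, symmetric] by (rule matrix_scaleR)
qed

section \<open>Reference measures, tilting and Laplace integrals of the mean\<close>

lemma sets_reference_measure: "reference_measure \<nu> \<Longrightarrow> sets \<nu> = sets borel"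
  by (auto simp: reference_measure_def)

lemma sets_nef_law: "reference_measure \<nu> \<Longrightarrow> sets (nef_law \<nu> h A \<theta>) = sets borel"
  by (simp add: nef_law_def sets_reference_measure)

lemma sigma_finite_reference_measure:
  assumes "reference_measure \<nu>"
  shows "sigma_finite_measure \<nu>"
proof (cases "\<nu> = lborel")
  case False
  then obtain S where S: "countable S" "\<nu> = distr (count_space S) borel (\<lambda>y. y)"
    using assms by (auto simp: reference_measure_def)
  have Sb[measurable]: "S \<in> sets borel" using S(1) by (rule sets.countable[rotated]) simp
  show ?thesis
  proof
    \<comment> \<open>The singletons of \<open>S\<close> together with the null complement of
      \<open>S\<close> form a countable cover by sets of finite measure.\<close>
    have *: "emeasure \<nu> {s} \<noteq> \<infinity>" "emeasure \<nu> (- S) = 0" if "s \<in> S" for s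
      using that by (auto simp: S(2) emeasure_distr)
    have "emeasure \<nu> (- S) = 0" by (simp add: S(2) emeasure_distr)
    then have "\<forall>a\<in>insert (- S) ((\<lambda>s. {s}) ` S). emeasure \<nu> a \<noteq> \<infinity>" using * by auto
    moreover have "\<Union>(insert (- S) ((\<lambda>s. {s}) ` S)) = space \<nu>" by (auto simp: S(2))
    moreover have "insert (- S) ((\<lambda>s. {s}) ` S) \<subseteq> sets \<nu>" by (auto simp: S(2))
    moreover have "countable (insert (- S) ((\<lambda>s. {s}) ` S))" using S(1) by simp
    ultimately show "\<exists>A. countable A \<and> A \<subseteq> sets \<nu> \<and> \<Union>A = space \<nu> \<and> (\<forall>a\<in>A. emeasure \<nu> a \<noteq> \<infinity>)"
      by blast
  qed
qed (simp add: sigma_finite_lborel)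

text \<open>The carrier cancels in the ratio of two members, so a change of parameter is a tilt that
  makes sense for any measure. It can therefore be carried over to the mean before a carrier for the
  mean is known.\<close>

lemma nef_law_tilt:
  assumes ref: "reference_measure \<nu>" and h[measurable]: "h \<in> borel_measurable borel" and nn: "\<And>y. 0 \<le> h y"
  shows "nef_law \<nu> h A \<eta> = density (nef_law \<nu> h A \<theta>) (\<lambda>y. ennreal (exp (y \<bullet> (\<eta> - \<theta>) - (A \<eta> - A \<theta>))))"
proof -
  note [measurable_cong] = sets_reference_measure[OF ref]
  have "density (nef_law \<nu> h A \<theta>) (\<lambda>y. ennreal (exp (y \<bullet> (\<eta> - \<theta>) - (A \<eta> - A \<theta>))))
    = density \<nu> (\<lambda>y. ennreal (h y * exp (y \<bullet> \<theta> - A \<theta>)) * ennreal (exp (y \<bullet> (\<eta> - \<theta>) - (A \<eta> - A \<theta>))))"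
    unfolding nef_law_def by (subst density_density_eq) auto
  also have "\<dots> = nef_law \<nu> h A \<eta>"
    unfolding nef_law_def
    by (intro density_cong AE_I2)
      (auto simp: nn ennreal_mult[symmetric] mult.assoc exp_add[symmetric] inner_diff_right)
  finally show ?thesis by simp
qed

text \<open>A function of \<open>P\<close> alone, built on the canonical product space: the given
  random variables realise only the parameter \<theta>, while the family property concerns means at
  every parameter.\<close>

definition mean_law :: "nat \<Rightarrow> (real^'n) measure \<Rightarrow> (real^'n) measure" where
  "mean_law n P = distr (PiM {1..n} (\<lambda>_. P)) borel (sample_mean (\<lambda>i x. x i) n)"

lemma sets_mean_law[simp, measurable_cong]: "sets (mean_law n P) = sets borel"
  by (simp add: mean_law_def)

lemma measurable_sample_mean:
  assumes "\<And>i. i \<in> {1..n} \<Longrightarrow> Z i \<in> borel_measurable M"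
  shows "sample_mean Z n \<in> borel_measurable M"
  unfolding sample_mean_def[abs_def] using assms
  by (intro borel_measurable_scaleR borel_measurable_sum) auto

lemma measurable_sample_mean_PiM:
  assumes "sets P = sets borel"
  shows "sample_mean (\<lambda>i x. x i) n \<in> borel_measurable (PiM {1..n} (\<lambda>_. P))"
proof (rule measurable_sample_mean)
  fix i assume "i \<in> {1..n}"
  then have "(\<lambda>x. x i) \<in> measurable (PiM {1..n} (\<lambda>_. P)) P" by simp
  then show "(\<lambda>x. x i) \<in> borel_measurable (PiM {1..n} (\<lambda>_. P))"
    by (simp cong: measurable_cong_sets add: assms)
qed

lemma prob_space_mean_law:
  assumes "prob_space P" "sets P = sets borel"
  shows "prob_space (mean_law n P)"
  unfolding mean_law_def using assms
  by (intro prob_space.prob_space_distr measurable_sample_mean_PiM prob_space_PiM)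

lemma (in prob_space) distr_sample_mean:
  assumes n: "n \<ge> 1" and indep: "indep_vars (\<lambda>_. borel) Z {1..n}"
    and law: "\<And>i. i \<in> {1..n} \<Longrightarrow> distr M borel (Z i) = P"
  shows "distr M borel (sample_mean Z n) = mean_law n P"
proof -
  have rv: "Z i \<in> borel_measurable M" if "i \<in> {1..n}" for i
    using indep that by (auto simp: indep_vars_def)
  have P: "sets P = sets borel" using law[of 1] n by auto
  have "distr M (PiM {1..n} (\<lambda>_. borel)) (\<lambda>x. \<lambda>i\<in>{1..n}. Z i x) = PiM {1..n} (\<lambda>i. distr M borel (Z i))"
    using indep n by (subst indep_vars_iff_distr_eq_PiM'[symmetric]) (auto intro: rv)
  also have "\<dots> = PiM {1..n} (\<lambda>_. P)" using law by (intro PiM_cong) auto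
  finally have "mean_law n P =
      distr (distr M (PiM {1..n} (\<lambda>_. borel)) (\<lambda>x. \<lambda>i\<in>{1..n}. Z i x)) borel (sample_mean (\<lambda>i x. x i) n)"
    by (simp add: mean_law_def)
  also have "\<dots> = distr M borel (sample_mean (\<lambda>i x. x i) n \<circ> (\<lambda>x. \<lambda>i\<in>{1..n}. Z i x))"
    by (intro distr_distr measurable_sample_mean_PiM measurable_restrict rv) auto
  also have "sample_mean (\<lambda>i x. x i) n \<circ> (\<lambda>x. \<lambda>i\<in>{1..n}. Z i x) = sample_mean Z n"
    by (auto simp: sample_mean_def intro!: sum.cong)
  finally show ?thesis by simp
qed

text \<open>The joint density ratio, a product of exponentials, depends on the observations only
  through their mean (sufficiency), so it descends to a density of the image measure.\<close>

lemma mean_law_tilt: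
  fixes P :: "(real^'n) measure"
  assumes n: "n \<ge> 1" and P: "prob_space P" "sets P = sets borel"
    and Q: "prob_space (density P (\<lambda>y. ennreal (exp (y \<bullet> \<delta> - c))))"
  shows "mean_law n (density P (\<lambda>y. ennreal (exp (y \<bullet> \<delta> - c))))
    = density (mean_law n P) (\<lambda>y. ennreal (exp (y \<bullet> (real n *\<^sub>R \<delta>) - real n * c)))"
proof -
  note [measurable_cong] = P(2)
  have "(\<Prod>i\<in>{1..n}. ennreal (exp (x i \<bullet> \<delta> - c)))
      = ennreal (exp (sample_mean (\<lambda>i x. x i) n x \<bullet> (real n *\<^sub>R \<delta>) - real n * c))" for x :: "nat \<Rightarrow> real^'n"
    using n by (simp add: prod_ennreal sample_mean_def inner_sum_left sum_subtractf flip: exp_sum)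
  then have "PiM {1..n} (\<lambda>_. density P (\<lambda>y. ennreal (exp (y \<bullet> \<delta> - c)))) = density (PiM {1..n} (\<lambda>_. P))
      (\<lambda>x. ennreal (exp (sample_mean (\<lambda>i x. x i) n x \<bullet> (real n *\<^sub>R \<delta>) - real n * c)))"
    using P Q by (subst PiM_density) simp_all
  then show ?thesis
    unfolding mean_law_def
    by (simp only:) (rule density_distr[symmetric], simp, rule measurable_sample_mean_PiM[OF P(2)])
qed

text \<open>The exponential of a sum factorises over independent coordinates. The extended
  nonnegative integral also records when the value is infinite, as is needed to identify the
  parameter space of the means.\<close>

lemma nn_integral_exp_mean_law:
  fixes P :: "(real^'n) measure"
  assumes n: "n \<ge> 1" and P: "prob_space P" "sets P = sets borel"
  shows "(\<integral>\<^sup>+y. ennreal (exp (y \<bullet> \<delta>)) \<partial>mean_law n P)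
    = (\<integral>\<^sup>+y. ennreal (exp (y \<bullet> ((1 / real n) *\<^sub>R \<delta>))) \<partial>P) ^ n"
proof -
  note [measurable_cong] = P(2)
  interpret pp: product_prob_space "\<lambda>_. P" "{1..n}" by (intro product_prob_spaceI P(1))
  have eq: "ennreal (exp (sample_mean (\<lambda>i x. x i) n x \<bullet> \<delta>))
      = (\<Prod>i\<in>{1..n}. ennreal (exp (x i \<bullet> ((1 / real n) *\<^sub>R \<delta>))))" for x :: "nat \<Rightarrow> real^'n"
    by (simp add: prod_ennreal sample_mean_def inner_sum_left sum_distrib_left sum_divide_distrib flip: exp_sum)
  have "(\<integral>\<^sup>+y. ennreal (exp (y \<bullet> \<delta>)) \<partial>mean_law n P)
      = (\<integral>\<^sup>+x. ennreal (exp (sample_mean (\<lambda>i x. x i) n x \<bullet> \<delta>)) \<partial>PiM {1..n} (\<lambda>_. P))"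
    unfolding mean_law_def by (intro nn_integral_distr measurable_sample_mean_PiM P) auto
  also have "\<dots> = (\<Prod>i\<in>{1..n}. \<integral>\<^sup>+y. ennreal (exp (y \<bullet> ((1 / real n) *\<^sub>R \<delta>))) \<partial>P)"
    unfolding eq by (intro pp.product_nn_integral_prod) auto
  finally show ?thesis by simp
qed

section \<open>Mean and covariance of the law of the mean\<close>

lemma norm_power2_cart: "(norm (x :: real^'n))\<^sup>2 = (\<Sum>i\<in>UNIV. (x $ i)\<^sup>2)"
  unfolding power2_norm_eq_inner inner_vec_def by (simp add: power2_eq_square)

text \<open>The canonical coordinates are an independent sample from \<open>P\<close>, so results on
  independent variables apply to the product space. \<open>N\<close> stands for any measure with the
  same measurable sets, later \<open>borel\<close>.\<close>

lemma indep_vars_PiM_coordinates: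
  assumes P: "prob_space P" "sets P = sets N" and I: "I \<noteq> {}"
  shows "prob_space.indep_vars (PiM I (\<lambda>_. P)) (\<lambda>_. N) (\<lambda>i x. x i) I"
    and "i \<in> I \<Longrightarrow> distr (PiM I (\<lambda>_. P)) N (\<lambda>x. x i) = P"
proof -
  note [measurable_cong] = P(2)
  interpret prob_space "PiM I (\<lambda>_. P)" by (intro prob_space_PiM P)
  have comp: "distr (PiM I (\<lambda>_. P)) N (\<lambda>x. x i) = P" if "i \<in> I" for i
  proof -
    have "distr (PiM I (\<lambda>_. P)) N (\<lambda>x. x i) = distr (PiM I (\<lambda>_. P)) P (\<lambda>x. x i)"
      using P(2) by (intro distr_cong) auto
    also have "\<dots> = P" using distr_PiM_component[of I "\<lambda>_. P" i] P that by simp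
    finally show ?thesis .
  qed
  then show "i \<in> I \<Longrightarrow> distr (PiM I (\<lambda>_. P)) N (\<lambda>x. x i) = P" .
  have "distr (PiM I (\<lambda>_. P)) (PiM I (\<lambda>_. N)) (\<lambda>x. \<lambda>i\<in>I. x i)
      = distr (PiM I (\<lambda>_. P)) (PiM I (\<lambda>_. P)) (\<lambda>x. x)"
    by (intro distr_cong) (auto simp: space_PiM P(2) intro!: sets_PiM_cong)
  also have "\<dots> = PiM I (\<lambda>i. distr (PiM I (\<lambda>_. P)) N (\<lambda>x. x i))"
    by (simp add: comp cong: PiM_cong)
  finally show "indep_vars (\<lambda>_. N) (\<lambda>i x. x i) I"
    using I by (subst indep_vars_iff_distr_eq_PiM') (auto simp: measurable_cong_sets[OF refl P(2)[symmetric]])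
qed

text \<open>Only the n equal diagonal terms remain in the covariance of the sum, and they meet the
  square of 1 / n. The law \<open>P\<close> is arbitrary because the moment identities of the family
  of means are required at every parameter.\<close>

lemma mean_law_moments:
  fixes P :: "(real^'n) measure"
  assumes n: "n \<ge> 1" and P: "prob_space P" "sets P = sets borel"
    and int: "integrable P (\<lambda>y. (norm y)\<^sup>2)"
  shows "integrable (mean_law n P) (\<lambda>y. (norm y)\<^sup>2)"
    and "mean (mean_law n P) = mean P"
    and "covariance_matrix (mean_law n P) = (1 / real n) *\<^sub>R covariance_matrix P"
proof -
  note [measurable_cong] = P(2)
  let ?I = "{1..n}" and ?\<Omega> = "PiM {1..n} (\<lambda>_. P)" and ?m = "mean P"
  have I: "?I \<noteq> {}" using n by simp
  interpret P: prob_space P by fact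
  interpret \<Omega>: prob_space ?\<Omega> by (intro prob_space_PiM P)
  interpret Q: prob_space "mean_law n P" by (intro prob_space_mean_law P)
  have comp: "(\<lambda>x. x i) \<in> borel_measurable ?\<Omega>" "distr ?\<Omega> borel (\<lambda>x. x i) = P" if "i \<in> ?I" for i
    using that indep_vars_PiM_coordinates(2)[OF P I] by (auto simp: measurable_cong_sets[OF refl P(2)[symmetric]])
  have transfer: "integrable ?\<Omega> (\<lambda>x. f (x i)) \<longleftrightarrow> integrable P f" "(\<integral>x. f (x i) \<partial>?\<Omega>) = (\<integral>y. f y \<partial>P)"
    if "i \<in> ?I" "f \<in> borel_measurable borel" for i and f :: "real^'n \<Rightarrow> 'c::{banach, second_countable_topology}"
    using integrable_distr_eq[OF comp(1) that(2)] integral_distr[OF comp(1) that(2)] that comp(2) by auto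
  have intP: "integrable P (\<lambda>y. y)"
  proof (rule Bochner_Integration.integrable_bound)
    show "integrable P (\<lambda>y. norm y ^ 1)"
      using int _ by (rule P.integrable_norm_power_le) auto
  qed auto
  have centred: "(\<integral>y. (y - ?m) $ a \<partial>P) = 0" for a
    using integral_bounded_linear[OF bounded_linear_vec_nth, of P "\<lambda>y. y" a]
      integrable_bounded_linear[OF bounded_linear_vec_nth intP, of a]
    by (simp add: intP mean_def P.prob_space)
  have int2: "integrable P (\<lambda>y. norm (y - ?m) ^ 2)"
  proof (rule Bochner_Integration.integrable_bound)
    show "integrable P (\<lambda>y. 2 * (norm y)\<^sup>2 + 2 * (norm ?m)\<^sup>2)" using int by simp
    have "(norm (y - ?m))\<^sup>2 \<le> 2 * (norm y)\<^sup>2 + 2 * (norm ?m)\<^sup>2" for y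
    proof -
      have "(norm (y - ?m))\<^sup>2 \<le> (norm y + norm ?m)\<^sup>2"
        by (intro power_mono norm_triangle_ineq4) simp
      also have "\<dots> \<le> 2 * (norm y)\<^sup>2 + 2 * (norm ?m)\<^sup>2"
        using zero_le_power2[of "norm y - norm ?m"] by (simp add: power2_eq_square algebra_simps)
      finally show ?thesis .
    qed
    then show "AE y in P. norm (norm (y - ?m) ^ 2) \<le> norm (2 * (norm y)\<^sup>2 + 2 * (norm ?m)\<^sup>2)"
      by auto
  qed auto
  have ind: "\<Omega>.indep_vars (\<lambda>_. borel) (\<lambda>i x. x i - ?m) ?I"
    using \<Omega>.indep_vars_compose2[OF indep_vars_PiM_coordinates(1)[OF P I], of "\<lambda>_ y. y - ?m" "\<lambda>_. borel"] by simp
  have X2: "integrable ?\<Omega> (\<lambda>x. norm (x i - ?m) ^ 2)" if "i \<in> ?I" for i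
    using transfer(1)[OF that, of "\<lambda>y. norm (y - ?m) ^ 2"] int2 by simp
  have X0: "(\<integral>x. (x i - ?m) $ a \<partial>?\<Omega>) = 0" if "i \<in> ?I" for i a
    using transfer(2)[OF that, of "\<lambda>y. (y - ?m) $ a"] centred by simp
  note m2 = \<Omega>.indep_centred_second_moment[OF finite_atLeastAtMost ind X2 X0]
  have sm: "sample_mean (\<lambda>i x. x i) n x - ?m = (1 / real n) *\<^sub>R (\<Sum>i\<in>?I. x i - ?m)" for x
    using n by (simp add: sample_mean_def sum_subtractf scaleR_diff_right sum_constant_scaleR del: sum_constant)
  have smm: "sample_mean (\<lambda>i x. x i) n \<in> borel_measurable ?\<Omega>"
    by (intro measurable_sample_mean_PiM P)
  have prod_eq: "(sample_mean (\<lambda>i x. x i) n x - ?m) $ a * (sample_mean (\<lambda>i x. x i) n x - ?m) $ b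
      = (1 / real n)\<^sup>2 * ((\<Sum>i\<in>?I. x i - ?m) $ a * (\<Sum>i\<in>?I. x i - ?m) $ b)" for x a b
    unfolding sm by (simp add: power2_eq_square)
  have second: "integrable (mean_law n P) (\<lambda>y. (y - ?m) $ a * (y - ?m) $ b)"
    "(\<integral>y. (y - ?m) $ a * (y - ?m) $ b \<partial>mean_law n P) = (1 / real n) * (\<integral>y. (y - ?m) $ a * (y - ?m) $ b \<partial>P)" for a b
  proof -
    have meas: "(\<lambda>y. (y - ?m) $ a * (y - ?m) $ b) \<in> borel_measurable borel" by measurable
    show "integrable (mean_law n P) (\<lambda>y. (y - ?m) $ a * (y - ?m) $ b)"
      unfolding mean_law_def integrable_distr_eq[OF smm meas] prod_eq
      by (intro integrable_mult_right m2)
    have "(\<integral>y. (y - ?m) $ a * (y - ?m) $ b \<partial>mean_law n P)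
        = (1 / real n)\<^sup>2 * (\<Sum>i\<in>?I. \<integral>x. (x i - ?m) $ a * (x i - ?m) $ b \<partial>?\<Omega>)"
      unfolding mean_law_def integral_distr[OF smm meas] prod_eq integral_mult_right_zero
      by (simp only: m2(2))
    also have "\<dots> = (1 / real n)\<^sup>2 * (\<Sum>i\<in>?I. \<integral>y. (y - ?m) $ a * (y - ?m) $ b \<partial>P)"
      using transfer(2)[OF _ meas] by simp
    finally show "(\<integral>y. (y - ?m) $ a * (y - ?m) $ b \<partial>mean_law n P)
        = (1 / real n) * (\<integral>y. (y - ?m) $ a * (y - ?m) $ b \<partial>P)"
      using n by (simp add: power2_eq_square)
  qed
  have sq: "integrable (mean_law n P) (\<lambda>y. (norm (y - ?m))\<^sup>2)"
    using second(1) unfolding norm_power2_cart by (intro Bochner_Integration.integrable_sum) (simp add: power2_eq_square)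
  show "integrable (mean_law n P) (\<lambda>y. (norm y)\<^sup>2)"
  proof (rule Bochner_Integration.integrable_bound)
    show "integrable (mean_law n P) (\<lambda>y. 2 * (norm (y - ?m))\<^sup>2 + 2 * (norm ?m)\<^sup>2)" using sq by simp
    have "(norm y)\<^sup>2 \<le> 2 * (norm (y - ?m))\<^sup>2 + 2 * (norm ?m)\<^sup>2" for y
    proof -
      have "(norm y)\<^sup>2 \<le> (norm (y - ?m) + norm ?m)\<^sup>2"
        using norm_triangle_sub[of y ?m] by (intro power_mono) (auto simp: add.commute)
      also have "\<dots> \<le> 2 * (norm (y - ?m))\<^sup>2 + 2 * (norm ?m)\<^sup>2"
        using zero_le_power2[of "norm (y - ?m) - norm ?m"] by (simp add: power2_eq_square algebra_simps)
      finally show ?thesis .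
    qed
    then show "AE y in mean_law n P. norm ((norm y)\<^sup>2) \<le> norm (2 * (norm (y - ?m))\<^sup>2 + 2 * (norm ?m)\<^sup>2)"
      by auto
  qed simp
  have idm: "(\<lambda>y :: real^'n. y) \<in> borel_measurable borel" by simp
  have coord: "integrable ?\<Omega> (\<lambda>x. x i)" "(\<integral>x. x i \<partial>?\<Omega>) = ?m" if "i \<in> ?I" for i
    using iffD2[OF transfer(1)[OF that idm] intP] transfer(2)[OF that idm] unfolding mean_def by blast+
  have "mean (mean_law n P) = (\<integral>x. sample_mean (\<lambda>i x. x i) n x \<partial>?\<Omega>)"
    unfolding mean_def mean_law_def by (intro integral_distr smm) simp
  also have "\<dots> = (1 / real n) *\<^sub>R (\<Sum>i\<in>?I. ?m)"
    unfolding sample_mean_def using coord by (simp add: Bochner_Integration.integral_sum)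
  also have "\<dots> = ?m" using n by (simp add: sum_constant_scaleR del: sum_constant)
  finally show mean: "mean (mean_law n P) = ?m" .
  show "covariance_matrix (mean_law n P) = (1 / real n) *\<^sub>R covariance_matrix P"
    unfolding covariance_matrix_def mean using second(2) by (simp add: vec_eq_iff)
qed

section \<open>Absolute continuity of the law of the mean\<close>

lemma null_sets_lborel_affine:
  fixes N :: "'a::euclidean_space set"
  assumes N: "N \<in> null_sets lborel" and c: "c \<noteq> 0"
  shows "emeasure lborel {y. t + c *\<^sub>R y \<in> N} = 0"
proof -
  have [measurable]: "N \<in> sets borel" using N by auto
  let ?D = "distr lborel borel (\<lambda>x. t + c *\<^sub>R x)"
  \<comment> \<open>Lebesgue measure is its affine image times the positive constant |c| ^ d, so
    both have the same null sets.\<close>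
  have "0 = emeasure (density ?D (\<lambda>_. ennreal (\<bar>c\<bar> ^ DIM('a)))) N"
    using N lborel_affine[OF c, of t] by auto
  also have "\<dots> = ennreal (\<bar>c\<bar> ^ DIM('a)) * emeasure ?D N"
    by (simp add: emeasure_density nn_integral_cmult)
  also have "emeasure ?D N = emeasure lborel {y. t + c *\<^sub>R y \<in> N}"
    by (subst emeasure_distr) (auto intro!: arg_cong[where f = "emeasure lborel"])
  finally have "ennreal (\<bar>c\<bar> ^ DIM('a)) * emeasure lborel {y. t + c *\<^sub>R y \<in> N} = 0" by simp
  moreover have "\<bar>c\<bar> ^ DIM('a) > 0" using c by simp
  ultimately show ?thesis using c by simp
qed

text \<open>With all observations but the last fixed, the mean is an affine function of the last one
  with ratio 1 / n. Preimages of Lebesgue null sets are then null for \<open>P\<close>, and Fubini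
  integrates zeros.\<close>

lemma absolutely_continuous_mean_law_lborel:
  fixes P :: "(real^'n) measure"
  assumes n: "n \<ge> 1" and P: "prob_space P" "sets P = sets borel" and ac: "absolutely_continuous lborel P"
  shows "absolutely_continuous lborel (mean_law n P)"
  unfolding absolutely_continuous_def
proof
  fix N :: "(real^'n) set" assume N: "N \<in> null_sets lborel"
  then have Nb[measurable]: "N \<in> sets borel" by auto
  note [measurable_cong] = P(2)
  obtain m where m: "n = Suc m" using n by (cases n) auto
  have I: "{1..n} = insert n {1..m}" "n \<notin> {1..m}" by (auto simp: m)
  interpret pp: product_prob_space "\<lambda>_. P" "{1..n}" by (intro product_prob_spaceI P(1))
  have smm[measurable]: "sample_mean (\<lambda>i x. x i) n \<in> borel_measurable (PiM {1..n} (\<lambda>_. P))"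
    by (intro measurable_sample_mean_PiM P)
  have upd: "sample_mean (\<lambda>i x. x i) n (x(n := y)) = (1 / real n) *\<^sub>R (\<Sum>i=1..m. x i) + (1 / real n) *\<^sub>R y"
    for x :: "nat \<Rightarrow> real^'n" and y
  proof -
    have "(\<Sum>i\<in>{1..n}. (x(n := y)) i) = y + (\<Sum>i=1..m. x i)"
      unfolding I(1) using I(2) by (subst sum.insert) (auto intro!: sum.cong)
    then show ?thesis by (simp add: sample_mean_def scaleR_add_right)
  qed
  \<comment> \<open>\<open>t\<close> stands for the contribution of the first n - 1
    observations.\<close>
  have inner: "(\<integral>\<^sup>+y. indicator N (t + (1 / real n) *\<^sub>R y) \<partial>P) = 0" for t
  proof -
    have "{y. t + (1 / real n) *\<^sub>R y \<in> N} \<in> null_sets lborel"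
      using null_sets_lborel_affine[OF N, of "1 / real n" t] n by (auto simp: null_sets_def)
    then have "{y. t + (1 / real n) *\<^sub>R y \<in> N} \<in> null_sets P"
      using ac by (auto simp: absolutely_continuous_def)
    then have "emeasure P {y. t + (1 / real n) *\<^sub>R y \<in> N} = 0" by auto
    moreover have "(\<integral>\<^sup>+y. indicator N (t + (1 / real n) *\<^sub>R y) \<partial>P)
        = (\<integral>\<^sup>+y. indicator {y. t + (1 / real n) *\<^sub>R y \<in> N} y \<partial>P)"
      by (intro nn_integral_cong) (auto simp: indicator_def)
    ultimately show ?thesis by (subst (asm) nn_integral_indicator) (auto simp: P(2))
  qed
  have "emeasure (mean_law n P) N = (\<integral>\<^sup>+y. indicator N y \<partial>mean_law n P)" by simp
  also have "\<dots> = (\<integral>\<^sup>+x. indicator N (sample_mean (\<lambda>i x. x i) n x) \<partial>PiM {1..n} (\<lambda>_. P))"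
    unfolding mean_law_def by (intro nn_integral_distr smm) simp
  also have "\<dots> = (\<integral>\<^sup>+x. \<integral>\<^sup>+y. indicator N (sample_mean (\<lambda>i x. x i) n (x(n := y))) \<partial>P \<partial>PiM {1..m} (\<lambda>_. P))"
    using smm unfolding I(1) by (intro pp.product_nn_integral_insert) (auto simp: m)
  also have "\<dots> = 0" unfolding upd inner by simp
  finally show "N \<in> null_sets (mean_law n P)" by (auto simp: null_sets_def)
qed

text \<open>\<open>P\<close> is concentrated on \<open>S\<close>, so almost every sample has all
  entries in \<open>S\<close> and its mean in \<open>S'\<close>; a null set of the counting measure
  on \<open>S'\<close> is disjoint from \<open>S'\<close>.\<close>

lemma absolutely_continuous_mean_law_countable:
  fixes n :: nat and P :: "(real^'n) measure"
  assumes P: "prob_space P" "sets P = sets borel" and S: "countable S"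
    and ac: "absolutely_continuous (distr (count_space S) borel (\<lambda>y. y)) P"
  defines "S' \<equiv> sample_mean (\<lambda>i x. x i) n ` (PiE {1..n} (\<lambda>_. S))"
  shows "absolutely_continuous (distr (count_space S') borel (\<lambda>y. y)) (mean_law n P)"
  unfolding absolutely_continuous_def
proof
  fix N :: "(real^'n) set" assume N: "N \<in> null_sets (distr (count_space S') borel (\<lambda>y. y))"
  then have Nb[measurable]: "N \<in> sets borel" by auto
  have NS: "N \<inter> S' = {}"
  proof -
    have "emeasure (count_space S') (N \<inter> S') = 0"
      using N by (auto simp: null_sets_def emeasure_distr)
    then show ?thesis by (auto simp: emeasure_count_space_eq_0)
  qed
  have smm: "sample_mean (\<lambda>i x. x i) n \<in> borel_measurable (PiM {1..n} (\<lambda>_. P))"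
    by (intro measurable_sample_mean_PiM P)
  have [measurable]: "S \<in> sets borel" using S by (rule sets.countable[rotated]) simp
  have "- S \<in> null_sets (distr (count_space S) borel (\<lambda>y. y))"
    by (auto simp: null_sets_def emeasure_distr)
  then have "- S \<in> null_sets P" using ac by (auto simp: absolutely_continuous_def)
  then have "AE y in P. y \<in> S" by (rule AE_I') auto
  then have "AE x in PiM {1..n} (\<lambda>_. P). x i \<in> S" if "i \<in> {1..n}" for i
    using AE_PiM_component[of "{1..n}" "\<lambda>_. P" i "\<lambda>y. y \<in> S"] P(1) that by auto
  then have "AE x in PiM {1..n} (\<lambda>_. P). \<forall>i\<in>{1..n}. x i \<in> S"
    by (intro eventually_ball_finite) auto
  then have AE: "AE x in PiM {1..n} (\<lambda>_. P). indicator N (sample_mean (\<lambda>i x. x i) n x) = (0 :: ennreal)"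
  proof (rule AE_mp, intro AE_I2 impI)
    fix x assume "x \<in> space (PiM {1..n} (\<lambda>_. P))" "\<forall>i\<in>{1..n}. x i \<in> S"
    then have "x \<in> PiE {1..n} (\<lambda>_. S)" by (auto simp: space_PiM PiE_iff)
    then show "indicator N (sample_mean (\<lambda>i x. x i) n x) = (0 :: ennreal)"
      using NS by (auto simp: S'_def indicator_def)
  qed
  have "emeasure (mean_law n P) N = (\<integral>\<^sup>+y. indicator N y \<partial>mean_law n P)" by simp
  also have "\<dots> = (\<integral>\<^sup>+x. indicator N (sample_mean (\<lambda>i x. x i) n x) \<partial>PiM {1..n} (\<lambda>_. P))"
    unfolding mean_law_def by (intro nn_integral_distr smm) simp
  also have "\<dots> = 0" using nn_integral_cong_AE[OF AE] by simp
  finally show "N \<in> null_sets (mean_law n P)" by (auto simp: null_sets_def)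
qed

lemma reference_measure_mean_law:
  fixes P :: "(real^'n) measure"
  assumes n: "n \<ge> 1" and P: "prob_space P" "sets P = sets borel"
    and ref: "reference_measure \<nu>" and ac: "absolutely_continuous \<nu> P"
  shows "\<exists>\<nu>'. reference_measure \<nu>' \<and> absolutely_continuous \<nu>' (mean_law n P)"
  using ref unfolding reference_measure_def[of \<nu>]
proof (elim disjE exE conjE)
  assume "\<nu> = lborel"
  then show ?thesis
    using absolutely_continuous_mean_law_lborel[OF n P] ac
    by (intro exI[of _ lborel]) (auto simp: reference_measure_def)
next
  fix S assume S: "countable S" "\<nu> = distr (count_space S) borel (\<lambda>y. y)"
  let ?S = "sample_mean (\<lambda>i x. x i) n ` (PiE {1..n} (\<lambda>_. S))"
  have "countable ?S" using S(1) by (intro countable_image countable_PiE) auto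
  then have "reference_measure (distr (count_space ?S) borel (\<lambda>y. y))"
    unfolding reference_measure_def by blast
  then show ?thesis
    using absolutely_continuous_mean_law_countable[OF P S(1)] ac S(2) by blast
qed

section \<open>The exponential family of the sample mean\<close>

lemma natural_exp_familyD:
  assumes "natural_exp_family \<nu> h \<Theta> A"
  shows "reference_measure \<nu>" "h \<in> borel_measurable borel" "0 \<le> h y" "open \<Theta>"
    "\<theta> \<in> \<Theta> \<longleftrightarrow> (\<integral>\<^sup>+y. ennreal (h y * exp (y \<bullet> \<theta>)) \<partial>\<nu>) < \<infinity>"
    "\<theta> \<in> \<Theta> \<Longrightarrow> prob_space (nef_law \<nu> h A \<theta>)" "convex_on \<Theta> A"
    "\<theta> \<in> \<Theta> \<Longrightarrow> A differentiable (at \<theta>)" "\<theta> \<in> \<Theta> \<Longrightarrow> grad A differentiable (at \<theta>)"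
    "inj_on (grad A) \<Theta>" "\<theta> \<in> \<Theta> \<Longrightarrow> integrable (nef_law \<nu> h A \<theta>) (\<lambda>y. (norm y)\<^sup>2)"
    "\<theta> \<in> \<Theta> \<Longrightarrow> mean (nef_law \<nu> h A \<theta>) = grad A \<theta>"
    "\<theta> \<in> \<Theta> \<Longrightarrow> covariance_matrix (nef_law \<nu> h A \<theta>) = hessian A \<theta>"
  using assms unfolding natural_exp_family_def by blast+

text \<open>The Laplace integrals of a member and of the carrier differ by a positive finite factor,
  so finiteness under one law of the family decides membership in the parameter space.\<close>

lemma nn_integral_exp_nef_law:
  assumes ref: "reference_measure \<nu>" and h[measurable]: "h \<in> borel_measurable borel" and nn: "\<And>y. 0 \<le> h y"
  shows "(\<integral>\<^sup>+y. ennreal (exp (y \<bullet> (\<zeta> - \<theta>))) \<partial>nef_law \<nu> h A \<theta>)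
    = ennreal (exp (- A \<theta>)) * (\<integral>\<^sup>+y. ennreal (h y * exp (y \<bullet> \<zeta>)) \<partial>\<nu>)"
proof -
  note [measurable_cong] = sets_reference_measure[OF ref]
  have "(\<integral>\<^sup>+y. ennreal (exp (y \<bullet> (\<zeta> - \<theta>))) \<partial>nef_law \<nu> h A \<theta>)
    = (\<integral>\<^sup>+y. ennreal (h y * exp (y \<bullet> \<theta> - A \<theta>)) * ennreal (exp (y \<bullet> (\<zeta> - \<theta>))) \<partial>\<nu>)"
    unfolding nef_law_def by (intro nn_integral_density) auto
  also have "\<dots> = (\<integral>\<^sup>+y. ennreal (exp (- A \<theta>)) * ennreal (h y * exp (y \<bullet> \<zeta>)) \<partial>\<nu>)"
    by (intro nn_integral_cong) (auto simp: nn ennreal_mult[symmetric] mult_ac exp_add[symmetric] inner_diff_right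
        intro!: arg_cong[where f = ennreal])
  finally show ?thesis by (simp add: nn_integral_cmult)
qed

lemma space_mean_law[simp]: "space (mean_law n P) = UNIV"
  by (simp add: mean_law_def)

lemma mem_scaleR_image_iff:
  fixes \<Theta> :: "'a::real_vector set"
  assumes "c \<noteq> 0"
  shows "\<eta> \<in> (\<lambda>\<eta>. c *\<^sub>R \<eta>) ` \<Theta> \<longleftrightarrow> (1 / c) *\<^sub>R \<eta> \<in> \<Theta>"
  using assms by (force simp: image_iff)

text \<open>
  The carrier of the law of the mean is a Radon-Nikodym derivative at one parameter; since tilting
  commutes with taking means, the same carrier then serves all parameters.
\<close>

lemma natural_exp_family_mean_law:
  fixes \<nu> :: "(real^'n) measure"
  assumes fam: "natural_exp_family \<nu> h \<Theta> A" and \<theta>: "\<theta> \<in> \<Theta>" and n: "n \<ge> 1"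
  shows "\<exists>\<nu>' h'. natural_exp_family \<nu>' h' ((\<lambda>\<eta>. real n *\<^sub>R \<eta>) ` \<Theta>) (scaled_log_partition A n) \<and>
    (\<forall>\<eta>\<in>\<Theta>. nef_law \<nu>' h' (scaled_log_partition A n) (real n *\<^sub>R \<eta>) = mean_law n (nef_law \<nu> h A \<eta>))"
proof -
  note F = natural_exp_familyD[OF fam]
  have n0: "real n \<noteq> 0" using n by simp
  define P where "P = nef_law \<nu> h A \<theta>"
  have P: "prob_space P" "sets P = sets borel"
    using F(6)[OF \<theta>] sets_nef_law[OF F(1)] by (auto simp: P_def)
  have [measurable]: "h \<in> borel_measurable borel" by (rule F)
  have "absolutely_continuous \<nu> P"
    unfolding P_def nef_law_def
    by (intro absolutely_continuousI_density) (simp add: measurable_cong_sets[OF sets_reference_measure[OF F(1)] refl])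
  then obtain \<nu>' where \<nu>': "reference_measure \<nu>'" "absolutely_continuous \<nu>' (mean_law n P)"
    using reference_measure_mean_law[OF n P F(1)] by blast
  note [measurable_cong] = sets_reference_measure[OF \<nu>'(1)]
  define Q where "Q = mean_law n P"
  interpret Q: prob_space Q unfolding Q_def by (rule prob_space_mean_law[OF P])
  interpret \<nu>': sigma_finite_measure \<nu>' by (rule sigma_finite_reference_measure[OF \<nu>'(1)])
  have setsQ: "sets Q = sets \<nu>'" using sets_reference_measure[OF \<nu>'(1)] by (simp add: Q_def)
  define R where "R = RN_deriv \<nu>' Q"
  have R: "density \<nu>' R = Q" "AE y in \<nu>'. R y \<noteq> \<infinity>"
    unfolding R_def
    using \<nu>'.density_RN_deriv[OF \<nu>'(2)[folded Q_def] setsQ]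
      \<nu>'.RN_deriv_finite[OF Q.sigma_finite_measure_axioms \<nu>'(2)[folded Q_def] setsQ] by blast+
  have R_meas: "R \<in> borel_measurable \<nu>'" unfolding R_def by (rule borel_measurable_RN_deriv)
  have [measurable]: "R \<in> borel_measurable borel"
    using R_meas unfolding measurable_cong_sets[OF sets_reference_measure[OF \<nu>'(1)] refl] .
  \<comment> \<open>A carrier is real-valued; since \<open>R\<close> is finite almost everywhere,
    its real version yields the same densities.\<close>
  have dens: "density \<nu>' (\<lambda>y. ennreal (enn2real (R y) * g y)) = density Q (\<lambda>y. ennreal (g y))"
    if [measurable]: "g \<in> borel_measurable borel" and "\<And>y. 0 \<le> g y" for g
  proof -
    have "density Q (\<lambda>y. ennreal (g y)) = density \<nu>' (\<lambda>y. R y * ennreal (g y))"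
      unfolding R(1)[symmetric] by (subst density_density_eq) auto
    also have "\<dots> = density \<nu>' (\<lambda>y. ennreal (enn2real (R y) * g y))"
    proof (intro density_cong)
      have "R y * ennreal (g y) = ennreal (enn2real (R y) * g y)" if "R y \<noteq> \<infinity>" for y
        using that \<open>\<And>y. 0 \<le> g y\<close> by (cases "R y") (simp_all add: ennreal_mult)
      then show "AE y in \<nu>'. R y * ennreal (g y) = ennreal (enn2real (R y) * g y)"
        using R(2) by auto
    qed (use R_meas in measurable)
    finally show ?thesis by simp
  qed
  \<comment> \<open>The exponential undoes the tilt at the parameter n \<theta>, whose log-partition
    value is \<open>real n * A \<theta>\<close>; there the density reduces to the real version of
    \<open>R\<close>.\<close>
  define h' where "h' y = enn2real (R y) * exp (real n * A \<theta> - y \<bullet> (real n *\<^sub>R \<theta>))" for y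
  let ?A = "scaled_log_partition A n" and ?\<Theta> = "(\<lambda>\<eta>. real n *\<^sub>R \<eta>) ` \<Theta>"
  have h'[measurable]: "h' \<in> borel_measurable borel" unfolding h'_def by measurable
  have h'_nn: "0 \<le> h' y" for y by (simp add: h'_def)
  have law: "nef_law \<nu>' h' ?A (real n *\<^sub>R \<eta>) = mean_law n (nef_law \<nu> h A \<eta>)" if \<eta>: "\<eta> \<in> \<Theta>" for \<eta>
  proof -
    have tilt: "nef_law \<nu> h A \<eta> = density P (\<lambda>y. ennreal (exp (y \<bullet> (\<eta> - \<theta>) - (A \<eta> - A \<theta>))))"
      unfolding P_def by (rule nef_law_tilt[OF F(1,2,3)])
    have "mean_law n (nef_law \<nu> h A \<eta>)
        = density Q (\<lambda>y. ennreal (exp (y \<bullet> (real n *\<^sub>R (\<eta> - \<theta>)) - real n * (A \<eta> - A \<theta>))))"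
      using F(6)[OF \<eta>] unfolding tilt Q_def by (intro mean_law_tilt n P)
    also have "\<dots> = density \<nu>' (\<lambda>y. ennreal (enn2real (R y) *
        exp (y \<bullet> (real n *\<^sub>R (\<eta> - \<theta>)) - real n * (A \<eta> - A \<theta>))))"
      by (intro dens[symmetric]) auto
    also have "\<dots> = nef_law \<nu>' h' ?A (real n *\<^sub>R \<eta>)"
      unfolding nef_law_def h'_def scaled_log_partition_def using n0
      by (simp add: mult.assoc exp_add[symmetric] algebra_simps)
    finally show ?thesis by simp
  qed
  \<comment> \<open>The Laplace integral at \<open>\<eta>\<close> is a positive finite constant
    times the n-th power of the one for \<open>P\<close>; as n is at least 1, the power is finite
    exactly when its base is.\<close>
  have fin_iff: "\<eta> \<in> ?\<Theta> \<longleftrightarrow> (\<integral>\<^sup>+y. ennreal (h' y * exp (y \<bullet> \<eta>)) \<partial>\<nu>') < \<infinity>" for \<eta>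
  proof -
    let ?\<zeta> = "(1 / real n) *\<^sub>R \<eta>"
    have g: "h' y * exp (y \<bullet> \<eta>) = enn2real (R y) * (exp (real n * A \<theta>) * exp (y \<bullet> (\<eta> - real n *\<^sub>R \<theta>)))" for y
      by (simp add: h'_def mult.assoc exp_add[symmetric] algebra_simps)
    have "(\<integral>\<^sup>+y. ennreal (h' y * exp (y \<bullet> \<eta>)) \<partial>\<nu>')
        = emeasure (density \<nu>' (\<lambda>y. ennreal (h' y * exp (y \<bullet> \<eta>)))) (space \<nu>')"
      by (subst emeasure_density) (auto intro!: nn_integral_cong)
    also have "\<dots> = emeasure (density Q (\<lambda>y. ennreal (exp (real n * A \<theta>) * exp (y \<bullet> (\<eta> - real n *\<^sub>R \<theta>))))) (space Q)"
      unfolding g using sets_eq_imp_space_eq[OF setsQ] by (subst dens) auto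
    also have "\<dots> = (\<integral>\<^sup>+y. ennreal (exp (real n * A \<theta>)) * ennreal (exp (y \<bullet> (\<eta> - real n *\<^sub>R \<theta>))) \<partial>Q)"
      by (subst emeasure_density) (auto simp: Q_def ennreal_mult intro!: nn_integral_cong)
    also have "\<dots> = ennreal (exp (real n * A \<theta>)) * (\<integral>\<^sup>+y. ennreal (exp (y \<bullet> (\<eta> - real n *\<^sub>R \<theta>))) \<partial>Q)"
      by (intro nn_integral_cmult) (simp add: Q_def)
    also have "(\<integral>\<^sup>+y. ennreal (exp (y \<bullet> (\<eta> - real n *\<^sub>R \<theta>))) \<partial>Q)
        = (\<integral>\<^sup>+y. ennreal (exp (y \<bullet> (?\<zeta> - \<theta>))) \<partial>P) ^ n"
      unfolding Q_def nn_integral_exp_mean_law[OF n P] using n0 by (simp add: scaleR_diff_right)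
    also have "(\<integral>\<^sup>+y. ennreal (exp (y \<bullet> (?\<zeta> - \<theta>))) \<partial>P)
        = ennreal (exp (- A \<theta>)) * (\<integral>\<^sup>+y. ennreal (h y * exp (y \<bullet> ?\<zeta>)) \<partial>\<nu>)"
      unfolding P_def by (rule nn_integral_exp_nef_law[OF F(1,2,3)])
    finally have "(\<integral>\<^sup>+y. ennreal (h' y * exp (y \<bullet> \<eta>)) \<partial>\<nu>') < \<infinity> \<longleftrightarrow>
        (\<integral>\<^sup>+y. ennreal (h y * exp (y \<bullet> ?\<zeta>)) \<partial>\<nu>) < \<infinity>"
      using n by (auto simp: ennreal_mult_less_top power_less_top_ennreal)
    then show ?thesis unfolding mem_scaleR_image_iff[OF n0] F(5)[of ?\<zeta>] by simp
  qed
  have grad: "grad ?A (real n *\<^sub>R \<eta>) = grad A \<eta>" for \<eta>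
    using n0 by (simp add: grad_scaled_log_partition[OF n])
  have "natural_exp_family \<nu>' h' ?\<Theta> ?A"
    unfolding natural_exp_family_def
  proof (intro conjI)
    show "?\<Theta> \<noteq> {}" using \<theta> by auto
    show "open ?\<Theta>" using F(4) n0 by (simp add: open_scaling)
    show "?\<Theta> = {\<theta>. (\<integral>\<^sup>+y. ennreal (h' y * exp (y \<bullet> \<theta>)) \<partial>\<nu>') < \<infinity>}"
      using fin_iff by auto
    show "\<forall>\<theta>\<in>?\<Theta>. prob_space (nef_law \<nu>' h' ?A \<theta>)"
      using F(6) sets_nef_law[OF F(1)] by (auto simp: law intro!: prob_space_mean_law)
    show "convex_on ?\<Theta> ?A"
    proof (rule convex_onI)
      show "convex ?\<Theta>" using convex_on_imp_convex[OF F(7)] by (rule convex_scaling)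
      fix t x y assume t: "0 < t" "t < (1::real)" and xy: "x \<in> ?\<Theta>" "y \<in> ?\<Theta>"
      then obtain u v where uv: "u \<in> \<Theta>" "v \<in> \<Theta>" "x = real n *\<^sub>R u" "y = real n *\<^sub>R v" by auto
      have "(1 / real n) *\<^sub>R ((1 - t) *\<^sub>R x + t *\<^sub>R y) = (1 - t) *\<^sub>R u + t *\<^sub>R v"
        using n0 by (simp add: uv scaleR_add_right)
      then have "?A ((1 - t) *\<^sub>R x + t *\<^sub>R y) = real n * A ((1 - t) *\<^sub>R u + t *\<^sub>R v)"
        by (simp add: scaled_log_partition_def)
      also have "\<dots> \<le> real n * ((1 - t) * A u + t * A v)"
        using convex_onD[OF F(7), of t u v] t uv by (intro mult_left_mono) auto
      also have "\<dots> = (1 - t) * ?A x + t * ?A y"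
        using n0 by (simp add: scaled_log_partition_def uv algebra_simps)
      finally show "?A ((1 - t) *\<^sub>R x + t *\<^sub>R y) \<le> (1 - t) * ?A x + t * ?A y" .
    qed
    show "\<forall>\<theta>\<in>?\<Theta>. ?A differentiable (at \<theta>) \<and> grad ?A differentiable (at \<theta>)"
    proof (intro ballI conjI)
      fix \<eta> assume "\<eta> \<in> ?\<Theta>"
      then have \<eta>: "(1 / real n) *\<^sub>R \<eta> \<in> \<Theta>" by (simp add: mem_scaleR_image_iff[OF n0])
      have "GDERIV ?A \<eta> :> grad A ((1 / real n) *\<^sub>R \<eta>)"
        unfolding GDERIV_scaled_log_partition[OF n] by (rule GDERIV_grad[OF F(8)[OF \<eta>]])
      then show "?A differentiable (at \<eta>)" unfolding gderiv_def by (rule differentiableI)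
      show "grad ?A differentiable (at \<eta>)" by (rule hessian_scaled_log_partition(1)[OF n F(9)[OF \<eta>]])
    qed
    show "inj_on (grad ?A) ?\<Theta>"
      using F(10) by (auto simp: inj_on_def grad)
    show "\<forall>\<theta>\<in>?\<Theta>. integrable (nef_law \<nu>' h' ?A \<theta>) (\<lambda>y. (norm y)\<^sup>2) \<and>
        mean (nef_law \<nu>' h' ?A \<theta>) = grad ?A \<theta> \<and> covariance_matrix (nef_law \<nu>' h' ?A \<theta>) = hessian ?A \<theta>"
    proof
      fix \<eta> assume "\<eta> \<in> ?\<Theta>"
      then obtain \<zeta> where \<zeta>: "\<zeta> \<in> \<Theta>" "\<eta> = real n *\<^sub>R \<zeta>" by auto
      note m = mean_law_moments[OF n F(6)[OF \<zeta>(1)] sets_nef_law[OF F(1)] F(11)[OF \<zeta>(1)]]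
      have "hessian ?A \<eta> = (1 / real n) *\<^sub>R hessian A \<zeta>"
        using hessian_scaled_log_partition(2)[OF n, of A \<eta>] F(9)[OF \<zeta>(1)] n0 \<zeta>(2) by simp
      then show "integrable (nef_law \<nu>' h' ?A \<eta>) (\<lambda>y. (norm y)\<^sup>2) \<and>
        mean (nef_law \<nu>' h' ?A \<eta>) = grad ?A \<eta> \<and> covariance_matrix (nef_law \<nu>' h' ?A \<eta>) = hessian ?A \<eta>"
        using m F(12,13)[OF \<zeta>(1)] by (simp add: \<zeta>(2) law[OF \<zeta>(1)] grad)
    qed
  qed (use \<nu>'(1) h'_nn in auto)
  with law show ?thesis by blast
qed

text \<open>Parameters are multiplied by n while means stay the same, so the inverse of the gradient
  map is multiplied by n; the Hessian found there is the old one divided by n.\<close>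

lemma is_variance_function_scaled:
  assumes inj: "inj_on (grad A) \<Theta>" and diff: "\<And>\<theta>. \<theta> \<in> \<Theta> \<Longrightarrow> grad A differentiable (at \<theta>)"
    and var: "is_variance_function \<Theta> A \<Lambda>" and n: "n \<ge> 1"
  shows "is_variance_function ((\<lambda>\<eta>. real n *\<^sub>R \<eta>) ` \<Theta>) (scaled_log_partition A n) (\<lambda>y. (1 / real n) *\<^sub>R \<Lambda> y)"
  unfolding is_variance_function_def
proof
  let ?A = "scaled_log_partition A n" and ?\<Theta> = "(\<lambda>\<eta>. real n *\<^sub>R \<eta>) ` \<Theta>"
  have n0: "real n \<noteq> 0" using n by simp
  have grad: "grad ?A (real n *\<^sub>R \<eta>) = grad A \<eta>" for \<eta>
    using n0 by (simp add: grad_scaled_log_partition[OF n])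
  fix m assume "m \<in> grad ?A ` ?\<Theta>"
  then obtain \<eta> where \<eta>: "\<eta> \<in> \<Theta>" "m = grad A \<eta>" by (auto simp: grad)
  have "inj_on (grad ?A) ?\<Theta>" using inj by (auto simp: inj_on_def grad)
  then have 1: "the_inv_into ?\<Theta> (grad ?A) m = real n *\<^sub>R \<eta>"
    using \<eta> by (intro the_inv_into_f_eq) (auto simp: grad)
  have 2: "the_inv_into \<Theta> (grad A) m = \<eta>"
    using \<eta> inj by (intro the_inv_into_f_eq) auto
  have "\<Lambda> m = hessian A \<eta>"
    using var \<eta> 2 unfolding is_variance_function_def by force
  then show "(1 / real n) *\<^sub>R \<Lambda> m = hessian ?A (the_inv_into ?\<Theta> (grad ?A) m)"
    unfolding 1 using hessian_scaled_log_partition(2)[OF n, of A "real n *\<^sub>R \<eta>"] diff[OF \<eta>(1)] n0 by simp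
qed

text \<open>The logarithm of the density ratio is affine in y, so its expectation is determined by
  the mean, which is the gradient of A. The true law is the last argument of
  \<open>KL_divergence\<close>, and base \<open>exp 1\<close> makes the logarithm natural.\<close>

lemma KL_divergence_nef_law:
  fixes \<nu> :: "(real^'n) measure"
  assumes fam: "natural_exp_family \<nu> h \<Theta> A" and \<theta>: "\<theta>\<^sub>0 \<in> \<Theta>" "\<theta>\<^sub>1 \<in> \<Theta>"
  shows "KL_divergence (exp 1) (nef_law \<nu> h A \<theta>\<^sub>1) (nef_law \<nu> h A \<theta>\<^sub>0)
    = A \<theta>\<^sub>1 - A \<theta>\<^sub>0 - grad A \<theta>\<^sub>0 \<bullet> (\<theta>\<^sub>1 - \<theta>\<^sub>0)"
proof -
  note F = natural_exp_familyD[OF fam]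
  have [measurable]: "h \<in> borel_measurable borel" by (rule F)
  note [measurable_cong] = sets_reference_measure[OF F(1)]
  let ?P = "nef_law \<nu> h A \<theta>\<^sub>0"
  define p where "p \<theta> y = h y * exp (y \<bullet> \<theta> - A \<theta>)" for \<theta> y
  have [measurable]: "p \<theta> \<in> borel_measurable borel" for \<theta> unfolding p_def by measurable
  interpret \<nu>: sigma_finite_measure \<nu> by (rule sigma_finite_reference_measure[OF F(1)])
  interpret P: prob_space ?P by (rule F(6)[OF \<theta>(1)])
  have setsP[measurable_cong]: "sets ?P = sets borel" by (rule sets_nef_law[OF F(1)])
  have "KL_divergence (exp 1) (nef_law \<nu> h A \<theta>\<^sub>1) ?P = (\<integral>y. p \<theta>\<^sub>0 y * log (exp 1) (p \<theta>\<^sub>0 y / p \<theta>\<^sub>1 y) \<partial>\<nu>)"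
    unfolding nef_law_def p_def[symmetric]
  proof (intro \<nu>.KL_density_density AE_I2)
    show "p \<theta>\<^sub>1 \<in> borel_measurable \<nu>" "p \<theta>\<^sub>0 \<in> borel_measurable \<nu>"
      by measurable
  qed (use F(3) in \<open>auto simp: p_def\<close>)
  also have "\<dots> = (\<integral>y. p \<theta>\<^sub>0 y * (y \<bullet> (\<theta>\<^sub>0 - \<theta>\<^sub>1) + (A \<theta>\<^sub>1 - A \<theta>\<^sub>0)) \<partial>\<nu>)"
  proof (intro Bochner_Integration.integral_cong refl)
    fix y
    show "p \<theta>\<^sub>0 y * log (exp 1) (p \<theta>\<^sub>0 y / p \<theta>\<^sub>1 y) = p \<theta>\<^sub>0 y * (y \<bullet> (\<theta>\<^sub>0 - \<theta>\<^sub>1) + (A \<theta>\<^sub>1 - A \<theta>\<^sub>0))"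
    \<comment> \<open>Where the carrier vanishes, both sides have the factor
      \<open>p \<theta>\<^sub>0 y = 0\<close>, whatever the value of the logarithm.\<close>
    proof (cases "h y = 0")
      case False
      then have "p \<theta>\<^sub>0 y / p \<theta>\<^sub>1 y = exp (y \<bullet> (\<theta>\<^sub>0 - \<theta>\<^sub>1) + (A \<theta>\<^sub>1 - A \<theta>\<^sub>0))"
        by (simp add: p_def exp_diff[symmetric] inner_diff_right algebra_simps)
      then show ?thesis by (simp add: log_def)
    qed (simp add: p_def)
  qed
  also have "\<dots> = (\<integral>y. y \<bullet> (\<theta>\<^sub>0 - \<theta>\<^sub>1) + (A \<theta>\<^sub>1 - A \<theta>\<^sub>0) \<partial>?P)"
    unfolding nef_law_def p_def[symmetric]
    by (subst integral_real_density) (auto simp: p_def F(3))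
  also have "\<dots> = (\<integral>y. y \<partial>?P) \<bullet> (\<theta>\<^sub>0 - \<theta>\<^sub>1) + (A \<theta>\<^sub>1 - A \<theta>\<^sub>0)"
  proof -
    have "integrable ?P (\<lambda>y. norm y ^ 1)"
      using F(11)[OF \<theta>(1)] _ by (rule P.integrable_norm_power_le) auto
    then have int: "integrable ?P (\<lambda>y. y)"
      by (intro integrable_norm_cancel[of ?P "\<lambda>y. y"]) simp_all
    then show ?thesis by (simp add: P.prob_space)
  qed
  also have "(\<integral>y. y \<partial>?P) = grad A \<theta>\<^sub>0" using F(12)[OF \<theta>(1)] by (simp add: mean_def)
  finally show ?thesis by (simp add: inner_diff_right)
qed

section \<open>Moments of the sample mean\<close>

text \<open>\<open>x ^ r / fact r\<close> is one term of the exponential series, whose terms are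
  nonnegative here.\<close>

lemma power_le_fact_exp:
  fixes x :: real
  assumes "0 \<le> x"
  shows "x ^ r \<le> fact r * exp x"
proof -
  have "(\<Sum>i\<in>{r}. x ^ i /\<^sub>R fact i) \<le> (\<Sum>i. x ^ i /\<^sub>R fact i)"
    using assms by (intro sum_le_suminf summable_exp_generic) auto
  then have "x ^ r / fact r \<le> exp x" by (simp add: exp_def divide_inverse mult.commute)
  then show ?thesis by (simp add: field_simps)
qed

lemma power_sum_le:
  fixes a :: "'b \<Rightarrow> real"
  assumes "finite B" "\<And>b. b \<in> B \<Longrightarrow> 0 \<le> a b" "B \<noteq> {}"
  shows "(\<Sum>b\<in>B. a b) ^ r \<le> real (card B) ^ r * (\<Sum>b\<in>B. a b ^ r)"
proof -
  have "Max (a ` B) \<in> a ` B" using assms by (intro Max_in) auto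
  then obtain m where m: "m \<in> B" "a m = Max (a ` B)" by force
  have "(\<Sum>b\<in>B. a b) \<le> real (card B) * a m"
    using assms m by (intro sum_bounded_above) auto
  then have "(\<Sum>b\<in>B. a b) ^ r \<le> (real (card B) * a m) ^ r"
    using assms by (intro power_mono sum_nonneg) auto
  also have "\<dots> = real (card B) ^ r * a m ^ r" by (rule power_mult_distrib)
  also have "\<dots> \<le> real (card B) ^ r * (\<Sum>b\<in>B. a b ^ r)"
    using assms m by (intro mult_left_mono member_le_sum) auto
  finally show ?thesis .
qed

text \<open>Exponential moments in the directions \<open>s b\<close> and \<open>- s b\<close>
  control every power of the norm: a power of a coordinate is below an exponential of its absolute
  value, and exp |t| is at most the sum of exp t and exp (- t).\<close>

lemma norm_power_le_sum_exp:
  fixes w :: "'a::euclidean_space"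
  assumes "s > 0"
  shows "norm w ^ r \<le> real DIM('a) ^ r * (fact r / s ^ r) * (\<Sum>b\<in>Basis. exp (w \<bullet> (s *\<^sub>R b)) + exp (w \<bullet> (- s *\<^sub>R b)))"
proof -
  have *: "\<bar>w \<bullet> b\<bar> ^ r \<le> (fact r / s ^ r) * (exp (w \<bullet> (s *\<^sub>R b)) + exp (w \<bullet> (- s *\<^sub>R b)))" for b
  proof -
    have "(s * \<bar>w \<bullet> b\<bar>) ^ r \<le> fact r * exp (s * \<bar>w \<bullet> b\<bar>)"
      using assms by (intro power_le_fact_exp) auto
    also have "exp (s * \<bar>w \<bullet> b\<bar>) \<le> exp (w \<bullet> (s *\<^sub>R b)) + exp (w \<bullet> (- s *\<^sub>R b))"
      by (cases "0 \<le> w \<bullet> b") (auto simp: abs_if)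
    finally have "s ^ r * \<bar>w \<bullet> b\<bar> ^ r \<le> fact r * (exp (w \<bullet> (s *\<^sub>R b)) + exp (w \<bullet> (- s *\<^sub>R b)))"
      by (simp add: power_mult_distrib)
    then show ?thesis using assms by (simp add: field_simps)
  qed
  have "norm w ^ r \<le> (\<Sum>b\<in>Basis. \<bar>w \<bullet> b\<bar>) ^ r"
    by (intro power_mono norm_le_l1) auto
  also have "\<dots> \<le> real DIM('a) ^ r * (\<Sum>b\<in>Basis. \<bar>w \<bullet> b\<bar> ^ r)"
    by (intro power_sum_le) auto
  also have "\<dots> \<le> real DIM('a) ^ r * (\<Sum>b\<in>Basis. (fact r / s ^ r) * (exp (w \<bullet> (s *\<^sub>R b)) + exp (w \<bullet> (- s *\<^sub>R b))))"
    by (intro mult_left_mono sum_mono *) auto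
  finally show ?thesis by (simp add: sum_distrib_left mult.assoc)
qed

text \<open>The tilted density has total mass 1 because \<theta> + \<delta> is again a parameter;
  solved for the integral, this exhibits A as the cumulant function.\<close>

lemma nn_integral_exp_nef_law_centred:
  fixes \<nu> :: "(real^'n) measure"
  assumes fam: "natural_exp_family \<nu> h \<Theta> A" and \<theta>: "\<theta> \<in> \<Theta>" and \<delta>: "\<theta> + \<delta> \<in> \<Theta>"
  shows "(\<integral>\<^sup>+y. ennreal (exp (y \<bullet> \<delta>)) \<partial>nef_law \<nu> h A \<theta>) = ennreal (exp (A (\<theta> + \<delta>) - A \<theta>))"
proof -
  note F = natural_exp_familyD[OF fam]
  let ?P = "nef_law \<nu> h A \<theta>" and ?c = "A (\<theta> + \<delta>) - A \<theta>"
  note [measurable_cong] = sets_nef_law[OF F(1)]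
  interpret tilted: prob_space "nef_law \<nu> h A (\<theta> + \<delta>)" by (rule F(6)[OF \<delta>])
  have "1 = emeasure (nef_law \<nu> h A (\<theta> + \<delta>)) (space (nef_law \<nu> h A (\<theta> + \<delta>)))"
    by (simp add: tilted.emeasure_space_1)
  also have "\<dots> = emeasure (density ?P (\<lambda>y. ennreal (exp (y \<bullet> \<delta> - ?c)))) (space ?P)"
    using nef_law_tilt[OF F(1,2,3), of A "\<theta> + \<delta>" \<theta>] by (simp add: nef_law_def)
  also have "\<dots> = (\<integral>\<^sup>+y. ennreal (exp (- ?c)) * ennreal (exp (y \<bullet> \<delta>)) \<partial>?P)"
    by (subst emeasure_density) (auto intro!: nn_integral_cong simp: ennreal_mult[symmetric] exp_add[symmetric] algebra_simps)
  also have "\<dots> = ennreal (exp (- ?c)) * (\<integral>\<^sup>+y. ennreal (exp (y \<bullet> \<delta>)) \<partial>?P)"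
    by (intro nn_integral_cmult) simp
  finally have eq: "ennreal (exp (- ?c)) * (\<integral>\<^sup>+y. ennreal (exp (y \<bullet> \<delta>)) \<partial>?P) = 1" ..
  have "ennreal (exp ?c) = ennreal (exp ?c) * (ennreal (exp (- ?c)) * (\<integral>\<^sup>+y. ennreal (exp (y \<bullet> \<delta>)) \<partial>?P))"
    by (simp only: eq mult_1_right)
  also have "\<dots> = (\<integral>\<^sup>+y. ennreal (exp (y \<bullet> \<delta>)) \<partial>?P)"
    by (simp add: mult.assoc[symmetric] ennreal_mult[symmetric] exp_add[symmetric])
  finally show ?thesis by simp
qed

text \<open>
  Rescaling by \<open>sqrt n\<close> turns the second-order expansion of \<open>A\<close> at \<open>\<theta>\<close> into a bound that is uniform
  in \<open>n\<close>; it yields all centred moments with the rate of the central limit theorem.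
\<close>

lemma mean_law_exp_bound:
  fixes \<nu> :: "(real^'n) measure"
  assumes fam: "natural_exp_family \<nu> h \<Theta> A" and \<theta>: "\<theta> \<in> \<Theta>"
  shows "\<exists>\<epsilon>>0. \<exists>K. \<forall>n\<ge>1. \<forall>\<delta>. norm \<delta> < \<epsilon> \<longrightarrow>
    (\<integral>\<^sup>+y. ennreal (exp ((sqrt (real n) *\<^sub>R (y - grad A \<theta>)) \<bullet> \<delta>)) \<partial>mean_law n (nef_law \<nu> h A \<theta>)) \<le> ennreal (exp K)"
proof -
  note F = natural_exp_familyD[OF fam]
  let ?P = "nef_law \<nu> h A \<theta>" and ?m = "grad A \<theta>"
  have P: "prob_space ?P" "sets ?P = sets borel" using F(6)[OF \<theta>] sets_nef_law[OF F(1)] by auto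
  have near: "\<forall>\<^sub>F x in nhds \<theta>. x \<in> \<Theta>" using F(4) \<theta> by (rule eventually_nhds_in_open)
  have "second_order_at A ((\<lambda>x h. h \<bullet> grad A x) \<theta>) \<theta>"
  proof (rule second_order_atI)
    show "\<forall>\<^sub>F x in nhds \<theta>. (A has_derivative (\<lambda>h. h \<bullet> grad A x)) (at x)"
      using near by eventually_elim (use GDERIV_grad[OF F(8)] in \<open>simp add: gderiv_def\<close>)
    show "(\<lambda>x. b \<bullet> grad A x) differentiable (at \<theta>)" for b
      using F(9)[OF \<theta>] by (intro differentiable_inner) auto
  qed
  then obtain K where K: "K \<ge> 0"
    "\<forall>\<^sub>F x in nhds \<theta>. norm (A x - A \<theta> - (x - \<theta>) \<bullet> ?m) \<le> K * (norm (x - \<theta>))\<^sup>2"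
    by (auto simp: second_order_at_def)
  from near K(2) have "\<forall>\<^sub>F x in nhds \<theta>. x \<in> \<Theta> \<and> norm (A x - A \<theta> - (x - \<theta>) \<bullet> ?m) \<le> K * (norm (x - \<theta>))\<^sup>2"
    by eventually_elim simp
  then obtain e where e: "e > 0" "\<And>x. dist x \<theta> < e \<Longrightarrow> x \<in> \<Theta>"
    "\<And>x. dist x \<theta> < e \<Longrightarrow> norm (A x - A \<theta> - (x - \<theta>) \<bullet> ?m) \<le> K * (norm (x - \<theta>))\<^sup>2"
    by (auto simp: eventually_nhds_metric)
  have "(\<integral>\<^sup>+y. ennreal (exp ((sqrt (real n) *\<^sub>R (y - ?m)) \<bullet> \<delta>)) \<partial>mean_law n ?P) \<le> ennreal (exp (K * e\<^sup>2))"
    if n: "n \<ge> 1" and \<delta>: "norm \<delta> < e" for n \<delta>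
  proof -
    \<comment> \<open>The tilt per observation shrinks like 1 / sqrt n, so that n times its square
      does not depend on n.\<close>
    define \<eta> where "\<eta> = (1 / sqrt (real n)) *\<^sub>R \<delta>"
    have "norm \<eta> \<le> norm \<delta>" using n by (simp add: \<eta>_def field_simps mult_le_cancel_left1)
    then have dist: "dist (\<theta> + \<eta>) \<theta> < e" using \<delta> by (simp add: dist_norm)
    have sq: "sqrt (real n) * sqrt (real n) = real n" by simp
    have scale: "(1 / real n) *\<^sub>R (sqrt (real n) *\<^sub>R \<delta>) = \<eta>"
      using n sq by (simp add: \<eta>_def field_simps)
    have norm\<eta>: "real n * (norm \<eta>)\<^sup>2 = (norm \<delta>)\<^sup>2"
      using n by (simp add: \<eta>_def power_mult_distrib power_divide)
    have inner: "sqrt (real n) * (?m \<bullet> \<delta>) = real n * (?m \<bullet> \<eta>)"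
      using n sq by (simp add: \<eta>_def field_simps)
    have "(\<integral>\<^sup>+y. ennreal (exp ((sqrt (real n) *\<^sub>R (y - ?m)) \<bullet> \<delta>)) \<partial>mean_law n ?P)
        = (\<integral>\<^sup>+y. ennreal (exp (- (sqrt (real n) * (?m \<bullet> \<delta>)))) * ennreal (exp (y \<bullet> (sqrt (real n) *\<^sub>R \<delta>))) \<partial>mean_law n ?P)"
      by (intro nn_integral_cong) (simp add: ennreal_mult[symmetric] exp_add[symmetric] algebra_simps inner_diff_left)
    also have "\<dots> = ennreal (exp (- (sqrt (real n) * (?m \<bullet> \<delta>)))) * (\<integral>\<^sup>+y. ennreal (exp (y \<bullet> (sqrt (real n) *\<^sub>R \<delta>))) \<partial>mean_law n ?P)"
      by (intro nn_integral_cmult) simp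
    also have "(\<integral>\<^sup>+y. ennreal (exp (y \<bullet> (sqrt (real n) *\<^sub>R \<delta>))) \<partial>mean_law n ?P) = ennreal (exp (A (\<theta> + \<eta>) - A \<theta>)) ^ n"
      unfolding nn_integral_exp_mean_law[OF n P] scale
      by (simp only: nn_integral_exp_nef_law_centred[OF fam \<theta> e(2)[OF dist]])
    also have "\<dots> = ennreal (exp (real n * (A (\<theta> + \<eta>) - A \<theta>)))"
      by (simp add: ennreal_power exp_of_nat_mult)
    \<comment> \<open>The centring cancels the linear part of A at \<theta>; the exponent that is
      left is n times a quadratic remainder.\<close>
    also have "ennreal (exp (- (sqrt (real n) * (?m \<bullet> \<delta>)))) * \<dots>
        = ennreal (exp (real n * (A (\<theta> + \<eta>) - A \<theta> - \<eta> \<bullet> ?m)))"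
      unfolding inner by (simp add: ennreal_mult[symmetric] exp_add[symmetric] algebra_simps inner_commute)
    also have "\<dots> \<le> ennreal (exp (K * e\<^sup>2))"
    proof -
      have "real n * (A (\<theta> + \<eta>) - A \<theta> - \<eta> \<bullet> ?m) \<le> real n * (K * (norm \<eta>)\<^sup>2)"
        using e(3)[OF dist] by (intro mult_left_mono) auto
      also have "\<dots> = K * (norm \<delta>)\<^sup>2" using norm\<eta> by (simp add: mult_ac)
      also have "\<dots> \<le> K * e\<^sup>2" using K(1) \<delta> by (intro mult_left_mono power_mono) auto
      finally show ?thesis by (intro ennreal_leI) simp
    qed
    finally show ?thesis .
  qed
  with e(1) show ?thesis by blast
qed

text \<open>For the deviation multiplied by sqrt n the exponential bound is uniform in n; undoing
  the rescaling produces the r-th power of 1 / sqrt n.\<close>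

lemma mean_law_norm_power_bound:
  fixes \<nu> :: "(real^'n) measure"
  assumes fam: "natural_exp_family \<nu> h \<Theta> A" and \<theta>: "\<theta> \<in> \<Theta>"
  shows "\<exists>C\<ge>0. \<forall>n\<ge>1. integrable (mean_law n (nef_law \<nu> h A \<theta>)) (\<lambda>y. norm (y - grad A \<theta>) ^ r) \<and>
    (\<integral>y. norm (y - grad A \<theta>) ^ r \<partial>mean_law n (nef_law \<nu> h A \<theta>)) \<le> C * (1 / sqrt (real n)) ^ r"
proof -
  let ?Q = "\<lambda>n. mean_law n (nef_law \<nu> h A \<theta>)" and ?m = "grad A \<theta>"
  obtain e K where e: "e > 0" and K: "\<And>n \<delta>. n \<ge> 1 \<Longrightarrow> norm \<delta> < e \<Longrightarrow>
    (\<integral>\<^sup>+y. ennreal (exp ((sqrt (real n) *\<^sub>R (y - ?m)) \<bullet> \<delta>)) \<partial>?Q n) \<le> ennreal (exp K)"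
    using mean_law_exp_bound[OF fam \<theta>] by metis
  \<comment> \<open>Half of \<open>e\<close>, so that the tilts along unit basis vectors have norm
    strictly below \<open>e\<close>.\<close>
  define s where "s = e / 2"
  have s: "s > 0" "s < e" using e by (auto simp: s_def)
  define c where "c = real DIM(real^'n) ^ r * (fact r / s ^ r)"
  have c: "c \<ge> 0" using s by (simp add: c_def)
  define C where "C = c * (\<Sum>b\<in>(Basis :: (real^'n) set). exp K + exp K)"
  have C: "C \<ge> 0" using c by (auto simp: C_def intro!: mult_nonneg_nonneg sum_nonneg)
  have bound: "(\<integral>\<^sup>+y. ennreal (norm (y - ?m) ^ r) \<partial>?Q n) \<le> ennreal (C * (1 / sqrt (real n)) ^ r)" if n: "n \<ge> 1" for n
  proof -
    let ?E = "\<lambda>y b. ennreal (exp ((sqrt (real n) *\<^sub>R (y - ?m)) \<bullet> (s *\<^sub>R b)))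
      + ennreal (exp ((sqrt (real n) *\<^sub>R (y - ?m)) \<bullet> (- s *\<^sub>R b)))"
    have pos: "0 \<le> (1 / sqrt (real n)) ^ r" by simp
    have "norm (y - ?m) ^ r = (1 / sqrt (real n)) ^ r * norm (sqrt (real n) *\<^sub>R (y - ?m)) ^ r" for y
      using n by (simp add: power_mult_distrib[symmetric])
    also have "\<dots> y \<le> (1 / sqrt (real n)) ^ r * (c * (\<Sum>b\<in>Basis. exp ((sqrt (real n) *\<^sub>R (y - ?m)) \<bullet> (s *\<^sub>R b))
        + exp ((sqrt (real n) *\<^sub>R (y - ?m)) \<bullet> (- s *\<^sub>R b))))" for y
      unfolding c_def by (intro mult_left_mono norm_power_le_sum_exp s) simp
    finally have ptw: "norm (y - ?m) ^ r \<le> ((1 / sqrt (real n)) ^ r * c) *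
        (\<Sum>b\<in>Basis. exp ((sqrt (real n) *\<^sub>R (y - ?m)) \<bullet> (s *\<^sub>R b)) + exp ((sqrt (real n) *\<^sub>R (y - ?m)) \<bullet> (- s *\<^sub>R b)))" for y
      by (simp only: mult.assoc)
    have "(\<integral>\<^sup>+y. ennreal (norm (y - ?m) ^ r) \<partial>?Q n)
        \<le> (\<integral>\<^sup>+y. ennreal ((1 / sqrt (real n)) ^ r * c) * (\<Sum>b\<in>Basis. ?E y b) \<partial>?Q n)"
    proof (rule nn_integral_mono)
      fix y
      have "(\<Sum>b\<in>Basis. ?E y b) = ennreal (\<Sum>b\<in>Basis. exp ((sqrt (real n) *\<^sub>R (y - ?m)) \<bullet> (s *\<^sub>R b)) + exp ((sqrt (real n) *\<^sub>R (y - ?m)) \<bullet> (- s *\<^sub>R b)))"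
        by (subst sum_ennreal[symmetric]) (auto simp: ennreal_plus intro!: sum.cong)
      then show "ennreal (norm (y - ?m) ^ r) \<le> ennreal ((1 / sqrt (real n)) ^ r * c) * (\<Sum>b\<in>Basis. ?E y b)"
        using ptw[of y] c by (simp only: ennreal_mult[symmetric] pos mult_nonneg_nonneg sum_nonneg exp_ge_zero add_nonneg_nonneg ennreal_leI)
    qed
    also have "\<dots> = ennreal ((1 / sqrt (real n)) ^ r * c) * (\<Sum>b\<in>Basis. \<integral>\<^sup>+y. ?E y b \<partial>?Q n)"
      by (simp add: nn_integral_cmult nn_integral_sum)
    also have "\<dots> \<le> ennreal ((1 / sqrt (real n)) ^ r * c) * (\<Sum>b\<in>(Basis :: (real^'n) set). ennreal (exp K + exp K))"
    proof (intro mult_left_mono sum_mono)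
      fix b :: "real^'n" assume b: "b \<in> Basis"
      have "(\<integral>\<^sup>+y. ?E y b \<partial>?Q n) = (\<integral>\<^sup>+y. ennreal (exp ((sqrt (real n) *\<^sub>R (y - ?m)) \<bullet> (s *\<^sub>R b))) \<partial>?Q n)
          + (\<integral>\<^sup>+y. ennreal (exp ((sqrt (real n) *\<^sub>R (y - ?m)) \<bullet> (- s *\<^sub>R b))) \<partial>?Q n)"
        by (intro nn_integral_add) simp_all
      also have "\<dots> \<le> ennreal (exp K) + ennreal (exp K)"
        using n s b by (intro add_mono K) auto
      finally show "(\<integral>\<^sup>+y. ?E y b \<partial>?Q n) \<le> ennreal (exp K + exp K)" by (simp only: ennreal_plus exp_ge_zero)
    qed simp
    also have "\<dots> = ennreal (C * (1 / sqrt (real n)) ^ r)"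
      unfolding C_def using c by (subst sum_ennreal) (auto simp: ennreal_mult[symmetric] mult_ac sum_nonneg)
    finally show ?thesis .
  qed
  have "integrable (?Q n) (\<lambda>y. norm (y - ?m) ^ r) \<and> (\<integral>y. norm (y - ?m) ^ r \<partial>?Q n) \<le> C * (1 / sqrt (real n)) ^ r"
    if n: "n \<ge> 1" for n
  proof
    have "(\<integral>\<^sup>+y. ennreal (norm (y - ?m) ^ r) \<partial>?Q n) < \<infinity>"
      using bound[OF n] by (rule le_less_trans) simp
    then show int: "integrable (?Q n) (\<lambda>y. norm (y - ?m) ^ r)"
      by (intro integrableI_bounded) simp_all
    have "ennreal (\<integral>y. norm (y - ?m) ^ r \<partial>?Q n) = (\<integral>\<^sup>+y. ennreal (norm (y - ?m) ^ r) \<partial>?Q n)"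
      by (intro nn_integral_eq_integral[symmetric] int) simp
    with bound[OF n] have "ennreal (\<integral>y. norm (y - ?m) ^ r \<partial>?Q n) \<le> ennreal (C * (1 / sqrt (real n)) ^ r)" by simp
    then show "(\<integral>y. norm (y - ?m) ^ r \<partial>?Q n) \<le> C * (1 / sqrt (real n)) ^ r"
      using C by (subst (asm) ennreal_le_iff) auto
  qed
  with C show ?thesis by blast
qed

text \<open>The n equal diagonal terms meet the third power of 1 / n. Signs are kept, which gains a
  factor 1 / sqrt n over the bound for the absolute third moment.\<close>

lemma (in prob_space) sample_mean_third_moment:
  fixes Z :: "nat \<Rightarrow> 'a \<Rightarrow> real^'n"
  assumes n: "n \<ge> 1" and indep: "indep_vars (\<lambda>_. borel) Z {1..n}"
    and law: "\<And>i. i \<in> {1..n} \<Longrightarrow> distr M borel (Z i) = P"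
    and int: "integrable P (\<lambda>y. norm (y - mean P) ^ 3)" and intP: "integrable P (\<lambda>y. y)"
  shows "integrable (mean_law n P) (\<lambda>y. (y - mean P) $ a * (y - mean P) $ b * (y - mean P) $ c)"
    and "(\<integral>y. (y - mean P) $ a * (y - mean P) $ b * (y - mean P) $ c \<partial>mean_law n P)
      = (1 / real n)\<^sup>2 * (\<integral>y. (y - mean P) $ a * (y - mean P) $ b * (y - mean P) $ c \<partial>P)"
proof -
  let ?I = "{1..n}" and ?m = "mean P"
  let ?f = "\<lambda>y. (y - ?m) $ a * (y - ?m) $ b * (y - ?m) $ c"
  have rv: "Z i \<in> borel_measurable M" if "i \<in> ?I" for i
    using indep that by (auto simp: indep_vars_def)
  have "prob_space (distr M borel (Z 1))" using n by (intro prob_space_distr rv) auto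
  then interpret P: prob_space P using law[of 1] n by simp
  have transfer: "integrable M (\<lambda>\<omega>. f (Z i \<omega>)) \<longleftrightarrow> integrable P f" "expectation (\<lambda>\<omega>. f (Z i \<omega>)) = (\<integral>y. f y \<partial>P)"
    if "i \<in> ?I" "f \<in> borel_measurable borel" for i and f :: "real^'n \<Rightarrow> real"
    using integrable_distr_eq[OF rv[OF that(1)] that(2)] integral_distr[OF rv[OF that(1)] that(2)] law[OF that(1)] by auto
  have centred: "(\<integral>y. (y - ?m) $ k \<partial>P) = 0" for k
    using integral_bounded_linear[OF bounded_linear_vec_nth, of P "\<lambda>y. y" k]
      integrable_bounded_linear[OF bounded_linear_vec_nth intP, of k]
    by (simp add: intP mean_def P.prob_space)
  have ind: "indep_vars (\<lambda>_. borel) (\<lambda>i \<omega>. Z i \<omega> - ?m) ?I"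
    using indep_vars_compose2[OF indep, of "\<lambda>_ y. y - ?m" "\<lambda>_. borel"] by simp
  have X3: "integrable M (\<lambda>\<omega>. norm (Z i \<omega> - ?m) ^ 3)" if "i \<in> ?I" for i
    using transfer(1)[OF that, of "\<lambda>y. norm (y - ?m) ^ 3"] int by simp
  have X0: "expectation (\<lambda>\<omega>. (Z i \<omega> - ?m) $ k) = 0" if "i \<in> ?I" for i k
    using transfer(2)[OF that, of "\<lambda>y. (y - ?m) $ k"] centred by simp
  note m3 = indep_centred_third_moment[OF finite_atLeastAtMost ind X3 X0]
  have sm: "sample_mean Z n \<omega> - ?m = (1 / real n) *\<^sub>R (\<Sum>i\<in>?I. Z i \<omega> - ?m)" for \<omega>
    using n by (simp add: sample_mean_def sum_subtractf scaleR_diff_right sum_constant_scaleR del: sum_constant)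
  have prod_eq: "?f (sample_mean Z n \<omega>) = (1 / real n) ^ 3 *
      ((\<Sum>i\<in>?I. Z i \<omega> - ?m) $ a * (\<Sum>i\<in>?I. Z i \<omega> - ?m) $ b * (\<Sum>i\<in>?I. Z i \<omega> - ?m) $ c)" for \<omega>
    unfolding sm by (simp add: power3_eq_cube)
  have meas: "?f \<in> borel_measurable borel" by measurable
  have smm: "sample_mean Z n \<in> borel_measurable M" by (intro measurable_sample_mean rv)
  note law' = distr_sample_mean[OF n indep law, symmetric]
  have Q: "mean_law n P = distr M borel (sample_mean Z n)" by (rule law')
  show "integrable (mean_law n P) ?f"
    unfolding Q integrable_distr_eq[OF smm meas] prod_eq by (intro integrable_mult_right m3)
  have "(\<integral>y. ?f y \<partial>mean_law n P)
      = (1 / real n) ^ 3 * (\<Sum>i\<in>?I. expectation (\<lambda>\<omega>. (Z i \<omega> - ?m) $ a * (Z i \<omega> - ?m) $ b * (Z i \<omega> - ?m) $ c))"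
    unfolding Q integral_distr[OF smm meas] prod_eq integral_mult_right_zero by (simp only: m3(2))
  also have "\<dots> = (1 / real n) ^ 3 * (\<Sum>i\<in>?I. \<integral>y. ?f y \<partial>P)"
    using transfer(2)[OF _ meas] by simp
  finally show "(\<integral>y. ?f y \<partial>mean_law n P) = (1 / real n)\<^sup>2 * (\<integral>y. ?f y \<partial>P)"
    using n by (simp add: power2_eq_square power3_eq_cube)
qed

section \<open>First-order expansion of expectations\<close>

lemma borel_measurable_if_differentiable:
  fixes f :: "'a::euclidean_space \<Rightarrow> 'b::real_normed_vector"
  assumes "\<And>x. f differentiable (at x)"
  shows "f \<in> borel_measurable borel"
  using assms by (intro borel_measurable_continuous_onI continuous_at_imp_continuous_on)
    (auto intro: differentiable_imp_continuous_within)

text \<open>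
  Away from \<open>m\<close> the function is split at the level \<open>n ^ q\<close>, where \<open>q (p - 1) \<ge> 1\<close>: above this level
  \<open>\<bar>F\<bar> \<le> \<bar>F\<bar> powr p / n\<close>, below it a high centred moment absorbs \<open>n ^ q\<close>.
\<close>

lemma expectation_expansion_second_order:
  fixes Q :: "nat \<Rightarrow> (real^'n) measure" and F :: "real^'n \<Rightarrow> real"
  assumes Q: "\<And>n. n \<ge> 1 \<Longrightarrow> prob_space (Q n)" "\<And>n. sets (Q n) = sets borel"
    and mom: "\<And>r. \<exists>C\<ge>0. \<forall>n\<ge>1. integrable (Q n) (\<lambda>y. norm (y - m) ^ r) \<and>
        (\<integral>y. norm (y - m) ^ r \<partial>Q n) \<le> C * (1 / sqrt (real n)) ^ r"
    and mean: "\<And>n. n \<ge> 1 \<Longrightarrow> (\<integral>y. y - m \<partial>Q n) = 0"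
    and F: "second_order_at F L m" and int: "\<And>n. n \<ge> 1 \<Longrightarrow> integrable (Q n) F"
    and p: "p > 1" and B: "\<forall>\<^sub>F n in sequentially. (\<integral>\<^sup>+y. ennreal (\<bar>F y\<bar> powr p) \<partial>Q n) \<le> ennreal B"
  shows "(\<lambda>n. (\<integral>y. F y \<partial>Q n) - F m) \<in> O(\<lambda>n. 1 / real n)"
proof -
  obtain C where C: "C \<ge> 0" "\<forall>\<^sub>F y in nhds m. norm (F y - F m - L (y - m)) \<le> C * (norm (y - m))\<^sup>2"
    and L: "bounded_linear L"
    using F by (auto simp: second_order_at_def)
  obtain d where d: "d > 0" "\<And>y. norm (y - m) < d \<Longrightarrow> \<bar>F y - F m - L (y - m)\<bar> \<le> C * (norm (y - m))\<^sup>2"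
    using C(2) by (auto simp: eventually_nhds_metric dist_norm)
  obtain K where K: "K \<ge> 0" "\<And>v. \<bar>L v\<bar> \<le> norm v * K"
    using bounded_linear.nonneg_bounded[OF L] by auto
  \<comment> \<open>With q at least 1 / (p - 1), a value |F| above n ^ q satisfies |F| powr (p - 1)
    \<ge> n.\<close>
  define q where "q = nat \<lceil>1 / (p - 1)\<rceil>"
  have q: "real q * (p - 1) \<ge> 1"
  proof -
    have "1 / (p - 1) \<le> real q" unfolding q_def by linarith
    then show ?thesis using p by (simp add: field_simps)
  qed
  obtain C2 where C2: "C2 \<ge> 0" "\<And>n. n \<ge> 1 \<Longrightarrow> integrable (Q n) (\<lambda>y. norm (y - m) ^ 2)"
    "\<And>n. n \<ge> 1 \<Longrightarrow> (\<integral>y. norm (y - m) ^ 2 \<partial>Q n) \<le> C2 * (1 / sqrt (real n)) ^ 2"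
    using mom[of 2] by blast
  \<comment> \<open>The moment of order 2 (q + 1) decays like the power q + 1 of 1 / n, so n ^ q
    times it is still O(1 / n).\<close>
  obtain Cr where Cr: "Cr \<ge> 0" "\<And>n. n \<ge> 1 \<Longrightarrow> integrable (Q n) (\<lambda>y. norm (y - m) ^ (2 * (q + 1)))"
    "\<And>n. n \<ge> 1 \<Longrightarrow> (\<integral>y. norm (y - m) ^ (2 * (q + 1)) \<partial>Q n) \<le> Cr * (1 / sqrt (real n)) ^ (2 * (q + 1))"
    using mom[of "2 * (q + 1)"] by blast
  \<comment> \<open>\<open>C\<close> serves inside the ball of radius d; outside, where |y - m| / d
    \<ge> 1, the constant \<open>F m\<close> and the linear part are absorbed into quadratic
    terms.\<close>
  define D where "D = C + \<bar>F m\<bar> / d\<^sup>2 + K / d"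
  have D: "D \<ge> 0" using C(1) K(1) d(1) by (simp add: D_def)
  have ptw: "\<bar>F y - F m - L (y - m)\<bar> \<le> D * norm (y - m) ^ 2 + \<bar>F y\<bar> powr p / real n
      + real n ^ q / d ^ (2 * (q + 1)) * norm (y - m) ^ (2 * (q + 1))" if n: "n \<ge> 1" for n y
  proof -
    let ?r = "norm (y - m)"
    have nonneg: "0 \<le> \<bar>F y\<bar> powr p / real n" "0 \<le> real n ^ q / d ^ (2 * (q + 1)) * ?r ^ (2 * (q + 1))"
      "0 \<le> \<bar>F m\<bar> / d\<^sup>2 * ?r ^ 2" "0 \<le> K / d * ?r ^ 2" "0 \<le> C * ?r ^ 2"
      using d(1) K(1) C(1) by simp_all
    show ?thesis
    proof (cases "?r < d")
      case True
      then show ?thesis using d(2)[OF True] nonneg unfolding D_def distrib_right by linarith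
    next
      case False
      then have r: "?r / d \<ge> 1" using d(1) by simp
      have "\<bar>F y\<bar> \<le> \<bar>F y\<bar> powr p / real n + real n ^ q / d ^ (2 * (q + 1)) * ?r ^ (2 * (q + 1))"
      proof (cases "\<bar>F y\<bar> \<le> real n ^ q")
        case True
        have "real n ^ q * 1 \<le> real n ^ q * (?r / d) ^ (2 * (q + 1))"
          using r by (intro mult_left_mono one_le_power) auto
        also have "\<dots> = real n ^ q / d ^ (2 * (q + 1)) * ?r ^ (2 * (q + 1))"
          by (simp add: power_divide)
        finally show ?thesis using True nonneg(1) by linarith
      next
        case False
        then have big: "\<bar>F y\<bar> \<ge> real n ^ q" by simp
        have Fpos: "\<bar>F y\<bar> > 0" using False n by (smt (verit) of_nat_0_le_iff zero_le_power)
        have "real n = real n powr 1" using n by simp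
        also have "\<dots> \<le> real n powr (real q * (p - 1))" using n q by (intro powr_mono) auto
        also have "\<dots> = (real n ^ q) powr (p - 1)"
          using n by (simp add: powr_powr[symmetric] powr_realpow)
        also have "\<dots> \<le> \<bar>F y\<bar> powr (p - 1)" using big p by (intro powr_mono2) auto
        finally have "\<bar>F y\<bar> * real n \<le> \<bar>F y\<bar> * \<bar>F y\<bar> powr (p - 1)"
          by (intro mult_left_mono) auto
        also have "\<dots> = \<bar>F y\<bar> powr p" using Fpos by (simp add: powr_diff)
        finally have "\<bar>F y\<bar> \<le> \<bar>F y\<bar> powr p / real n" using n by (simp add: field_simps)
        then show ?thesis using nonneg(2) by linarith
      qed
      moreover have "\<bar>F m\<bar> \<le> \<bar>F m\<bar> / d\<^sup>2 * ?r ^ 2"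
      proof -
        have "\<bar>F m\<bar> * 1 \<le> \<bar>F m\<bar> * (?r / d) ^ 2" using r by (intro mult_left_mono one_le_power) auto
        then show ?thesis by (simp add: power_divide)
      qed
      moreover have "\<bar>L (y - m)\<bar> \<le> K / d * ?r ^ 2"
      proof -
        have "\<bar>L (y - m)\<bar> \<le> (?r * K) * 1" using K(2) by simp
        also have "\<dots> \<le> (?r * K) * (?r / d)" using r K(1) by (intro mult_left_mono) auto
        finally show ?thesis by (simp add: power2_eq_square mult_ac)
      qed
      ultimately have "\<bar>F y - F m - L (y - m)\<bar> \<le> \<bar>F y\<bar> powr p / real n
          + real n ^ q / d ^ (2 * (q + 1)) * ?r ^ (2 * (q + 1)) + \<bar>F m\<bar> / d\<^sup>2 * ?r ^ 2 + K / d * ?r ^ 2"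
        by linarith
      then show ?thesis using nonneg unfolding D_def distrib_right by linarith
    qed
  qed
  \<comment> \<open>\<open>B\<close> may be negative, in which case \<open>ennreal B\<close> is 0;
    the maximum is a valid real bound in either case.\<close>
  let ?b = "max B 0"
  define E where "E = D * C2 + ?b + Cr / d ^ (2 * (q + 1))"
  have "\<forall>\<^sub>F n in sequentially. norm ((\<integral>y. F y \<partial>Q n) - F m) \<le> E * norm (1 / real n)"
    using B eventually_ge_at_top[of 1]
  proof eventually_elim
    case (elim n)
    note n = elim(2)
    interpret prob_space "Q n" by (rule Q(1)[OF n])
    note [measurable_cong] = Q(2)[of n]
    have Fm: "F \<in> borel_measurable (Q n)" using int[OF n] by auto
    have powm: "(\<lambda>y. \<bar>F y\<bar> powr p) \<in> borel_measurable (Q n)" using Fm by measurable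
    have intp: "integrable (Q n) (\<lambda>y. \<bar>F y\<bar> powr p)"
    proof (rule integrableI_bounded[OF powm])
      show "(\<integral>\<^sup>+y. ennreal (norm (\<bar>F y\<bar> powr p)) \<partial>Q n) < \<infinity>"
        using elim(1) by (simp add: le_less_trans[OF _ ennreal_less_top])
    qed
    have valp: "(\<integral>y. \<bar>F y\<bar> powr p \<partial>Q n) \<le> ?b"
    proof -
      have "ennreal (\<integral>y. \<bar>F y\<bar> powr p \<partial>Q n) = (\<integral>\<^sup>+y. ennreal (\<bar>F y\<bar> powr p) \<partial>Q n)"
        by (intro nn_integral_eq_integral[symmetric] intp) simp
      also have "\<dots> \<le> ennreal ?b" using elim(1) by (rule order_trans) (simp add: ennreal_leI)
      finally show ?thesis by (subst (asm) ennreal_le_iff) auto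
    qed
    have intv: "integrable (Q n) (\<lambda>y. y - m)"
    proof (rule integrable_norm_cancel)
      show "integrable (Q n) (\<lambda>y. norm (y - m))" using mom[of 1] n by auto
    qed simp
    have intL: "integrable (Q n) (\<lambda>y. L (y - m))" "(\<integral>y. L (y - m) \<partial>Q n) = 0"
      using integrable_bounded_linear[OF L intv] integral_bounded_linear[OF L intv] mean[OF n]
        linear_0[OF bounded_linear.linear[OF L]] by auto
    \<comment> \<open>The linear part integrates to 0 because m is the mean, so it can be subtracted
      under the integral.\<close>
    have "(\<integral>y. F y \<partial>Q n) - F m = (\<integral>y. F y - F m - L (y - m) \<partial>Q n)"
      using int[OF n] intL by (simp add: prob_space)
    also have "\<bar>\<dots>\<bar> \<le> (\<integral>y. D * norm (y - m) ^ 2 + \<bar>F y\<bar> powr p / real n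
        + real n ^ q / d ^ (2 * (q + 1)) * norm (y - m) ^ (2 * (q + 1)) \<partial>Q n)"
    proof (rule order_trans[OF integral_abs_bound])
      show "(\<integral>y. \<bar>F y - F m - L (y - m)\<bar> \<partial>Q n) \<le> (\<integral>y. D * norm (y - m) ^ 2 + \<bar>F y\<bar> powr p / real n
        + real n ^ q / d ^ (2 * (q + 1)) * norm (y - m) ^ (2 * (q + 1)) \<partial>Q n)"
        using int[OF n] intL(1) C2(2)[OF n] Cr(2)[OF n] intp
        by (intro integral_mono ptw n Bochner_Integration.integrable_add integrable_abs
            Bochner_Integration.integrable_diff integrable_mult_right integrable_divide) auto
    qed
    also have "\<dots> = D * (\<integral>y. norm (y - m) ^ 2 \<partial>Q n) + (\<integral>y. \<bar>F y\<bar> powr p \<partial>Q n) / real n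
        + real n ^ q / d ^ (2 * (q + 1)) * (\<integral>y. norm (y - m) ^ (2 * (q + 1)) \<partial>Q n)"
      using C2(2)[OF n] Cr(2)[OF n] intp by simp
    also have "\<dots> \<le> D * (C2 * (1 / sqrt (real n)) ^ 2) + ?b / real n
        + real n ^ q / d ^ (2 * (q + 1)) * (Cr * (1 / sqrt (real n)) ^ (2 * (q + 1)))"
      using C2(3)[OF n] Cr(3)[OF n] valp D d(1) n
      by (intro add_mono mult_left_mono divide_right_mono) auto
    also have "(1 / sqrt (real n)) ^ 2 = 1 / real n" using n by (simp add: power_divide)
    also have "(1 / sqrt (real n)) ^ (2 * (q + 1)) = 1 / real n ^ (q + 1)"
      unfolding power_mult using n by (simp add: power_divide)
    also have "D * (C2 * (1 / real n)) + ?b / real n + real n ^ q / d ^ (2 * (q + 1)) * (Cr * (1 / real n ^ (q + 1)))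
        = E * norm (1 / real n)"
      using n d(1) by (simp add: E_def field_simps)
    finally show ?case by simp
  qed
  then show ?thesis by (rule bigoI)
qed

text \<open>Exact moments of orders 1 to 3 feed the Taylor polynomial, and absolute moments of
  orders 4 and k + 1 its remainder. Both of the latter are at most of order 1 / n ^ 2, which the
  factor n turns into 1 / n.\<close>

lemma expectation_inner_expansion:
  fixes Q :: "nat \<Rightarrow> (real^'n) measure" and g :: "real^'n \<Rightarrow> real^'n"
  assumes Q: "\<And>n. n \<ge> 1 \<Longrightarrow> prob_space (Q n)" "\<And>n. sets (Q n) = sets borel"
    and mom: "\<And>r. \<exists>C\<ge>0. \<forall>n\<ge>1. integrable (Q n) (\<lambda>y. norm (y - m) ^ r) \<and>
        (\<integral>y. norm (y - m) ^ r \<partial>Q n) \<le> C * (1 / sqrt (real n)) ^ r"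
    and mean: "\<And>n. n \<ge> 1 \<Longrightarrow> (\<integral>y. y - m \<partial>Q n) = 0"
    and cov: "\<And>n a b. n \<ge> 1 \<Longrightarrow> integrable (Q n) (\<lambda>y. (y - m) $ a * (y - m) $ b) \<and>
        (\<integral>y. (y - m) $ a * (y - m) $ b \<partial>Q n) = S $ a $ b / real n"
    and third: "\<And>n a b c. n \<ge> 1 \<Longrightarrow> integrable (Q n) (\<lambda>y. (y - m) $ a * (y - m) $ b * (y - m) $ c) \<and>
        (\<integral>y. (y - m) $ a * (y - m) $ b * (y - m) $ c \<partial>Q n) = (1 / real n)\<^sup>2 * \<kappa> a b c"
    and g: "times_differentiable k g" "bounded_total_deriv k g" and k: "k \<ge> 3"
  shows "n \<ge> 1 \<Longrightarrow> integrable (Q n) (\<lambda>y. (y - m) \<bullet> g y)"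
    and "(\<lambda>n. real n * (\<integral>y. (y - m) \<bullet> g y \<partial>Q n) - trace (S ** jacobian g (at m))) \<in> O(\<lambda>n. 1 / real n)"
proof -
  define T where "T a b c = total_deriv g [axis a 1, axis b 1] m $ c" for a b c
  \<comment> \<open>The first index is the direction and the second the component, so this is the
    transpose of the Jacobian matrix; this order fits the trace of its product with
    \<open>S\<close>.\<close>
  define J where "J a b = total_deriv g [axis a 1] m $ b" for a b
  have Basis_sum: "(\<Sum>b\<in>Basis. f b) = (\<Sum>i\<in>UNIV. f (axis i 1))" for f :: "real^'n \<Rightarrow> 'b::comm_monoid_add"
  proof -
    have inj: "inj (\<lambda>i. axis i 1 :: real^'n)" by (simp add: inj_on_def axis_eq_axis)
    have range: "(Basis :: (real^'n) set) = range (\<lambda>i. axis i 1)" by (auto simp: Basis_vec_def)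
    show ?thesis unfolding range sum.reindex[OF inj] by simp
  qed
  have lin: "total_deriv g [v] m \<bullet> v = (\<Sum>a\<in>UNIV. \<Sum>b\<in>UNIV. (v $ a * v $ b) * J a b)" for v
  proof -
    have "total_deriv g [v] m = (\<Sum>a\<in>UNIV. v $ a *\<^sub>R total_deriv g [axis a 1] m)"
      using total_deriv_Basis_expansion[OF g(1), of "[]" "[]" v m] k
      by (simp add: Basis_sum inner_axis)
    then show ?thesis
      unfolding J_def
      by (simp only: inner_sum_left inner_scaleR_left)
        (simp only: inner_vec_def inner_real_def sum_distrib_left mult_ac)
  qed
  have quad: "total_deriv g [v, v] m \<bullet> v = (\<Sum>a\<in>UNIV. \<Sum>b\<in>UNIV. \<Sum>c\<in>UNIV. (v $ a * v $ b * v $ c) * T a b c)" for v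
  proof -
    have "total_deriv g [v, v] m = (\<Sum>a\<in>UNIV. v $ a *\<^sub>R total_deriv g [axis a 1, v] m)"
      using total_deriv_Basis_expansion[OF g(1), of "[]" "[v]" v m] k
      by (simp add: Basis_sum inner_axis)
    also have "\<dots> = (\<Sum>a\<in>UNIV. v $ a *\<^sub>R (\<Sum>b\<in>UNIV. v $ b *\<^sub>R total_deriv g [axis a 1, axis b 1] m))"
    proof (intro sum.cong refl)
      fix a
      show "v $ a *\<^sub>R total_deriv g [axis a 1, v] m = v $ a *\<^sub>R (\<Sum>b\<in>UNIV. v $ b *\<^sub>R total_deriv g [axis a 1, axis b 1] m)"
        using total_deriv_Basis_expansion[OF g(1), of "[axis a 1]" "[]" v m] k
        by (simp add: Basis_sum inner_axis)
    qed
    finally show ?thesis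
      unfolding T_def
      by (simp only: inner_sum_left inner_scaleR_left)
        (simp only: inner_vec_def inner_real_def sum_distrib_left mult_ac)
  qed
  have trace: "trace (S ** jacobian g (at m)) = (\<Sum>a\<in>UNIV. \<Sum>b\<in>UNIV. S $ a $ b * J a b)"
    by (simp add: trace_def matrix_matrix_mult_def jacobian_def matrix_def J_def)
  obtain C where C: "C \<ge> 0" "\<And>v. \<bar>g (m + v) \<bullet> v - g m \<bullet> v - total_deriv g [v] m \<bullet> v - (total_deriv g [v, v] m \<bullet> v) / 2\<bar>
    \<le> C * (norm v ^ 4 + norm v ^ (k + 1))"
    using taylor_inner_expansion[OF g k] by blast
  define R where "R y = g y \<bullet> (y - m) - g m \<bullet> (y - m) - total_deriv g [y - m] m \<bullet> (y - m)
      - (total_deriv g [y - m, y - m] m \<bullet> (y - m)) / 2" for y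
  have R: "\<bar>R y\<bar> \<le> C * (norm (y - m) ^ 4 + norm (y - m) ^ (k + 1))" for y
    using C(2)[of "y - m"] by (simp add: R_def)
  have [measurable]: "g \<in> borel_measurable borel"
    using times_differentiableD[OF g(1), of "[]"] k by (intro borel_measurable_if_differentiable) simp
  \<comment> \<open>In coordinates the derivative terms of \<open>R\<close> are polynomials in y -
    m, which makes measurability automatic.\<close>
  have Rm[measurable]: "R \<in> borel_measurable borel" unfolding R_def[abs_def] unfolding lin quad by measurable
  obtain C4 where C4: "C4 \<ge> 0" "\<And>n. n \<ge> 1 \<Longrightarrow> integrable (Q n) (\<lambda>y. norm (y - m) ^ 4)"
    "\<And>n. n \<ge> 1 \<Longrightarrow> (\<integral>y. norm (y - m) ^ 4 \<partial>Q n) \<le> C4 * (1 / sqrt (real n)) ^ 4"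
    using mom[of 4] by blast
  obtain Ck where Ck: "Ck \<ge> 0" "\<And>n. n \<ge> 1 \<Longrightarrow> integrable (Q n) (\<lambda>y. norm (y - m) ^ (k + 1))"
    "\<And>n. n \<ge> 1 \<Longrightarrow> (\<integral>y. norm (y - m) ^ (k + 1) \<partial>Q n) \<le> Ck * (1 / sqrt (real n)) ^ (k + 1)"
    using mom[of "k + 1"] by blast
  have decomp: "(y - m) \<bullet> g y = g m \<bullet> (y - m) + (\<Sum>a\<in>UNIV. \<Sum>b\<in>UNIV. ((y - m) $ a * (y - m) $ b) * J a b)
      + (\<Sum>a\<in>UNIV. \<Sum>b\<in>UNIV. \<Sum>c\<in>UNIV. ((y - m) $ a * (y - m) $ b * (y - m) $ c) * T a b c) / 2 + R y" for y
    by (simp only: R_def lin quad inner_commute[of _ "g y"])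
  have main: "integrable (Q n) (\<lambda>y. (y - m) \<bullet> g y) \<and>
      (\<integral>y. (y - m) \<bullet> g y \<partial>Q n) = trace (S ** jacobian g (at m)) / real n
        + (1 / real n)\<^sup>2 * (\<Sum>a\<in>UNIV. \<Sum>b\<in>UNIV. \<Sum>c\<in>UNIV. \<kappa> a b c * T a b c) / 2 + (\<integral>y. R y \<partial>Q n) \<and>
      \<bar>\<integral>y. R y \<partial>Q n\<bar> \<le> C * (C4 + Ck) * (1 / real n)\<^sup>2" if n: "n \<ge> 1" for n
  proof -
    interpret prob_space "Q n" by (rule Q(1)[OF n])
    note [measurable_cong] = Q(2)[of n]
    have intv: "integrable (Q n) (\<lambda>y. y - m)"
    proof (rule integrable_norm_cancel)
      show "integrable (Q n) (\<lambda>y. norm (y - m))" using mom[of 1] n by auto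
    qed simp
    have i1: "integrable (Q n) (\<lambda>y. g m \<bullet> (y - m))" "(\<integral>y. g m \<bullet> (y - m) \<partial>Q n) = 0"
      using intv mean[OF n] integral_inner_right[of "g m" "Q n" "\<lambda>y. y - m"] by auto
    have dom: "integrable (Q n) (\<lambda>y. C * (norm (y - m) ^ 4 + norm (y - m) ^ (k + 1)))"
      using C4(2)[OF n] Ck(2)[OF n] by simp
    have iR: "integrable (Q n) R"
      using R C(1) by (intro Bochner_Integration.integrable_bound[OF dom]) (auto intro!: AE_I2 order_trans[OF R])
    let ?f2 = "\<lambda>y. \<Sum>a\<in>UNIV. \<Sum>b\<in>UNIV. ((y - m) $ a * (y - m) $ b) * J a b"
    let ?f3 = "\<lambda>y. \<Sum>a\<in>UNIV. \<Sum>b\<in>UNIV. \<Sum>c\<in>UNIV. ((y - m) $ a * (y - m) $ b * (y - m) $ c) * T a b c"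
    have cov1: "\<And>a b. integrable (Q n) (\<lambda>y. (y - m) $ a * (y - m) $ b * J a b)"
      and cov2: "\<And>a b. (\<integral>y. (y - m) $ a * (y - m) $ b * J a b \<partial>Q n) = S $ a $ b / real n * J a b"
      using cov[OF n] by (simp_all add: integral_mult_left_zero integrable_mult_left)
    have i2: "integrable (Q n) ?f2"
      using cov1 by (intro Bochner_Integration.integrable_sum)
    have v2: "(\<integral>y. ?f2 y \<partial>Q n) = trace (S ** jacobian g (at m)) / real n"
      using cov1 cov2 by (simp add: Bochner_Integration.integral_sum Bochner_Integration.integrable_sum trace sum_divide_distrib)
    have th1: "\<And>a b c. integrable (Q n) (\<lambda>y. (y - m) $ a * (y - m) $ b * (y - m) $ c * T a b c)"
      and th2: "\<And>a b c. (\<integral>y. (y - m) $ a * (y - m) $ b * (y - m) $ c * T a b c \<partial>Q n) = (1 / real n)\<^sup>2 * \<kappa> a b c * T a b c"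
      using third[OF n] by (simp_all add: integral_mult_left_zero integrable_mult_left)
    have i3: "integrable (Q n) ?f3"
      using th1 by (intro Bochner_Integration.integrable_sum)
    have v3: "(\<integral>y. ?f3 y \<partial>Q n) = (1 / real n)\<^sup>2 * (\<Sum>a\<in>UNIV. \<Sum>b\<in>UNIV. \<Sum>c\<in>UNIV. \<kappa> a b c * T a b c)"
      using th1 th2 by (simp add: Bochner_Integration.integral_sum Bochner_Integration.integrable_sum sum_distrib_left mult.assoc)
    have "\<bar>\<integral>y. R y \<partial>Q n\<bar> \<le> (\<integral>y. C * (norm (y - m) ^ 4 + norm (y - m) ^ (k + 1)) \<partial>Q n)"
      by (intro order_trans[OF integral_abs_bound] integral_mono R dom integrable_abs iR)
    also have "\<dots> = C * ((\<integral>y. norm (y - m) ^ 4 \<partial>Q n) + (\<integral>y. norm (y - m) ^ (k + 1) \<partial>Q n))"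
      using C4(2)[OF n] Ck(2)[OF n] by simp
    also have "\<dots> \<le> C * (C4 * (1 / sqrt (real n)) ^ 4 + Ck * (1 / sqrt (real n)) ^ (k + 1))"
      using C4(3)[OF n] Ck(3)[OF n] C(1) by (intro mult_left_mono add_mono)
    \<comment> \<open>Since k + 1 \<ge> 4 and 1 / sqrt n \<le> 1, the higher moment is brought to
      the rate of the fourth.\<close>
    also have "\<dots> \<le> C * (C4 * (1 / sqrt (real n)) ^ 4 + Ck * (1 / sqrt (real n)) ^ 4)"
      using C(1) Ck(1) k n by (intro mult_left_mono add_left_mono power_decreasing) auto
    also have "(1 / sqrt (real n)) ^ 4 = (1 / real n)\<^sup>2"
      using power_mult[of "1 / sqrt (real n)" 2 2] n by (simp add: power_divide)
    finally have vR: "\<bar>\<integral>y. R y \<partial>Q n\<bar> \<le> C * (C4 + Ck) * (1 / real n)\<^sup>2" by (simp add: algebra_simps)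
    have "integrable (Q n) (\<lambda>y. (y - m) \<bullet> g y)"
      unfolding decomp by (intro Bochner_Integration.integrable_add integrable_divide i1 i2 i3 iR)
    moreover have "(\<integral>y. (y - m) \<bullet> g y \<partial>Q n)
        = (\<integral>y. g m \<bullet> (y - m) \<partial>Q n) + (\<integral>y. ?f2 y \<partial>Q n) + (\<integral>y. ?f3 y \<partial>Q n) / 2 + (\<integral>y. R y \<partial>Q n)"
      unfolding decomp
      by (subst Bochner_Integration.integral_add, intro Bochner_Integration.integrable_add integrable_divide i1 i2 i3, rule iR,
          subst Bochner_Integration.integral_add, intro Bochner_Integration.integrable_add i1 i2, rule integrable_divide, rule i3,
          subst Bochner_Integration.integral_add, rule i1, rule i2, simp only: integral_divide_zero)
    ultimately show ?thesis using vR by (simp only: i1(2) v2 v3) simp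
  qed
  then show "n \<ge> 1 \<Longrightarrow> integrable (Q n) (\<lambda>y. (y - m) \<bullet> g y)" by blast
  let ?k = "\<Sum>a\<in>UNIV. \<Sum>b\<in>UNIV. \<Sum>c\<in>UNIV. \<kappa> a b c * T a b c"
  have "\<forall>\<^sub>F n in sequentially. norm (real n * (\<integral>y. (y - m) \<bullet> g y \<partial>Q n) - trace (S ** jacobian g (at m)))
      \<le> (\<bar>?k\<bar> / 2 + C * (C4 + Ck)) * norm (1 / real n)"
    using eventually_ge_at_top[of 1]
  proof eventually_elim
    case (elim n)
    note M = main[OF elim]
    have "real n * (\<integral>y. (y - m) \<bullet> g y \<partial>Q n) - trace (S ** jacobian g (at m))
        = (1 / real n) * ?k / 2 + real n * (\<integral>y. R y \<partial>Q n)"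
      using M elim by (simp add: distrib_left power2_eq_square)
    also have "\<bar>\<dots>\<bar> \<le> (1 / real n) * \<bar>?k\<bar> / 2 + real n * (C * (C4 + Ck) * (1 / real n)\<^sup>2)"
    proof (rule order_trans[OF abs_triangle_ineq], rule add_mono)
      show "\<bar>real n * (\<integral>y. R y \<partial>Q n)\<bar> \<le> real n * (C * (C4 + Ck) * (1 / real n)\<^sup>2)"
        using M by (simp only: abs_mult abs_of_nat) (intro mult_left_mono; simp)
    qed (simp add: abs_mult)
    also have "\<dots> = (\<bar>?k\<bar> / 2 + C * (C4 + Ck)) * norm (1 / real n)"
      using elim by (simp add: power2_eq_square field_simps)
    finally show ?case by simp
  qed
  then show "(\<lambda>n. real n * (\<integral>y. (y - m) \<bullet> g y \<partial>Q n) - trace (S ** jacobian g (at m))) \<in> O(\<lambda>n. 1 / real n)"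
    by (rule bigoI)
qed

section \<open>The loss estimator\<close>

lemma trace_term_eq:
  "trace_term \<Lambda> g y = (\<Sum>i\<in>UNIV. \<Sum>j\<in>UNIV. \<Lambda> y $ i $ j * total_deriv g [axis i 1] y $ j)"
  by (simp add: trace_term_def trace_def matrix_matrix_mult_def jacobian_def matrix_def)

text \<open>The factor 1 / n of the variance function cancels the factor n of the estimator, so one
  fixed function is integrated against all the laws.\<close>

lemma trace_term_scaled:
  fixes g :: "real^'n \<Rightarrow> real^'n"
  assumes "n \<ge> 1" and "g differentiable (at y)"
  shows "trace_term (\<lambda>y. (1 / real n) *\<^sub>R \<Lambda> y) (\<lambda>y. real n *\<^sub>R g y) y = trace_term \<Lambda> g y"
proof -
  have "((\<lambda>y. real n *\<^sub>R g y) has_derivative (\<lambda>v. real n *\<^sub>R frechet_derivative g (at y) v)) (at y)"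
    using assms(2) by (intro has_derivative_scaleR_right) (simp add: frechet_derivative_works)
  from frechet_derivative_at[OF this, symmetric] show ?thesis
    using assms(1) by (simp add: trace_term_eq)
qed

text \<open>The trace is a sum of products of entries of \<Lambda> and first derivatives of g.
  Expanding the latter to second order takes three derivatives of g, one source of the condition k
  \<ge> 3.\<close>

lemma second_order_at_trace_term:
  fixes \<Lambda> :: "real^'n \<Rightarrow> real^'n^'n"
  assumes \<Lambda>: "times_differentiable 2 \<Lambda>" and g: "times_differentiable 3 g"
  shows "\<exists>L. second_order_at (trace_term \<Lambda> g) L m"
proof -
  have 1: "second_order_at (\<lambda>y. \<Lambda> y $ i $ j) (\<lambda>v. frechet_derivative \<Lambda> (at m) v $ i $ j) m" for i j
    by (intro second_order_at_compose_bounded_linear[where T = "\<lambda>B. B $ i $ j"]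
        times_differentiable_imp_second_order_at \<Lambda> bounded_linear_compose[OF bounded_linear_vec_nth bounded_linear_vec_nth])
  have "times_differentiable 2 (total_deriv g [axis i 1])" for i
    using times_differentiable_total_deriv[OF g, of "[axis i 1]"] by simp
  then have 2: "second_order_at (\<lambda>y. total_deriv g [axis i 1] y $ j)
      (\<lambda>v. frechet_derivative (total_deriv g [axis i 1]) (at m) v $ j) m" for i j
    by (intro second_order_at_compose_bounded_linear[where T = "\<lambda>u. u $ j"]
        times_differentiable_imp_second_order_at bounded_linear_vec_nth)
  have "second_order_at (\<lambda>y. \<Sum>i\<in>UNIV. \<Sum>j\<in>UNIV. \<Lambda> y $ i $ j * total_deriv g [axis i 1] y $ j)
    (\<lambda>v. \<Sum>i\<in>UNIV. \<Sum>j\<in>UNIV. \<Lambda> m $ i $ j * (frechet_derivative (total_deriv g [axis i 1]) (at m) v $ j)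
        + (frechet_derivative \<Lambda> (at m) v $ i $ j) * total_deriv g [axis i 1] m $ j) m"
    by (intro second_order_at_sum second_order_at_mult 1 2)
  then show ?thesis unfolding trace_term_eq[abs_def] by blast
qed

lemma borel_measurable_trace_term:
  fixes \<Lambda> :: "real^'n \<Rightarrow> real^'n^'n"
  assumes \<Lambda>: "times_differentiable 1 \<Lambda>" and g: "times_differentiable 2 g"
  shows "trace_term \<Lambda> g \<in> borel_measurable borel"
proof -
  have "(\<lambda>y. \<Lambda> y $ i $ j) \<in> borel_measurable borel" for i j
  proof (rule borel_measurable_if_differentiable)
    fix y
    have "(\<Lambda> has_derivative frechet_derivative \<Lambda> (at y)) (at y)"
      using times_differentiableD[OF \<Lambda>, of "[]" y] by (simp add: frechet_derivative_works)
    then show "(\<lambda>y. \<Lambda> y $ i $ j) differentiable (at y)"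
      by (intro differentiableI[of _ "\<lambda>v. frechet_derivative \<Lambda> (at y) v $ i $ j"]
          bounded_linear.has_derivative[OF bounded_linear_vec_nth])
  qed
  moreover have "(\<lambda>y. total_deriv g [axis i 1] y $ j) \<in> borel_measurable borel" for i j
    using times_differentiableD[OF g, of "[axis i 1]"]
    by (intro borel_measurable_vec_nth borel_measurable_if_differentiable) simp
  ultimately show ?thesis
    unfolding trace_term_eq[abs_def] by (intro borel_measurable_sum borel_measurable_times)
qed

text \<open>The log-partition values at the estimate and at the true parameter cancel, and so do the
  pairings with the true parameter. Thus A composed with the estimator disappears before any
  expectation is expanded.\<close>

lemma DKLA_minus_KLA_loss:
  fixes g :: "real^'n \<Rightarrow> real^'n"
  assumes n: "n \<ge> 1" and g: "g differentiable (at y)"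
  shows "DKLA (scaled_log_partition A n) (\<lambda>y. (1 / real n) *\<^sub>R \<Lambda> y) (\<lambda>y. real n *\<^sub>R g y) y
    - (KLA_loss (scaled_log_partition A n) (real n *\<^sub>R \<theta>) (\<lambda>y. real n *\<^sub>R g y) y
      - grad A \<theta> \<bullet> (real n *\<^sub>R \<theta>) + scaled_log_partition A n (real n *\<^sub>R \<theta>))
    = trace_term \<Lambda> g y - real n * ((y - grad A \<theta>) \<bullet> g y)"
  using n unfolding DKLA_def KLA_loss_def trace_term_scaled[OF assms] grad_scaled_log_partition[OF n]
  by (simp add: algebra_simps)

lemma integrable_norm_diff_power3:
  fixes P :: "'a::euclidean_space measure"
  assumes "finite_measure P" "sets P = sets borel" "integrable P (\<lambda>y. norm y ^ 3)"
  shows "integrable P (\<lambda>y. norm (y - m) ^ 3)"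
proof (rule Bochner_Integration.integrable_bound)
  interpret finite_measure P by fact
  show "integrable P (\<lambda>y. 8 * (norm y ^ 3 + norm m ^ 3))" using assms(3) by simp
  have "norm (y - m) ^ 3 \<le> 8 * (norm y ^ 3 + norm m ^ 3)" for y
  proof -
    have "norm (y - m) ^ 3 \<le> (2 * max (norm y) (norm m)) ^ 3"
      using norm_triangle_ineq4[of y m] by (intro power_mono) auto
    also have "\<dots> = 8 * max (norm y) (norm m) ^ 3" by (simp add: power_mult_distrib)
    also have "max (norm y) (norm m) ^ 3 \<le> norm y ^ 3 + norm m ^ 3"
      by (simp add: max_def)
    finally show ?thesis by simp
  qed
  then show "AE y in P. norm (norm (y - m) ^ 3) \<le> norm (8 * (norm y ^ 3 + norm m ^ 3))" by auto
  show "(\<lambda>y. norm (y - m) ^ 3) \<in> borel_measurable P"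
    unfolding measurable_cong_sets[OF assms(2) refl] by simp
qed

lemma limsup_less_infinity_imp_bounded:
  fixes f :: "nat \<Rightarrow> ennreal"
  assumes "limsup f < \<infinity>"
  shows "\<exists>B. \<forall>\<^sub>F n in sequentially. f n \<le> ennreal B"
proof -
  obtain r where r: "r \<ge> 0" "limsup f = ennreal r" using assms by (cases "limsup f") auto
  then have "limsup f < ennreal (r + 1)" by (simp add: ennreal_less_iff)
  then have "\<forall>\<^sub>F n in sequentially. f n < ennreal (r + 1)" by (rule Limsup_lessD)
  then have "\<forall>\<^sub>F n in sequentially. f n \<le> ennreal (r + 1)" by eventually_elim simp
  then show ?thesis by blast
qed

text \<open>Reference measures and carriers are obtained from the law of the observations before any
  estimator is given, so one choice serves all estimators. The expansion then concerns the laws of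
  the means, to which the expectations over M are transferred.\<close>

theorem theorem4p3:
  fixes M :: "'w measure"
    and Z :: "nat \<Rightarrow> 'w \<Rightarrow> real^'n"
    and \<nu> :: "(real^'n) measure"
    and h A :: "real^'n \<Rightarrow> real"
    and \<Theta> :: "(real^'n) set"
    and \<theta> \<mu> :: "real^'n"
    and \<Lambda> :: "real^'n \<Rightarrow> real^'n^'n"
    and k :: nat
  assumes k: "k \<ge> 3"
    and M: "prob_space M"
    and family: "natural_exp_family \<nu> h \<Theta> A"
    and \<theta>: "\<theta> \<in> \<Theta>"
    and indep: "prob_space.indep_vars M (\<lambda>_. borel) Z {1..}"
    and law: "\<And>i. i \<ge> 1 \<Longrightarrow> distr M borel (Z i) = nef_law \<nu> h A \<theta>"
    and moments: "\<And>i j. i \<ge> 1 \<Longrightarrow> j \<le> k \<Longrightarrow> integrable M (\<lambda>\<omega>. norm (Z i \<omega>) ^ j)"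
    and mean: "\<And>i. i \<ge> 1 \<Longrightarrow> (\<integral>\<omega>. Z i \<omega> \<partial>M) = \<mu>"
    and variance: "is_variance_function \<Theta> A \<Lambda>"
    and smooth: "smooth \<Lambda>"
  shows
    "let Y = sample_mean Z;
         \<theta>\<^sub>n = (\<lambda>n. real n *\<^sub>R \<theta>);
         \<Theta>\<^sub>n = (\<lambda>n. (\<lambda>\<eta>. real n *\<^sub>R \<eta>) ` \<Theta>);
         A\<^sub>n = scaled_log_partition A;
         \<Lambda>\<^sub>n = (\<lambda>n y. (1 / real n) *\<^sub>R \<Lambda> y)
     in \<exists>\<nu>\<^sub>n h\<^sub>n.
       (\<forall>n\<ge>1.
          natural_exp_family (\<nu>\<^sub>n n) (h\<^sub>n n) (\<Theta>\<^sub>n n) (A\<^sub>n n) \<and>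
          distr M borel (Y n) = nef_law (\<nu>\<^sub>n n) (h\<^sub>n n) (A\<^sub>n n) (\<theta>\<^sub>n n) \<and>
          (\<integral>\<omega>. Y n \<omega> \<partial>M) = \<mu> \<and>
          is_variance_function (\<Theta>\<^sub>n n) (A\<^sub>n n) (\<Lambda>\<^sub>n n)) \<and>
       (\<forall>\<theta>hat :: real^'n \<Rightarrow> real^'n.
          let T = (\<lambda>n y. real n *\<^sub>R \<theta>hat y);
              DKLA\<^sub>n = (\<lambda>n \<omega>. DKLA (A\<^sub>n n) (\<Lambda>\<^sub>n n) (T n) (Y n \<omega>));
              KLA\<^sub>n = (\<lambda>n \<omega>. KLA_loss (A\<^sub>n n) (\<theta>\<^sub>n n) (T n) (Y n \<omega>));
              MKLA\<^sub>n = (\<lambda>n. \<integral>\<omega>. KLA\<^sub>n n \<omega> \<partial>M)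
          in (\<forall>y. \<theta>hat y \<in> \<Theta>) \<longrightarrow>
             times_differentiable k \<theta>hat \<longrightarrow>
             bounded_total_deriv k \<theta>hat \<longrightarrow>
             (\<forall>n\<ge>1. integrable M (DKLA\<^sub>n n) \<and> integrable M (KLA\<^sub>n n)) \<longrightarrow>
             (\<forall>n\<ge>1. MKLA\<^sub>n n =
                (\<integral>\<omega>. KL_divergence (exp 1) (nef_law (\<nu>\<^sub>n n) (h\<^sub>n n) (A\<^sub>n n) (T n (Y n \<omega>)))
                        (nef_law (\<nu>\<^sub>n n) (h\<^sub>n n) (A\<^sub>n n) (\<theta>\<^sub>n n)) \<partial>M)) \<and>
             (\<forall>p>1.
                limsup (\<lambda>n. \<integral>\<^sup>+\<omega>. ennreal (\<bar>trace_term (\<Lambda>\<^sub>n n) (T n) (Y n \<omega>)\<bar> powr p) \<partial>M) < \<infinity> \<longrightarrow>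
                (\<lambda>n. (\<integral>\<omega>. DKLA\<^sub>n n \<omega> \<partial>M) - (MKLA\<^sub>n n - \<mu> \<bullet> \<theta>\<^sub>n n + A\<^sub>n n (\<theta>\<^sub>n n)))
                  \<in> O(\<lambda>n. 1 / real n)))"
proof -
  interpret prob_space M by (rule M)
  note F = natural_exp_familyD[OF family]
  define P where "P = nef_law \<nu> h A \<theta>"
  define Q where "Q n = mean_law n P" for n
  let ?Y = "sample_mean Z" and ?A = "scaled_log_partition A"
  let ?\<Lambda> = "\<lambda>n y. (1 / real n) *\<^sub>R \<Lambda> y"
  have P: "prob_space P" "sets P = sets borel"
    using F(6)[OF \<theta>] sets_nef_law[OF F(1)] by (simp_all add: P_def)
  interpret P: prob_space P by (rule P(1))
  have rv: "Z i \<in> borel_measurable M" if "i \<ge> 1" for i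
    using indep that by (auto simp: indep_vars_def)
  have ind: "indep_vars (\<lambda>_. borel) Z {1..n}" for n
    by (rule indep_vars_subset[OF indep]) auto
  have lawP: "distr M borel (Z i) = P" if "i \<in> {1..n}" for i n
    using law that by (simp add: P_def)
  have Ym: "?Y n \<in> borel_measurable M" for n
    by (intro measurable_sample_mean rv) simp
  have Y: "distr M borel (?Y n) = Q n" if "n \<ge> 1" for n
    unfolding Q_def by (rule distr_sample_mean[OF that ind lawP])
  have Q: "prob_space (Q n)" "sets (Q n) = sets borel" for n
    using prob_space_mean_law[OF P] by (simp_all add: Q_def)
  have \<mu>: "Defs.mean P = \<mu>"
  proof -
    have "(\<integral>\<omega>. Z 1 \<omega> \<partial>M) = (\<integral>y. y \<partial>distr M borel (Z 1))"
      by (subst integral_distr) (use rv in auto)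
    then show ?thesis using mean[of 1] lawP[of 1 1] by (simp add: Defs.mean_def)
  qed
  have grad: "grad A \<theta> = \<mu>" using F(12)[OF \<theta>] \<mu> by (simp add: P_def)
  have int2: "integrable P (\<lambda>y. (norm y)\<^sup>2)" using F(11)[OF \<theta>] by (simp add: P_def)
  note momQ = mean_law_moments[OF _ P int2]
  have mom: "\<exists>C\<ge>0. \<forall>n\<ge>1. integrable (Q n) (\<lambda>y. norm (y - \<mu>) ^ r) \<and>
      (\<integral>y. norm (y - \<mu>) ^ r \<partial>Q n) \<le> C * (1 / sqrt (real n)) ^ r" for r
    using mean_law_norm_power_bound[OF family \<theta>, of r] unfolding Q_def P_def grad .
  have meanY: "(\<integral>\<omega>. ?Y n \<omega> \<partial>M) = \<mu>" if n: "n \<ge> 1" for n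
  proof -
    have "(\<integral>\<omega>. ?Y n \<omega> \<partial>M) = (\<integral>y. y \<partial>distr M borel (?Y n))"
      by (subst integral_distr) (use Ym in auto)
    then show ?thesis using momQ(2)[OF n] Y[OF n] \<mu> by (simp add: Defs.mean_def Q_def)
  qed
  \<comment> \<open>The guard inside the existential makes n = 0 vacuous, so the witnesses can be
    chosen as functions on all natural numbers.\<close>
  have "\<forall>n. \<exists>\<nu>' h'. n \<ge> 1 \<longrightarrow> natural_exp_family \<nu>' h' ((\<lambda>\<eta>. real n *\<^sub>R \<eta>) ` \<Theta>) (?A n) \<and>
      (\<forall>\<eta>\<in>\<Theta>. nef_law \<nu>' h' (?A n) (real n *\<^sub>R \<eta>) = mean_law n (nef_law \<nu> h A \<eta>))"
    using natural_exp_family_mean_law[OF family \<theta>] by blast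
  then obtain \<nu>' h' where fam: "\<And>n. n \<ge> 1 \<Longrightarrow> natural_exp_family (\<nu>' n) (h' n) ((\<lambda>\<eta>. real n *\<^sub>R \<eta>) ` \<Theta>) (?A n)"
    and famlaw: "\<And>n \<eta>. n \<ge> 1 \<Longrightarrow> \<eta> \<in> \<Theta> \<Longrightarrow> nef_law (\<nu>' n) (h' n) (?A n) (real n *\<^sub>R \<eta>) = mean_law n (nef_law \<nu> h A \<eta>)"
    by metis
  have part1: "natural_exp_family (\<nu>' n) (h' n) ((\<lambda>\<eta>. real n *\<^sub>R \<eta>) ` \<Theta>) (?A n) \<and>
      distr M borel (?Y n) = nef_law (\<nu>' n) (h' n) (?A n) (real n *\<^sub>R \<theta>) \<and> (\<integral>\<omega>. ?Y n \<omega> \<partial>M) = \<mu> \<and>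
      is_variance_function ((\<lambda>\<eta>. real n *\<^sub>R \<eta>) ` \<Theta>) (?A n) (?\<Lambda> n)" if n: "n \<ge> 1" for n
    using fam[OF n] famlaw[OF n \<theta>] Y[OF n] meanY[OF n] is_variance_function_scaled[OF F(10,9) variance n]
    by (simp add: Q_def P_def)
  \<comment> \<open>\<mu> is the image of \<theta> under the gradient map; injectivity identifies
    the value of the variance function there with the covariance of one observation.\<close>
  have \<Lambda>\<mu>: "\<Lambda> \<mu> = covariance_matrix P"
  proof -
    have "\<Lambda> \<mu> = hessian A (the_inv_into \<Theta> (grad A) \<mu>)"
      using variance \<theta> unfolding is_variance_function_def grad[symmetric] by blast
    also have "the_inv_into \<Theta> (grad A) \<mu> = \<theta>" using the_inv_into_f_f[OF F(10) \<theta>] by (simp add: grad)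
    finally show ?thesis using F(13)[OF \<theta>] by (simp add: P_def)
  qed
  have Q0: "(\<integral>y. y - \<mu> \<partial>Q n) = 0" if n: "n \<ge> 1" for n
  proof -
    interpret Q: prob_space "Q n" by (rule Q(1))
    have "integrable (Q n) (\<lambda>y. norm y ^ 1)"
      using momQ(1)[OF n] _ unfolding Q_def by (rule prob_space.integrable_norm_power_le[OF prob_space_mean_law[OF P]]) auto
    then have "integrable (Q n) (\<lambda>y. y)"
      by (intro integrable_norm_cancel[of _ "\<lambda>y. y"]) (simp_all add: Q_def)
    then show ?thesis using momQ(2)[OF n] \<mu> by (simp add: Defs.mean_def Q_def[symmetric] Q.prob_space)
  qed
  have cov: "integrable (Q n) (\<lambda>y. (y - \<mu>) $ a * (y - \<mu>) $ b) \<and>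
      (\<integral>y. (y - \<mu>) $ a * (y - \<mu>) $ b \<partial>Q n) = \<Lambda> \<mu> $ a $ b / real n" if n: "n \<ge> 1" for n a b
  proof
    have "integrable (Q n) (\<lambda>y. norm (y - \<mu>) ^ 2)" using mom[of 2] n by blast
    then show "integrable (Q n) (\<lambda>y. (y - \<mu>) $ a * (y - \<mu>) $ b)"
    proof (rule Bochner_Integration.integrable_bound)
      show "(\<lambda>y. (y - \<mu>) $ a * (y - \<mu>) $ b) \<in> borel_measurable (Q n)" unfolding Q_def by measurable
    qed (auto simp: power2_eq_square abs_mult simp del: vector_minus_component intro!: mult_mono component_le_norm_cart)
    have "covariance_matrix (Q n) $ a $ b = (\<integral>y. (y - \<mu>) $ a * (y - \<mu>) $ b \<partial>Q n)"
      using momQ(2)[OF n] \<mu> by (simp add: covariance_matrix_def Q_def)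
    then show "(\<integral>y. (y - \<mu>) $ a * (y - \<mu>) $ b \<partial>Q n) = \<Lambda> \<mu> $ a $ b / real n"
      using momQ(3)[OF n] by (simp add: \<Lambda>\<mu> Q_def)
  qed
  have intP: "integrable P (\<lambda>y. y)"
  proof (rule integrable_norm_cancel)
    show "integrable P (\<lambda>y. norm y)"
      using P.integrable_norm_power_le[OF int2, of 1] by (simp add: measurable_cong_sets[OF P(2) refl])
  qed (simp add: measurable_cong_sets[OF P(2) refl])
  \<comment> \<open>Order 3 is covered by the moment hypothesis since k \<ge> 3.\<close>
  have int3: "integrable P (\<lambda>y. norm (y - \<mu>) ^ 3)"
  proof -
    have "integrable (distr M borel (Z 1)) (\<lambda>y. norm y ^ 3)"
      using moments[of 1 3] k rv[of 1] by (subst integrable_distr_eq) auto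
    then show ?thesis
      using lawP[of 1 1] P(2) P.finite_measure_axioms by (intro integrable_norm_diff_power3) auto
  qed
  define \<kappa> where "\<kappa> a b c = (\<integral>y. (y - \<mu>) $ a * (y - \<mu>) $ b * (y - \<mu>) $ c \<partial>P)" for a b c
  have third: "integrable (Q n) (\<lambda>y. (y - \<mu>) $ a * (y - \<mu>) $ b * (y - \<mu>) $ c) \<and>
      (\<integral>y. (y - \<mu>) $ a * (y - \<mu>) $ b * (y - \<mu>) $ c \<partial>Q n) = (1 / real n)\<^sup>2 * \<kappa> a b c"
    if n: "n \<ge> 1" for n a b c
    unfolding Q_def \<kappa>_def \<mu>[symmetric]
    by (intro conjI sample_mean_third_moment[OF n ind] lawP intP int3[folded \<mu>])
  have part2: "(\<forall>n\<ge>1. (\<integral>\<omega>. KLA_loss (?A n) (real n *\<^sub>R \<theta>) (\<lambda>y. real n *\<^sub>R g y) (?Y n \<omega>) \<partial>M) =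
        (\<integral>\<omega>. KL_divergence (exp 1) (nef_law (\<nu>' n) (h' n) (?A n) (real n *\<^sub>R g (?Y n \<omega>)))
          (nef_law (\<nu>' n) (h' n) (?A n) (real n *\<^sub>R \<theta>)) \<partial>M))"
    if g: "\<And>y. g y \<in> \<Theta>" for g
  proof (intro allI impI)
    fix n :: nat assume n: "n \<ge> 1"
    have "KLA_loss (?A n) (real n *\<^sub>R \<theta>) (\<lambda>y. real n *\<^sub>R g y) y =
        KL_divergence (exp 1) (nef_law (\<nu>' n) (h' n) (?A n) (real n *\<^sub>R g y))
          (nef_law (\<nu>' n) (h' n) (?A n) (real n *\<^sub>R \<theta>))" for y
      unfolding KLA_loss_def using KL_divergence_nef_law[OF fam[OF n] imageI[OF \<theta>] imageI[OF g]] by simp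
    then show "(\<integral>\<omega>. KLA_loss (?A n) (real n *\<^sub>R \<theta>) (\<lambda>y. real n *\<^sub>R g y) (?Y n \<omega>) \<partial>M) =
        (\<integral>\<omega>. KL_divergence (exp 1) (nef_law (\<nu>' n) (h' n) (?A n) (real n *\<^sub>R g (?Y n \<omega>)))
          (nef_law (\<nu>' n) (h' n) (?A n) (real n *\<^sub>R \<theta>)) \<partial>M)"
      by simp
  qed
  have part3: "(\<lambda>n. (\<integral>\<omega>. DKLA (?A n) (?\<Lambda> n) (\<lambda>y. real n *\<^sub>R g y) (?Y n \<omega>) \<partial>M)
      - ((\<integral>\<omega>. KLA_loss (?A n) (real n *\<^sub>R \<theta>) (\<lambda>y. real n *\<^sub>R g y) (?Y n \<omega>) \<partial>M)
        - \<mu> \<bullet> (real n *\<^sub>R \<theta>) + ?A n (real n *\<^sub>R \<theta>))) \<in> O(\<lambda>n. 1 / real n)"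
    if g: "times_differentiable k g" "bounded_total_deriv k g"
      and int: "\<And>n. n \<ge> 1 \<Longrightarrow> integrable M (\<lambda>\<omega>. DKLA (?A n) (?\<Lambda> n) (\<lambda>y. real n *\<^sub>R g y) (?Y n \<omega>))"
        "\<And>n. n \<ge> 1 \<Longrightarrow> integrable M (\<lambda>\<omega>. KLA_loss (?A n) (real n *\<^sub>R \<theta>) (\<lambda>y. real n *\<^sub>R g y) (?Y n \<omega>))"
      and p: "p > 1" and lim: "limsup (\<lambda>n. \<integral>\<^sup>+\<omega>. ennreal (\<bar>trace_term (?\<Lambda> n) (\<lambda>y. real n *\<^sub>R g y) (?Y n \<omega>)\<bar> powr p) \<partial>M) < \<infinity>"
    for g p
  proof -
    let ?F = "trace_term \<Lambda> g"
    have gdiff: "g differentiable (at y)" for y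
      using times_differentiableD[OF g(1), of "[]"] k by simp
    have g3: "times_differentiable 3 g" by (rule times_differentiable_mono[OF g(1) k])
    have \<Lambda>2: "times_differentiable 2 \<Lambda>" using smooth by (simp add: smooth_def)
    have Fm: "?F \<in> borel_measurable borel"
      by (intro borel_measurable_trace_term times_differentiable_mono[OF g3] times_differentiable_mono[OF \<Lambda>2]) auto
    obtain L where L: "second_order_at ?F L \<mu>" using second_order_at_trace_term[OF \<Lambda>2 g3] by blast
    have intg: "integrable (Q n) (\<lambda>y. (y - \<mu>) \<bullet> g y)" if "n \<ge> 1" for n
      by (rule expectation_inner_expansion(1)[OF Q mom Q0 cov third g k]) (use that in auto)
    have gm: "(\<lambda>y. (y - \<mu>) \<bullet> g y) \<in> borel_measurable borel"
      using borel_measurable_if_differentiable[OF gdiff] by measurable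
    have diff: "DKLA (?A n) (?\<Lambda> n) (\<lambda>y. real n *\<^sub>R g y) y
        - (KLA_loss (?A n) (real n *\<^sub>R \<theta>) (\<lambda>y. real n *\<^sub>R g y) y - \<mu> \<bullet> (real n *\<^sub>R \<theta>) + ?A n (real n *\<^sub>R \<theta>))
      = ?F y - real n * ((y - \<mu>) \<bullet> g y)" if "n \<ge> 1" for n y
      using DKLA_minus_KLA_loss[OF that gdiff, where A = A and \<Lambda> = \<Lambda> and y = y and \<theta> = \<theta>] unfolding grad .
    have intdiff: "integrable M (\<lambda>\<omega>. ?F (?Y n \<omega>) - real n * ((?Y n \<omega> - \<mu>) \<bullet> g (?Y n \<omega>)))"
      and eqdiff: "(\<integral>\<omega>. DKLA (?A n) (?\<Lambda> n) (\<lambda>y. real n *\<^sub>R g y) (?Y n \<omega>) \<partial>M)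
      - ((\<integral>\<omega>. KLA_loss (?A n) (real n *\<^sub>R \<theta>) (\<lambda>y. real n *\<^sub>R g y) (?Y n \<omega>) \<partial>M)
        - \<mu> \<bullet> (real n *\<^sub>R \<theta>) + ?A n (real n *\<^sub>R \<theta>))
      = (\<integral>\<omega>. ?F (?Y n \<omega>) - real n * ((?Y n \<omega> - \<mu>) \<bullet> g (?Y n \<omega>)) \<partial>M)" if n: "n \<ge> 1" for n
      unfolding diff[OF n, symmetric] using int[OF n] by (simp_all add: prob_space)
    \<comment> \<open>Finite expectations are assumed for DKLA and for the loss. Their difference
      is, up to a constant, the trace term minus an integrable inner product, so the trace term is
      integrable as well.\<close>
    have intF: "integrable (Q n) ?F" if n: "n \<ge> 1" for n
    proof -
      have "integrable (distr M borel (?Y n)) (\<lambda>y. ?F y - real n * ((y - \<mu>) \<bullet> g y))"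
        using intdiff[OF n] Fm gm by (subst integrable_distr_eq[OF Ym]) auto
      then have "integrable (Q n) (\<lambda>y. (?F y - real n * ((y - \<mu>) \<bullet> g y)) + real n * ((y - \<mu>) \<bullet> g y))"
        unfolding Y[OF n] by (intro Bochner_Integration.integrable_add integrable_mult_right intg[OF n])
      then show ?thesis by simp
    qed
    obtain B where "\<forall>\<^sub>F n in sequentially.
        (\<integral>\<^sup>+\<omega>. ennreal (\<bar>trace_term (?\<Lambda> n) (\<lambda>y. real n *\<^sub>R g y) (?Y n \<omega>)\<bar> powr p) \<partial>M) \<le> ennreal B"
      using limsup_less_infinity_imp_bounded[OF lim] by blast
    then have B: "\<forall>\<^sub>F n in sequentially. (\<integral>\<^sup>+y. ennreal (\<bar>?F y\<bar> powr p) \<partial>Q n) \<le> ennreal B"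
      using eventually_ge_at_top[of 1]
    proof eventually_elim
      case (elim n)
      have "(\<integral>\<^sup>+y. ennreal (\<bar>?F y\<bar> powr p) \<partial>Q n) = (\<integral>\<^sup>+\<omega>. ennreal (\<bar>?F (?Y n \<omega>)\<bar> powr p) \<partial>M)"
        unfolding Y[OF elim(2), symmetric] using Fm by (intro nn_integral_distr Ym) measurable
      then show ?case using elim(1) by (simp only: trace_term_scaled[OF elim(2) gdiff])
    qed
    have T2: "(\<lambda>n. (\<integral>y. ?F y \<partial>Q n) - ?F \<mu>) \<in> O(\<lambda>n. 1 / real n)"
      by (rule expectation_expansion_second_order[OF Q mom Q0 L intF p B])
    \<comment> \<open>Unfolding turns the centre of the expansion into the trace with covariance
      \<open>\<Lambda> \<mu>\<close> and the Jacobian at \<mu>, the same number as in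
      \<open>T2\<close>.\<close>
    have T1: "(\<lambda>n. real n * (\<integral>y. (y - \<mu>) \<bullet> g y \<partial>Q n) - ?F \<mu>) \<in> O(\<lambda>n. 1 / real n)"
      unfolding trace_term_def
      by (rule expectation_inner_expansion(2)[OF Q mom Q0 cov third g k])
    have "\<forall>\<^sub>F n in sequentially. (\<integral>\<omega>. DKLA (?A n) (?\<Lambda> n) (\<lambda>y. real n *\<^sub>R g y) (?Y n \<omega>) \<partial>M)
      - ((\<integral>\<omega>. KLA_loss (?A n) (real n *\<^sub>R \<theta>) (\<lambda>y. real n *\<^sub>R g y) (?Y n \<omega>) \<partial>M)
        - \<mu> \<bullet> (real n *\<^sub>R \<theta>) + ?A n (real n *\<^sub>R \<theta>))
      = ((\<integral>y. ?F y \<partial>Q n) - ?F \<mu>) - (real n * (\<integral>y. (y - \<mu>) \<bullet> g y \<partial>Q n) - ?F \<mu>)"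
      using eventually_ge_at_top[of 1]
    proof eventually_elim
      case (elim n)
      have "(\<integral>\<omega>. ?F (?Y n \<omega>) - real n * ((?Y n \<omega> - \<mu>) \<bullet> g (?Y n \<omega>)) \<partial>M)
          = (\<integral>y. ?F y - real n * ((y - \<mu>) \<bullet> g y) \<partial>Q n)"
        unfolding Y[OF elim, symmetric] using Fm gm by (subst integral_distr[OF Ym]) auto
      also have "\<dots> = (\<integral>y. ?F y \<partial>Q n) - real n * (\<integral>y. (y - \<mu>) \<bullet> g y \<partial>Q n)"
        using intF[OF elim] intg[OF elim] by simp
      finally show ?case using eqdiff[OF elim] by simp
    qed
    from landau_o.big.in_cong[OF this, THEN iffD2, OF sum_in_bigo(2)[OF T2 T1]] show ?thesis .
  qed
  show ?thesis
    unfolding Let_def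
  proof (rule exI[of _ \<nu>'], rule exI[of _ h'], rule conjI, goal_cases)
    case 1
    show ?case using part1 by blast
  next
    case 2
    show ?case
    proof (intro allI impI, rule conjI, goal_cases)
      case (1 g)
      then show ?case by (intro part2) blast
    next
      case (2 g)
      show ?case
      proof (intro allI impI)
        fix p :: real
        assume "p > 1" "limsup (\<lambda>n. \<integral>\<^sup>+\<omega>. ennreal (\<bar>trace_term (?\<Lambda> n) (\<lambda>y. real n *\<^sub>R g y) (?Y n \<omega>)\<bar> powr p) \<partial>M) < \<infinity>"
        with 2 show "(\<lambda>n. (\<integral>\<omega>. DKLA (?A n) (?\<Lambda> n) (\<lambda>y. real n *\<^sub>R g y) (?Y n \<omega>) \<partial>M)
          - ((\<integral>\<omega>. KLA_loss (?A n) (real n *\<^sub>R \<theta>) (\<lambda>y. real n *\<^sub>R g y) (?Y n \<omega>) \<partial>M)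
            - \<mu> \<bullet> (real n *\<^sub>R \<theta>) + ?A n (real n *\<^sub>R \<theta>))) \<in> O(\<lambda>n. 1 / real n)"
          by (intro part3) auto
      qed
    qed
  qed
qed

end
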